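(* Let $E$ be a unital Banach algebra, $a<b$, and let $A:[a,b]\to E$ be a right regulated mapping. Given an arbitrary $\varepsilon>0$, let $\Lambda_\varepsilon\subset[a,b]$ be the well-ordered set associated with $A$ and $\varepsilon$ (defined in the context). Then the following properties are equivalent: 1. $A$ is strongly McShane product integrable. 2. $A$ is Bochner integrable. 3. The step mapping $A_\varepsilon:[a,b]\to E$ given by $A_\varepsilon(t)=A(\beta+)$ for $t\in[\beta,S(\beta))$, $\beta\in\Lambda_\varepsilon^{<b}$, and $A_\varepsilon(b)=A(b)$, is Bochner integrable. 4. The family $((S(\beta)-\beta)A(\beta+))_{\beta\in\Lambda_\varepsilon^{<b}}$ is absolutely summable. 5. The family $(\exp((S(\beta)-\beta)\|A(\beta+)\|))_{\beta\in\Lambda_\varepsilon^{<b}}$ of real numbers is multipliable. 6. The family $(1+(S(\beta)-\beta)\|A(\beta+)\|)_{\beta\in\Lambda_\varepsilon^{<b}}$ of real numbers is multipliable.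
   Context: A unital Banach algebra is a complete normed algebra with unit $I$, $\|I\|=1$. Bochner integrability is with respect to Lebesgue measure on $[a,b]$. $A:[a,b]\to E$ is right regulated if the right limit $A(t+)$ exists in $E$ at every $t\in[a,b)$. For a well-ordered $\Lambda\subset\mathbb R\cup\{\infty\}$: $S(\beta)$ is the smallest element of $\Lambda$ greater than $\beta$; $\Lambda^{<\gamma}=\{\alpha\in\Lambda:\alpha<\gamma\}$; an element that is neither a successor $S(\beta)$ nor the minimum is a limit element. The set $\Lambda_\varepsilon$: define $G_\varepsilon:[a,b]\to[a,b]$ by $G_\varepsilon(x)=\sup\{y\in(x,b]:\|A(s)-A(t)\|\le\varepsilon\text{ for all }s,t\in(x,y)\}$ for $x\in[a,b)$ and $G_\varepsilon(b)=b$. $\Lambda_\varepsilon$ is the well-ordered subset of $[a,b]$ determined by: $a=\min\Lambda_\varepsilon$, and for $\gamma>a$, $\gamma\in\Lambda_\varepsilon$ if and only if $\gamma=\sup\{G_\varepsilon(x):x\in\Lambda_\varepsilon^{<\gamma}\}$. (Known: such $\Lambda_\varepsilon$ exists, has maximum $b$, $[a,b)$ is the disjoint union of the intervals $[\beta,S(\beta))$, $\beta\in\Lambda_\varepsilon^{<b}$, and $\|A(s)-A(t)\|\le\varepsilon$ whenever $s,t\in(\beta,S(\beta))$, $\beta\in\Lambda_\varepsilon^{<b}$.) Summability: let $\Lambda'$ be a nonempty well-ordered subset of $\mathbb R\cup\{\infty\}$, $a'=\min\Lambda'$, $b'=\sup\Lambda'$. A family $(x_\alpha)_{\alpha\in\Lambda'}$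 in a normed space is summable if for every $\gamma\in\Lambda'\cup\{b'\}$ there is an element $\Sigma_{\alpha\in\Lambda'^{<\gamma}}x_\alpha$ such that: (i) $\Sigma_{\alpha\in\Lambda'^{<a'}}x_\alpha=0$, and if $\gamma=S(\beta)$, $\beta\in\Lambda'$, then $\Sigma_{\alpha\in\Lambda'^{<\gamma}}x_\alpha=x_\beta+\Sigma_{\alpha\in\Lambda'^{<\beta}}x_\alpha$; (ii) if $\gamma$ is a limit element (of $\Lambda'\cup\{b'\}$), then for each $\eta>0$ there is $\beta_\eta\in\Lambda'^{<\gamma}$ with $\|\Sigma_{\alpha\in\Lambda'^{<\beta}}x_\alpha-\Sigma_{\alpha\in\Lambda'^{<\gamma}}x_\alpha\|<\eta$ for all $\beta\in\Lambda'\cap[\beta_\eta,\gamma)$. The family is absolutely summable if $(\|x_\alpha\|)_{\alpha\in\Lambda'}$ is summable in $\mathbb R$. Multipliability of a family in a unital normed algebra (here $\mathbb R$) is defined in the same way with $0$ replaced by the unit, with $\Pi_{\alpha\in\Lambda'^{<\gamma}}x_\alpha=x_\beta\cdot\Pi_{\alpha\in\Lambda'^{<\beta}}x_\alpha$ for $\gamma=S(\beta)$, and with the same limit condition (ii) for the partial products. Here $\Lambda'=\Lambda_\varepsilon^{<b}$. Free tagged partition of $[a,b]$: $(\xi_i,[t_{i-1},t_i])_{i=1}^m$ with $a=t_0<\dots<t_m=b$ and $\xi_i\in[a,b]$ (not necessarily in $[t_{i-1},t_i]$); for a gauge $\delta:[a,b]\to\mathbb R^+$ it is $\delta$-fine if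 $[t_{i-1},t_i]\subset(\xi_i-\delta(\xi_i),\xi_i+\delta(\xi_i))$ for all $i$. $A$ is strongly McShane product integrable if there is $W:[a,b]\to E$ with $W(t)$ invertible for all $t$, $W$ and $W^{-1}$ bounded, such that for every $\eta>0$ there is a gauge $\delta$ with $\sum_{i=1}^m\|I+A(\xi_i)(t_i-t_{i-1})-W(t_i)W(t_{i-1})^{-1}\|<\eta$ for every $\delta$-fine free tagged partition of $[a,b]$. *)

theory Defs
  imports "HOL-Analysis.Analysis"
begin

text \<open>
  A mapping on the interval from \<open>a\<close> to \<open>b\<close> is a function on \<open>real\<close>; every notion below only depends
  on its values on \<open>{a..b}\<close>. Unital Banach algebras are types of class \<open>real_normed_algebra_1\<close> and
  \<open>banach\<close>; no separability is assumed.
\<close>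

subsection \<open>Regulated mappings and Bochner integrability\<close>

definition right_regulated :: "real \<Rightarrow> real \<Rightarrow> (real \<Rightarrow> 'e::topological_space) \<Rightarrow> bool" where
  "right_regulated a b A \<longleftrightarrow> (\<forall>t\<in>{a..<b}. \<exists>L. (A \<longlongrightarrow> L) (at_right t))"

definition right_lim :: "(real \<Rightarrow> 'e::t2_space) \<Rightarrow> real \<Rightarrow> 'e" where
  "right_lim A t = Lim (at_right t) A"

text \<open>
  The constant \<open>integrable\<close> of the library requires a second countable target space. The definition
  below is the classical one for arbitrary normed spaces. Almost everywhere convergence makes \<open>f\<close>
  strongly measurable, so over a complete measure the integrands of the \<open>nn_integral\<close> are measurable.
\<close>

definition Bochner_integrable :: "'s measure \<Rightarrow> ('s \<Rightarrow> 'e::real_normed_vector) \<Rightarrow> bool" where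
  "Bochner_integrable M f \<longleftrightarrow>
     (\<exists>s :: nat \<Rightarrow> 's \<Rightarrow> 'e.
        (\<forall>n. Bochner_Integration.simple_bochner_integrable M (s n)) \<and>
        (AE x in M. (\<lambda>n. s n x) \<longlonglongrightarrow> f x) \<and>
        (\<lambda>n. \<integral>\<^sup>+x. ennreal (norm (f x - s n x)) \<partial>M) \<longlonglongrightarrow> 0)"

abbreviation Bochner_integrable_on :: "real \<Rightarrow> real \<Rightarrow> (real \<Rightarrow> 'e::real_normed_vector) \<Rightarrow> bool" where
  "Bochner_integrable_on a b f \<equiv> Bochner_integrable (lebesgue_on {a..b}) f"


subsection \<open>Summability and multipliability over well-ordered index sets\<close>

definition is_successor :: "'i::linorder set \<Rightarrow> 'i \<Rightarrow> 'i \<Rightarrow> bool" where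
  "is_successor \<Lambda> \<beta> \<gamma> \<longleftrightarrow> \<gamma> \<in> \<Lambda> \<and> \<beta> < \<gamma> \<and> (\<forall>\<delta>\<in>\<Lambda>. \<beta> < \<delta> \<longrightarrow> \<gamma> \<le> \<delta>)"

definition successor :: "'i::linorder set \<Rightarrow> 'i \<Rightarrow> 'i" where
  "successor \<Lambda> \<beta> = (THE \<gamma>. is_successor \<Lambda> \<beta> \<gamma>)"

definition limit_element :: "'i::linorder set \<Rightarrow> 'i \<Rightarrow> bool" where
  "limit_element \<Lambda> \<gamma> \<longleftrightarrow>
     \<gamma> \<in> \<Lambda> \<and> (\<exists>\<delta>\<in>\<Lambda>. \<delta> < \<gamma>) \<and> (\<nexists>\<beta>. \<beta> \<in> \<Lambda> \<and> is_successor \<Lambda> \<beta> \<gamma>)"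

text \<open>
  The index set is meant to be nonempty, well-ordered and bounded above, so that \<open>Sup \<Lambda>\<close> is its
  supremum; over \<open>ereal\<close> the bound is automatic. The function \<open>\<sigma>\<close> assigns to \<open>\<gamma>\<close> the partial sum
  (product) over all \<open>\<alpha> \<in> \<Lambda>\<close> with \<open>\<alpha> < \<gamma>\<close>. If \<open>\<Lambda>\<close> has a maximum, then \<open>Sup \<Lambda>\<close> is that maximum and the
  last term of the family is unconstrained.
\<close>

definition partial_limits ::
    "'i::conditionally_complete_linorder set \<Rightarrow> ('i \<Rightarrow> 'e::real_normed_vector) \<Rightarrow> bool" where
  "partial_limits \<Lambda> \<sigma> \<longleftrightarrow>
     (\<forall>\<gamma>. limit_element (insert (Sup \<Lambda>) \<Lambda>) \<gamma> \<longrightarrow>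
        (\<forall>\<eta>>0. \<exists>\<beta>\<^sub>\<eta>\<in>\<Lambda>. \<beta>\<^sub>\<eta> < \<gamma> \<and>
           (\<forall>\<beta>\<in>\<Lambda> \<inter> {\<beta>\<^sub>\<eta>..<\<gamma>}. norm (\<sigma> \<beta> - \<sigma> \<gamma>) < \<eta>)))"

definition summable_family ::
    "'i::conditionally_complete_linorder set \<Rightarrow> ('i \<Rightarrow> 'e::real_normed_vector) \<Rightarrow> bool" where
  "summable_family \<Lambda> x \<longleftrightarrow>
     (\<exists>\<sigma>. \<sigma> (Inf \<Lambda>) = 0 \<and>
        (\<forall>\<beta>\<in>\<Lambda>. \<forall>\<gamma>. is_successor \<Lambda> \<beta> \<gamma> \<longrightarrow> \<sigma> \<gamma> = x \<beta> + \<sigma> \<beta>) \<and>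
        partial_limits \<Lambda> \<sigma>)"

definition abs_summable_family ::
    "'i::conditionally_complete_linorder set \<Rightarrow> ('i \<Rightarrow> 'e::real_normed_vector) \<Rightarrow> bool" where
  "abs_summable_family \<Lambda> x \<longleftrightarrow> summable_family \<Lambda> (\<lambda>\<alpha>. norm (x \<alpha>))"

definition multipliable_family ::
    "'i::conditionally_complete_linorder set \<Rightarrow> ('i \<Rightarrow> 'e::real_normed_algebra_1) \<Rightarrow> bool" where
  "multipliable_family \<Lambda> x \<longleftrightarrow>
     (\<exists>\<sigma>. \<sigma> (Inf \<Lambda>) = 1 \<and>
        (\<forall>\<beta>\<in>\<Lambda>. \<forall>\<gamma>. is_successor \<Lambda> \<beta> \<gamma> \<longrightarrow> \<sigma> \<gamma> = x \<beta> * \<sigma> \<beta>) \<and>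
        partial_limits \<Lambda> \<sigma>)"


subsection \<open>The well-ordered set associated with a mapping\<close>

definition osc_step :: "real \<Rightarrow> (real \<Rightarrow> 'e::real_normed_vector) \<Rightarrow> real \<Rightarrow> real \<Rightarrow> real" where
  "osc_step b A \<epsilon> x =
     (if x < b
      then Sup {y \<in> {x<..b}. \<forall>s\<in>{x<..<y}. \<forall>t\<in>{x<..<y}. norm (A s - A t) \<le> \<epsilon>}
      else b)"

definition is_osc_set ::
    "real \<Rightarrow> real \<Rightarrow> (real \<Rightarrow> 'e::real_normed_vector) \<Rightarrow> real \<Rightarrow> real set \<Rightarrow> bool" where
  "is_osc_set a b A \<epsilon> \<Lambda> \<longleftrightarrow>
     \<Lambda> \<subseteq> {a..b} \<and> wfp_on \<Lambda> (<) \<and> a \<in> \<Lambda> \<and>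
     (\<forall>\<gamma>>a. \<gamma> \<in> \<Lambda> \<longleftrightarrow> \<gamma> = Sup (osc_step b A \<epsilon> ` {x \<in> \<Lambda>. x < \<gamma>}))"

text \<open>Existence and uniqueness are shown in \<open>ex1_osc_set\<close> below.\<close>

definition osc_set :: "real \<Rightarrow> real \<Rightarrow> (real \<Rightarrow> 'e::real_normed_vector) \<Rightarrow> real \<Rightarrow> real set" where
  "osc_set a b A \<epsilon> = (THE \<Lambda>. is_osc_set a b A \<epsilon> \<Lambda>)"

definition osc_set_below :: "real \<Rightarrow> real \<Rightarrow> (real \<Rightarrow> 'e::real_normed_vector) \<Rightarrow> real \<Rightarrow> real set" where
  "osc_set_below a b A \<epsilon> = {\<beta> \<in> osc_set a b A \<epsilon>. \<beta> < b}"

text \<open>The second branch gives the prescribed value \<open>A b\<close> at \<open>b\<close>.\<close>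

definition step_map ::
    "real \<Rightarrow> real \<Rightarrow> (real \<Rightarrow> 'e::real_normed_vector) \<Rightarrow> real \<Rightarrow> real \<Rightarrow> 'e" where
  "step_map a b A \<epsilon> t =
     (if t < b
      then right_lim A (THE \<beta>. \<beta> \<in> osc_set_below a b A \<epsilon> \<and> t \<in> {\<beta>..<successor (osc_set a b A \<epsilon>) \<beta>})
      else A t)"

lemma osc_step_bounds:
  assumes "right_regulated a b A" "\<epsilon> > 0" "a \<le> x" "x < b"
  shows "x < osc_step b A \<epsilon> x" "osc_step b A \<epsilon> x \<le> b"
proof -
  let ?Y = "{y \<in> {x<..b}. \<forall>s\<in>{x<..<y}. \<forall>t\<in>{x<..<y}. norm (A s - A t) \<le> \<epsilon>}"
  obtain L where L: "(A \<longlongrightarrow> L) (at_right x)"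
    using assms unfolding right_regulated_def by (meson atLeastLessThan_iff)
  have "\<forall>\<^sub>F t in at_right x. dist (A t) L < \<epsilon> / 2"
    using tendstoD[OF L, of "\<epsilon> / 2"] assms(2) by simp
  then obtain c where c: "c > x" "\<And>t. x < t \<Longrightarrow> t < c \<Longrightarrow> dist (A t) L < \<epsilon> / 2"
    unfolding eventually_at_right_field by auto
  have "norm (A s - A t) \<le> \<epsilon>" if "s \<in> {x<..<min c b}" "t \<in> {x<..<min c b}" for s t
  proof -
    have "dist (A s) L < \<epsilon> / 2" "dist (A t) L < \<epsilon> / 2"
      using c that by auto
    then have "dist (A s) (A t) < \<epsilon>"
      by (rule dist_triangle_half_l)
    then show ?thesis
      by (simp add: dist_norm)
  qed
  then have Y: "min c b \<in> ?Y"
    using c assms by auto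
  have bdd: "bdd_above ?Y"
    by (rule bdd_aboveI[of _ b]) auto
  have "x < min c b"
    using c assms by auto
  also have "min c b \<le> Sup ?Y"
    by (rule cSup_upper[OF Y bdd])
  finally show "x < osc_step b A \<epsilon> x"
    using assms by (simp add: osc_step_def)
  have "?Y \<noteq> {}"
    using Y by (rule ex_in_conv[THEN iffD1, OF exI])
  then have "Sup ?Y \<le> b"
    by (rule cSup_least) auto
  then show "osc_step b A \<epsilon> x \<le> b"
    using assms by (simp add: osc_step_def)
qed

inductive_set step_closure :: "real \<Rightarrow> (real \<Rightarrow> real) \<Rightarrow> real set" for a G where
  base: "a \<in> step_closure a G"
| step: "x \<in> step_closure a G \<Longrightarrow> G x \<in> step_closure a G"
| Sup: "X \<noteq> {} \<Longrightarrow> bdd_above X \<Longrightarrow> (\<And>x. x \<in> X \<Longrightarrow> x \<in> step_closure a G) \<Longrightarrow> Sup X \<in> step_closure a G"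

lemma ex_osc_set:
  fixes A :: "real \<Rightarrow> 'e::real_normed_vector"
  assumes "a < b" "right_regulated a b A" "\<epsilon> > 0"
  shows "\<exists>\<Lambda>. is_osc_set a b A \<epsilon> \<Lambda>"
proof -
  define G where "G = osc_step b A \<epsilon>"
  define L where "L = step_closure a G"
  have G_gt: "x < G x" "G x \<le> b" if "a \<le> x" "x < b" for x
    using osc_step_bounds assms that by (auto simp: G_def)
  have G_b: "G b = b"
    by (simp add: G_def osc_step_def)
  have rng: "a \<le> x \<and> x \<le> b" if "x \<in> L" for x
    using that unfolding L_def
  proof (induction rule: step_closure.induct)
    case base
    then show ?case using assms by simp
  next
    case (step x)
    then show ?case using G_gt[of x] G_b by (cases "x = b") auto
  next
    case (Sup X)
    then obtain z where "z \<in> X" by blast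
    then have "a \<le> Sup X" using Sup cSup_upper[of z X] by force
    then show ?case using Sup by (auto intro!: cSup_least)
  qed
  have bdd: "bdd_above X" if "X \<subseteq> L" for X
    using rng that by (intro bdd_aboveI[of _ b]) auto
  have SupL: "Sup X \<in> L" if "X \<subseteq> L" "X \<noteq> {}" for X
    using that bdd[OF that(1)] unfolding L_def by (intro step_closure.Sup) auto
  have GL: "G x \<in> L" if "x \<in> L" for x
    using that unfolding L_def by (rule step_closure.step)
  have aL: "a \<in> L" unfolding L_def by (rule step_closure.base)
  have G_ge: "x \<le> G x" if "x \<in> L" for x
    using rng[OF that] G_gt[of x] G_b by (cases "x = b") auto
  have sep1: "y \<le> x \<or> G x \<le> y" if "y \<in> L" "\<forall>y\<in>L. y < x \<longrightarrow> G y \<le> x" "x \<in> L" for x y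
    using that(1) unfolding L_def
  proof (induction rule: step_closure.induct)
    case base
    then show ?case using rng that by auto
  next
    case (step y)
    have yL: "y \<in> L" using step by (simp add: L_def)
    consider "y < x" | "y = x" | "G x \<le> y" using step by force
    then show ?case
      using that(2) yL G_ge[OF yL] by cases auto
  next
    case (Sup X)
    show ?case
    proof (cases "\<forall>y\<in>X. y \<le> x")
      case True
      then have "Sup X \<le> x" using Sup(1) by (intro cSup_least) auto
      then show ?thesis ..
    next
      case False
      then obtain y where "y \<in> X" "G x \<le> y" using Sup by blast
      then show ?thesis using cSup_upper[of y X] Sup by auto
    qed
  qed
  have ext: "\<forall>y\<in>L. y < x \<longrightarrow> G y \<le> x" if "x \<in> L" for x
    using that unfolding L_def
  proof (induction rule: step_closure.induct)
    case base
    then show ?case using rng unfolding L_def by force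
  next
    case (step x)
    have xL: "x \<in> L" using step by (simp add: L_def)
    show ?case
    proof (intro ballI impI)
      fix y assume "y \<in> step_closure a G" "y < G x"
      then have "y \<le> x" "y \<in> L"
        using sep1[of y x] step xL by (auto simp: L_def)
      then show "G y \<le> G x"
        using step G_ge[OF xL] by (cases "y = x") (force simp: L_def)+
    qed
  next
    case (Sup X)
    show ?case
    proof (intro ballI impI)
      fix y assume y: "y \<in> step_closure a G" "y < Sup X"
      then obtain x where "x \<in> X" "y < x"
        using Sup less_cSup_iff by blast
      then show "G y \<le> Sup X"
        using Sup y cSup_upper[of x X] by force
    qed
  qed
  have sep: "y \<le> x \<or> G x \<le> y" if "x \<in> L" "y \<in> L" for x y
    using sep1 ext that by blast
  have wf: "wfp_on L (<)"
    unfolding wfp_on_iff_ex_minimal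
  proof (intro allI impI)
    fix B assume B: "B \<subseteq> L" "B \<noteq> {}"
    define s where "s = Sup {z \<in> L. \<forall>y\<in>B. z \<le> y}"
    have ne: "a \<in> {z \<in> L. \<forall>y\<in>B. z \<le> y}"
      using aL rng B by auto
    have sL: "s \<in> L"
      unfolding s_def using ne by (intro SupL) auto
    have sB: "s \<le> y" if "y \<in> B" for y
      unfolding s_def using ne that by (intro cSup_least) auto
    have "s \<in> B"
    proof (rule ccontr)
      assume "s \<notin> B"
      then have lt: "s < y" if "y \<in> B" for y
        using sB that by (metis order_le_imp_less_or_eq)
      then have "G s \<le> y" if "y \<in> B" for y
        using sep[OF sL, of y] B that by force
      then have "G s \<le> s"
        unfolding s_def using GL[OF sL] s_def by (intro cSup_upper bdd) auto
      moreover obtain y where "y \<in> B" "s < y" "y \<le> b"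
        using B lt rng by blast
      ultimately show False
        using G_gt(1)[of s] rng[OF sL] by auto
    qed
    then show "\<exists>z\<in>B. \<forall>y. y < z \<longrightarrow> y \<notin> B"
      using sB by force
  qed
  have iff: "\<gamma> \<in> L \<longleftrightarrow> \<gamma> = Sup (G ` {x \<in> L. x < \<gamma>})" if "\<gamma> > a" for \<gamma>
  proof -
    let ?m = "Sup (G ` {x \<in> L. x < \<gamma>})"
    have ne: "G ` {x \<in> L. x < \<gamma>} \<noteq> {}"
      using aL that by auto
    have sub: "G ` {x \<in> L. x < \<gamma>} \<subseteq> L"
      using GL by auto
    have mL: "?m \<in> L"
      by (rule SupL[OF sub ne])
    have eq: "\<gamma> = ?m" if "\<gamma> \<in> L"
    proof (rule ccontr)
      assume neq: "\<gamma> \<noteq> ?m"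
      have "?m \<le> \<gamma>"
        using ne ext[OF that] by (intro cSup_least) auto
      then have lt: "?m < \<gamma>" using neq by simp
      then have "G ?m \<le> ?m"
        using mL by (intro cSup_upper bdd[OF sub]) auto
      moreover have "?m < G ?m"
        using rng[OF mL] rng[OF that] lt by (intro G_gt) auto
      ultimately show False by simp
    qed
    show ?thesis
    proof
      assume "\<gamma> = ?m"
      then show "\<gamma> \<in> L" using mL by (rule ssubst[of _ _ "\<lambda>z. z \<in> L"])
    qed (rule eq)
  qed
  have "is_osc_set a b A \<epsilon> L"
    unfolding is_osc_set_def using rng aL wf iff by (auto simp: G_def)
  then show ?thesis ..
qed

lemma osc_set_subset:
  assumes "is_osc_set a b A \<epsilon> \<Lambda>" "is_osc_set a b A \<epsilon> \<Lambda>'"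
  shows "\<Lambda> \<subseteq> \<Lambda>'"
proof (rule ccontr)
  have a_less: "a < x" if "is_osc_set a b A \<epsilon> M" "is_osc_set a b A \<epsilon> N" "x \<in> M" "x \<notin> N" for M N x
    using that unfolding is_osc_set_def by (cases "x = a") (auto simp: order_less_le)
  have iff: "\<gamma> \<in> M \<longleftrightarrow> \<gamma> = Sup (osc_step b A \<epsilon> ` {x \<in> M. x < \<gamma>})"
    if "is_osc_set a b A \<epsilon> M" "a < \<gamma>" for M \<gamma>
    using that unfolding is_osc_set_def by blast
  assume "\<not> \<Lambda> \<subseteq> \<Lambda>'"
  moreover have "wfp_on \<Lambda> (<)"
    using assms(1) by (simp add: is_osc_set_def)
  ultimately obtain \<gamma> where g: "\<gamma> \<in> \<Lambda>" "\<gamma> \<notin> \<Lambda>'" and gmin: "\<And>y. y < \<gamma> \<Longrightarrow> y \<in> \<Lambda> \<Longrightarrow> y \<in> \<Lambda>'"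
    unfolding wfp_on_iff_ex_minimal
    by (elim allE[of _ "\<Lambda> - \<Lambda>'"]) force
  have "{x \<in> \<Lambda>'. x < \<gamma>} \<subseteq> \<Lambda>"
  proof (rule ccontr)
    assume "\<not> {x \<in> \<Lambda>'. x < \<gamma>} \<subseteq> \<Lambda>"
    then have ne: "{x \<in> \<Lambda>'. x < \<gamma> \<and> x \<notin> \<Lambda>} \<noteq> {}" by auto
    have "wfp_on \<Lambda>' (<)"
      using assms(2) by (simp add: is_osc_set_def)
    then obtain \<delta> where d: "\<delta> \<in> \<Lambda>'" "\<delta> < \<gamma>" "\<delta> \<notin> \<Lambda>" and dmin: "\<And>y. y < \<delta> \<Longrightarrow> y \<in> \<Lambda>' \<Longrightarrow> y \<in> \<Lambda>"
      using ne unfolding wfp_on_iff_ex_minimal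
      by (elim allE[of _ "{x \<in> \<Lambda>'. x < \<gamma> \<and> x \<notin> \<Lambda>}"]) force
    have "{x \<in> \<Lambda>. x < \<delta>} = {x \<in> \<Lambda>'. x < \<delta>}"
      using d dmin gmin by auto
    moreover have "\<delta> > a"
      using a_less[OF assms(2,1) d(1,3)] .
    ultimately show False
      using iff[OF assms(1)] iff[OF assms(2)] d by simp
  qed
  then have "{x \<in> \<Lambda>. x < \<gamma>} = {x \<in> \<Lambda>'. x < \<gamma>}"
    using gmin by auto
  moreover have "\<gamma> > a"
    using a_less[OF assms g] .
  ultimately show False
    using iff[OF assms(1)] iff[OF assms(2)] g by simp
qed

lemma ex1_osc_set:
  assumes "a < b" "right_regulated a b A" "\<epsilon> > 0"
  shows "\<exists>!\<Lambda>. is_osc_set a b A \<epsilon> \<Lambda>"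
  using ex_osc_set[OF assms] osc_set_subset by blast


subsection \<open>Strong McShane product integrability\<close>

text \<open>The class-based \<open>inverse\<close> is only available in division algebras.\<close>

definition is_inverse :: "'e::monoid_mult \<Rightarrow> 'e \<Rightarrow> bool" where
  "is_inverse x y \<longleftrightarrow> x * y = 1 \<and> y * x = 1"

definition invertible_elem :: "'e::monoid_mult \<Rightarrow> bool" where
  "invertible_elem x \<longleftrightarrow> (\<exists>y. is_inverse x y)"

definition inv_elem :: "'e::monoid_mult \<Rightarrow> 'e" where
  "inv_elem x = (THE y. is_inverse x y)"

text \<open>The tags \<open>\<xi> 1, \<dots>, \<xi> m\<close> need not lie in the corresponding subintervals.\<close>

definition free_tagged_partition ::
    "real \<Rightarrow> real \<Rightarrow> nat \<Rightarrow> (nat \<Rightarrow> real) \<Rightarrow> (nat \<Rightarrow> real) \<Rightarrow> bool" where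
  "free_tagged_partition a b m t \<xi> \<longleftrightarrow>
     t 0 = a \<and> t m = b \<and> (\<forall>i\<in>{1..m}. t (i - 1) < t i \<and> \<xi> i \<in> {a..b})"

definition fine_partition ::
    "(real \<Rightarrow> real) \<Rightarrow> nat \<Rightarrow> (nat \<Rightarrow> real) \<Rightarrow> (nat \<Rightarrow> real) \<Rightarrow> bool" where
  "fine_partition \<delta> m t \<xi> \<longleftrightarrow>
     (\<forall>i\<in>{1..m}. {t (i - 1)..t i} \<subseteq> {\<xi> i - \<delta> (\<xi> i)<..<\<xi> i + \<delta> (\<xi> i)})"

definition strongly_McShane_product_integrable ::
    "real \<Rightarrow> real \<Rightarrow> (real \<Rightarrow> 'e::real_normed_algebra_1) \<Rightarrow> bool" where
  "strongly_McShane_product_integrable a b A \<longleftrightarrow>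
     (\<exists>W :: real \<Rightarrow> 'e.
        (\<forall>t\<in>{a..b}. invertible_elem (W t)) \<and>
        bounded (W ` {a..b}) \<and> bounded ((\<lambda>t. inv_elem (W t)) ` {a..b}) \<and>
        (\<forall>\<eta>>0. \<exists>\<delta>. (\<forall>t\<in>{a..b}. \<delta> t > 0) \<and>
           (\<forall>m t \<xi>. free_tagged_partition a b m t \<xi> \<and> fine_partition \<delta> m t \<xi> \<longrightarrow>
              (\<Sum>i=1..m. norm (1 + (t i - t (i - 1)) *\<^sub>R A (\<xi> i)
                                  - W (t i) * inv_elem (W (t (i - 1))))) < \<eta>)))"

end

theory Submission
  imports Defs
begin

text \<open>
  The equivalences are proved along the cycle ``product integrable, absolutely summable, Bochner
  integrable, product integrable''; the remaining ones are comparisons of nonnegative functions and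
  families, taking logarithms of the products.

  If \<open>A\<close> is product integrable, then the Riemann sums of any two sufficiently fine free partitions
  with the same division points differ by at most \<open>2\<close>, whatever the tags. Tags taken from a finite
  subcover keep \<open>norm \<circ> A\<close> bounded; tags in the middle half of the interval from \<open>\<beta>\<close> to its
  successor, for finitely many \<open>\<beta>\<close>, produce half of the corresponding partial sum, up to \<open>\<epsilon>\<close>.

  Conversely, let \<open>G\<close> and \<open>V\<close> be the indefinite integrals of \<open>A\<close> and \<open>norm \<circ> A\<close>. The products of
  the factors \<open>exp (G t\<^sub>i - G t\<^sub>i\<^sub>-\<^sub>1)\<close> converge along the net of finite sets of division points,
  because a product over a partition of the interval from \<open>s\<close> to \<open>t\<close> differs from
  \<open>1 + (G t - G s)\<close> by at most \<open>exp w - 1 - w\<close> with \<open>w = V t - V s\<close>. The limit provides \<open>W\<close>, and only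
  \<open>A (\<xi>) (t - s)\<close> and \<open>G t - G s\<close> have to be compared. This is easy when \<open>A\<close> is continuous at the tag \<open>\<xi>\<close>;
  there are only countably many other tags, and their contribution is made small by the gauge.
\<close>

subsection \<open>The set of oscillation points\<close>

text \<open>Freedom of tags is what yields absolute summability: two tag choices on the same cells
  can be subtracted, and the terms built from \<open>W\<close>, which depend only on the division
  points, cancel. The obstacle is that \<open>A\<close> may be unbounded near limit elements of the
  index set, so the reference tags need a bound fixed before the finitely many intervals are
  selected; compactness of [a,b] supplies it.

  In the converse direction a free partition may use one bad tag in arbitrarily many cells, so
  counting cells is useless. The errors at such a tag are instead dominated by increments of a
  monotone continuous function over a small neighbourhood of the tag.

  The remainder exp w - 1 - w is both second order in w and reproduced exactly when products are
  composed. The first property makes sums over fine partitions small, the second makes the estimates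
  independent of the number of division points.

  As \<open>'e\<close> need not be separable, measurability is only ever asked of the real functions
  norm (A x - c); continuity of \<open>A\<close> outside a countable set gives it, and also gives
  simple approximations.\<close>

lemma is_successor_unique: "is_successor \<Lambda> \<beta> \<gamma> \<Longrightarrow> is_successor \<Lambda> \<beta> \<gamma>' \<Longrightarrow> \<gamma> = \<gamma>'"
  by (auto simp: is_successor_def intro: antisym)

lemma successor_eqI: "is_successor \<Lambda> \<beta> \<gamma> \<Longrightarrow> successor \<Lambda> \<beta> = \<gamma>"
  unfolding successor_def by (rule the_equality) (auto intro: is_successor_unique)

text \<open>Points below the supremum defining \<open>osc_step\<close> lie below a common admissible
  y. The right limit at x makes the set of admissible y nonempty, so that the supremum is
  meaningful.\<close>

lemma osc_step_oscillation:
  assumes L: "(A \<longlongrightarrow> L) (at_right x)" and "\<epsilon> > 0"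
    and "x < b" "s \<in> {x<..<osc_step b A \<epsilon> x}" "t \<in> {x<..<osc_step b A \<epsilon> x}"
  shows "norm (A s - A t) \<le> \<epsilon>"
proof -
  let ?Y = "{y \<in> {x<..b}. \<forall>s\<in>{x<..<y}. \<forall>t\<in>{x<..<y}. norm (A s - A t) \<le> \<epsilon>}"
  have bdd: "bdd_above ?Y" by (rule bdd_aboveI[of _ b]) auto
  have lt: "max s t < Sup ?Y" using assms by (auto simp: osc_step_def)
  have "\<forall>\<^sub>F t in at_right x. dist (A t) L < \<epsilon> / 2"
    using tendstoD[OF L, of "\<epsilon> / 2"] assms(2) by simp
  then obtain c where c: "c > x" "\<And>t. x < t \<Longrightarrow> t < c \<Longrightarrow> dist (A t) L < \<epsilon> / 2"
    unfolding eventually_at_right_field by auto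
  have "norm (A s - A t) \<le> \<epsilon>" if "s \<in> {x<..<min c b}" "t \<in> {x<..<min c b}" for s t
    using dist_triangle_half_l[of "A s" L \<epsilon> "A t"] c that by (simp add: dist_norm)
  then have Y: "min c b \<in> ?Y"
    using c assms by auto
  then have ne: "?Y \<noteq> {}" by blast
  obtain y where "y \<in> ?Y" "max s t < y"
    using less_cSup_iff[OF ne bdd, THEN iffD1, OF lt] by (rule bexE)
  then show ?thesis using assms by auto
qed

locale right_regulated_interval =
  fixes a b :: real and A :: "real \<Rightarrow> 'e::real_normed_vector"
  assumes less: "a < b" and right_regulated: "right_regulated a b A"
begin

lemma right_lim: "a \<le> t \<Longrightarrow> t < b \<Longrightarrow> (A \<longlongrightarrow> right_lim A t) (at_right t)"
  using right_regulated unfolding right_regulated_def right_lim_def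
  by (metis atLeastLessThan_iff tendsto_Lim trivial_limit_at_right_real)

lemma osc_set: "\<epsilon> > 0 \<Longrightarrow> is_osc_set a b A \<epsilon> (osc_set a b A \<epsilon>)"
  unfolding osc_set_def by (rule theI') (rule ex1_osc_set[OF less right_regulated])

context
  fixes \<epsilon> :: real assumes eps: "\<epsilon> > 0"
begin

abbreviation (input) "\<Lambda> \<equiv> osc_set a b A \<epsilon>"
abbreviation (input) "G \<equiv> osc_step b A \<epsilon>"

lemma osc_set_range: "\<beta> \<in> \<Lambda> \<Longrightarrow> a \<le> \<beta> \<and> \<beta> \<le> b"
  and wfp_on_osc_set: "wfp_on \<Lambda> (<)"
  and a_in_osc_set: "a \<in> \<Lambda>"
  and osc_set_iff: "\<gamma> > a \<Longrightarrow> \<gamma> \<in> \<Lambda> \<longleftrightarrow> \<gamma> = Sup (G ` {x \<in> \<Lambda>. x < \<gamma>})"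
  using osc_set[OF eps] unfolding is_osc_set_def by auto

lemma osc_step_gt: "\<beta> \<in> \<Lambda> \<Longrightarrow> \<beta> < b \<Longrightarrow> \<beta> < G \<beta>"
  and osc_step_le: "\<beta> \<in> \<Lambda> \<Longrightarrow> G \<beta> \<le> b"
proof -
  assume b: "\<beta> \<in> \<Lambda>"
  note B = osc_step_bounds[OF right_regulated eps, of \<beta>] osc_set_range[OF b]
  show "\<beta> < b \<Longrightarrow> \<beta> < G \<beta>" using B by auto
  show "G \<beta> \<le> b" using B by (cases "\<beta> < b") (auto simp: osc_step_def)
qed

lemma bdd_above_osc_step: "bdd_above (G ` {x \<in> \<Lambda>. P x})"
  by (rule bdd_aboveI[of _ b]) (auto intro: osc_step_le)

lemma osc_step_le_osc_set: "\<beta> \<in> \<Lambda> \<Longrightarrow> \<gamma> \<in> \<Lambda> \<Longrightarrow> \<beta> < \<gamma> \<Longrightarrow> G \<beta> \<le> \<gamma>"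
  using osc_set_iff[of \<gamma>] osc_set_range[of \<beta>] cSup_upper[OF _ bdd_above_osc_step, of "G \<beta>" "\<lambda>x. x < \<gamma>"] by auto

text \<open>Any x in \<Lambda> below G \<beta> satisfies x \<le> \<beta>, for otherwise G \<beta>
  \<le> x. Hence G \<beta> is the maximum of the values G x with x < G \<beta>, and the defining
  equivalence puts it into \<Lambda>.\<close>

lemma is_successor_osc_step:
  assumes b: "\<beta> \<in> \<Lambda>" "\<beta> < b"
  shows "is_successor \<Lambda> \<beta> (G \<beta>)"
proof -
  have gt: "\<beta> < G \<beta>" by (rule osc_step_gt[OF b])
  have "Sup (G ` {x \<in> \<Lambda>. x < G \<beta>}) = G \<beta>"
  proof (rule cSup_eq_maximum)
    show "G \<beta> \<in> G ` {x \<in> \<Lambda>. x < G \<beta>}" using b gt by auto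
    fix y assume "y \<in> G ` {x \<in> \<Lambda>. x < G \<beta>}"
    then obtain x where x: "x \<in> \<Lambda>" "x < G \<beta>" "y = G x" by auto
    then have "x \<le> \<beta>" using osc_step_le_osc_set[of \<beta> x] b by force
    then show "y \<le> G \<beta>" using osc_step_le_osc_set[of x \<beta>] b x gt by (cases "x = \<beta>") auto
  qed
  then have "G \<beta> \<in> \<Lambda>" using osc_set_iff[of "G \<beta>"] gt osc_set_range[OF b(1)] by auto
  then show ?thesis
    using gt osc_step_le_osc_set b by (auto simp: is_successor_def)
qed

lemma successor_osc_set: "\<beta> \<in> \<Lambda> \<Longrightarrow> \<beta> < b \<Longrightarrow> successor \<Lambda> \<beta> = G \<beta>"
  by (rule successor_eqI[OF is_successor_osc_step])

text \<open>If the supremum is not attained, every x in \<Lambda> below it is followed by some z in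
  X with G x \<le> z, while x < G x for x in X. So the values G x have the same supremum as
  X.\<close>

lemma Sup_in_osc_set:
  assumes X: "X \<subseteq> \<Lambda>" "X \<noteq> {}"
  shows "Sup X \<in> \<Lambda>"
proof (cases "Sup X \<in> X")
  case False
  have bdd: "bdd_above X" using X osc_set_range by (intro bdd_aboveI[of _ b]) auto
  have lt: "x < Sup X" if "x \<in> X" for x
    using cSup_upper[OF that bdd] that False by (metis order_le_imp_less_or_eq)
  obtain x0 where x0: "x0 \<in> X" using X by auto
  have "a < Sup X" using lt[OF x0] X osc_set_range[of x0] x0 by auto
  have "Sup (G ` {x \<in> \<Lambda>. x < Sup X}) = Sup X"
  proof (rule cSup_eq_non_empty)
    show "G ` {x \<in> \<Lambda>. x < Sup X} \<noteq> {}" using x0 lt X by auto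
    fix y assume "y \<in> G ` {x \<in> \<Lambda>. x < Sup X}"
    then obtain x where x: "x \<in> \<Lambda>" "x < Sup X" "y = G x" by auto
    then obtain z where "z \<in> X" "x < z" using X bdd by (auto simp: less_cSup_iff)
    then show "y \<le> Sup X" using osc_step_le_osc_set[of x z] x X lt[of z] by force
  next
    fix u assume u: "\<And>x. x \<in> G ` {x \<in> \<Lambda>. x < Sup X} \<Longrightarrow> x \<le> u"
    show "Sup X \<le> u"
    proof (rule cSup_least[OF X(2)])
      fix x assume x: "x \<in> X"
      then have "x < G x" using X lt osc_set_range[of x] cSup_least[OF X(2), of b] osc_set_range
        by (intro osc_step_gt) (auto intro: less_le_trans)
      also have "G x \<le> u" using X x lt by (intro u) auto
      finally show "x \<le> u" by simp
    qed
  qed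
  then show ?thesis using osc_set_iff[of "Sup X"] \<open>a < Sup X\<close> by simp
qed (use X in auto)

text \<open>The point \<beta> is the largest element of \<Lambda> not exceeding t, which exists
  because \<Lambda> contains the suprema of its nonempty subsets.\<close>

lemma ex1_osc_set_interval:
  assumes t: "a \<le> t" "t < b"
  shows "\<exists>!\<beta>. \<beta> \<in> osc_set_below a b A \<epsilon> \<and> t \<in> {\<beta>..<successor \<Lambda> \<beta>}"
proof -
  let ?X = "{x \<in> \<Lambda>. x \<le> t}"
  have X: "?X \<noteq> {}" using t a_in_osc_set by auto
  define \<beta> where "\<beta> = Sup ?X"
  have b: "\<beta> \<in> \<Lambda>" unfolding \<beta>_def by (rule Sup_in_osc_set) (use X in auto)
  have le: "\<beta> \<le> t" unfolding \<beta>_def by (rule cSup_least[OF X]) auto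
  have b': "\<beta> < b" using le t by simp
  note succ = is_successor_osc_step[OF b b']
  have "t < G \<beta>"
  proof (rule ccontr)
    assume "\<not> t < G \<beta>"
    then have "G \<beta> \<le> \<beta>"
      unfolding \<beta>_def using succ by (intro cSup_upper bdd_aboveI[of _ t]) (auto simp: is_successor_def \<beta>_def)
    then show False using succ by (simp add: is_successor_def)
  qed
  show ?thesis
  proof (rule ex1I[of _ \<beta>])
    show "\<beta> \<in> osc_set_below a b A \<epsilon> \<and> t \<in> {\<beta>..<successor \<Lambda> \<beta>}"
      using b b' le \<open>t < G \<beta>\<close> by (simp add: osc_set_below_def successor_osc_set)
    fix \<gamma> assume g: "\<gamma> \<in> osc_set_below a b A \<epsilon> \<and> t \<in> {\<gamma>..<successor \<Lambda> \<gamma>}"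
    then have g': "\<gamma> \<in> \<Lambda>" "\<gamma> \<le> t" "t < G \<gamma>" by (auto simp: osc_set_below_def successor_osc_set)
    show "\<gamma> = \<beta>"
      using osc_step_le_osc_set[of \<gamma> \<beta>] osc_step_le_osc_set[of \<beta> \<gamma>] g' b le \<open>t < G \<beta>\<close>
      by (cases \<gamma> \<beta> rule: linorder_cases) auto
  qed
qed

lemma osc_set_below:
  assumes "\<beta> \<in> osc_set_below a b A \<epsilon>"
  shows "a \<le> \<beta>" "\<beta> < b" "\<beta> < successor \<Lambda> \<beta>" "successor \<Lambda> \<beta> \<le> b"
    "\<And>\<gamma>. \<gamma> \<in> \<Lambda> \<Longrightarrow> \<beta> < \<gamma> \<Longrightarrow> successor \<Lambda> \<beta> \<le> \<gamma>"
    "\<And>s t. s \<in> {\<beta><..<successor \<Lambda> \<beta>} \<Longrightarrow> t \<in> {\<beta><..<successor \<Lambda> \<beta>} \<Longrightarrow> norm (A s - A t) \<le> \<epsilon>"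
  using assms osc_step_gt[of \<beta>] osc_step_le[of \<beta>] osc_set_range[of \<beta>] osc_step_le_osc_set[of \<beta>]
    osc_step_oscillation[OF right_lim eps, of \<beta> b]
  by (auto simp: osc_set_below_def successor_osc_set)

lemma osc_set_belowE:
  assumes "a \<le> t" "t < b"
  obtains \<beta> where "\<beta> \<in> osc_set_below a b A \<epsilon>" "\<beta> \<le> t" "t < successor \<Lambda> \<beta>"
  using ex1_osc_set_interval[OF assms] by auto

lemma osc_set_below_nonempty: "osc_set_below a b A \<epsilon> \<noteq> {}"
  using a_in_osc_set less by (auto simp: osc_set_below_def)

lemma wfp_on_osc_set_below: "wfp_on (osc_set_below a b A \<epsilon>) (<)"
  by (rule wfp_on_subset[OF wfp_on_osc_set]) (auto simp: osc_set_below_def)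

lemma bdd_above_osc_set_below: "bdd_above (osc_set_below a b A \<epsilon>)"
  by (rule bdd_aboveI[of _ b]) (auto simp: osc_set_below_def)

text \<open>The gaps between points and their successors are disjoint nonempty open intervals;
  nonemptiness makes the assignment of gaps injective.\<close>

lemma countable_osc_set_below: "countable (osc_set_below a b A \<epsilon>)"
proof -
  let ?J = "\<lambda>\<beta>. {\<beta><..<successor \<Lambda> \<beta>}" and ?L = "osc_set_below a b A \<epsilon>"
  have disj: "?J \<beta> \<inter> ?J \<gamma> = {}" if "\<beta> \<in> ?L" "\<gamma> \<in> ?L" "\<beta> < \<gamma>" for \<beta> \<gamma>
    using osc_set_below(5)[of \<beta> \<gamma>] that by (auto simp: osc_set_below_def)
  have ne: "?J \<beta> \<noteq> {}" if "\<beta> \<in> ?L" for \<beta> using osc_set_below(3)[OF that] by simp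
  have "inj_on ?J ?L"
  proof (rule inj_onI)
    fix \<beta> \<gamma> assume *: "\<beta> \<in> ?L" "\<gamma> \<in> ?L" "?J \<beta> = ?J \<gamma>"
    then show "\<beta> = \<gamma>" using disj[of \<beta> \<gamma>] disj[of \<gamma> \<beta>] ne[of \<beta>] ne[of \<gamma>]
      by (cases \<beta> \<gamma> rule: linorder_cases) auto
  qed
  moreover have "countable (?J ` ?L)"
  proof (rule countable_disjoint_open_subsets)
    show "disjoint (?J ` ?L)"
    proof (rule pairwise_imageI)
      fix \<beta> \<gamma> assume "\<beta> \<in> ?L" "\<gamma> \<in> ?L" "\<beta> \<noteq> \<gamma>"
      then show "disjnt (?J \<beta>) (?J \<gamma>)"
        unfolding disjnt_def using disj[of \<beta> \<gamma>] disj[of \<gamma> \<beta>] by (cases \<beta> \<gamma> rule: linorder_cases) blast+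
    qed
  qed auto
  ultimately show ?thesis by (rule countable_image_inj_on[rotated])
qed

lemma norm_diff_right_lim:
  assumes b: "\<beta> \<in> osc_set_below a b A \<epsilon>" and s: "s \<in> {\<beta><..<successor \<Lambda> \<beta>}"
  shows "norm (A s - right_lim A \<beta>) \<le> \<epsilon>"
proof (rule tendsto_le[OF _ tendsto_const tendsto_norm])
  show "((\<lambda>t. A s - A t) \<longlongrightarrow> A s - right_lim A \<beta>) (at_right \<beta>)"
    using osc_set_below[OF b] by (intro tendsto_intros right_lim)
  show "\<forall>\<^sub>F t in at_right \<beta>. norm (A s - A t) \<le> \<epsilon>"
    using osc_set_below[OF b] s unfolding eventually_at_right_field by (intro exI[of _ "successor \<Lambda> \<beta>"]) auto
qed simp

lemma step_map_eq:
  assumes b: "\<beta> \<in> osc_set_below a b A \<epsilon>" and t: "\<beta> \<le> t" "t < successor \<Lambda> \<beta>"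
  shows "step_map a b A \<epsilon> t = right_lim A \<beta>"
proof -
  have "t < b" "a \<le> t" using t osc_set_below[OF b] by auto
  then have "(THE \<beta>. \<beta> \<in> osc_set_below a b A \<epsilon> \<and> t \<in> {\<beta>..<successor \<Lambda> \<beta>}) = \<beta>"
    using b t by (intro the1_equality[OF ex1_osc_set_interval]) auto
  then show ?thesis using \<open>t < b\<close> by (simp add: step_map_def)
qed

text \<open>Allows the locale to be interpreted for the step map itself, so that results on
  \<open>A\<close> apply to both mappings.\<close>

lemma right_regulated_step_map: "right_regulated a b (step_map a b A \<epsilon>)"
  unfolding right_regulated_def
proof
  fix t assume "t \<in> {a..<b}"
  then obtain \<beta> where b: "\<beta> \<in> osc_set_below a b A \<epsilon>" "\<beta> \<le> t" "t < successor \<Lambda> \<beta>"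
    using osc_set_belowE by auto
  have "\<forall>\<^sub>F s in at_right t. step_map a b A \<epsilon> s = right_lim A \<beta>"
    unfolding eventually_at_right_field using b step_map_eq[OF b(1)]
    by (intro exI[of _ "successor \<Lambda> \<beta>"]) auto
  then have "(step_map a b A \<epsilon> \<longlongrightarrow> right_lim A \<beta>) (at_right t)"
    by (rule tendsto_eventually)
  then show "\<exists>L. (step_map a b A \<epsilon> \<longlongrightarrow> L) (at_right t)" ..
qed

text \<open>The points of the index set are excluded because the value of \<open>A\<close> at
  \<beta> is unrelated to its right limit there; at b both mappings agree.\<close>

lemma norm_diff_step_map:
  assumes "t \<in> {a..b}" "t \<notin> osc_set_below a b A \<epsilon>"
  shows "norm (A t - step_map a b A \<epsilon> t) \<le> \<epsilon>"
proof (cases "t = b")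
  case False
  then obtain \<beta> where b: "\<beta> \<in> osc_set_below a b A \<epsilon>" "\<beta> \<le> t" "t < successor \<Lambda> \<beta>"
    using osc_set_belowE[of t] assms by auto
  moreover have "\<beta> \<noteq> t" using b assms by auto
  ultimately show ?thesis using norm_diff_right_lim[of \<beta> t] step_map_eq[of \<beta> t] by auto
qed (use eps in \<open>simp add: step_map_def\<close>)

end

text \<open>Here the oscillation sets of all \<epsilon> = 1/(n+1) are used together. A point outside
  all of them lies, for each n, in an open gap on which \<open>A\<close> oscillates by at most
  1/(n+1).\<close>

lemma countable_discontinuities:
  "countable {t \<in> {a<..<b}. \<not> isCont A t}"
proof (rule countable_subset)
  show "countable (\<Union>n. osc_set_below a b A (1 / Suc n))"
    by (intro countable_UN countable_osc_set_below) auto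
  show "{t \<in> {a<..<b}. \<not> isCont A t} \<subseteq> (\<Union>n. osc_set_below a b A (1 / Suc n))"
  proof (rule ccontr)
    assume "\<not> {t \<in> {a<..<b}. \<not> isCont A t} \<subseteq> (\<Union>n. osc_set_below a b A (1 / Suc n))"
    then obtain t where t: "a < t" "t < b" "\<not> isCont A t" "\<And>n. t \<notin> osc_set_below a b A (1 / Suc n)"
      by auto
    have "isCont A t"
      unfolding continuous_at_eps_delta
    proof (intro allI impI)
      fix e :: real assume "e > 0"
      then obtain n where n: "1 / Suc n < e" using nat_approx_posE by blast
      define \<epsilon> where "\<epsilon> = 1 / Suc n"
      have e: "\<epsilon> > 0" by (simp add: \<epsilon>_def)
      obtain \<beta> where b: "\<beta> \<in> osc_set_below a b A \<epsilon>" "\<beta> \<le> t" "t < successor (osc_set a b A \<epsilon>) \<beta>"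
        using osc_set_belowE[OF e, of t] t by auto
      then have bt: "\<beta> < t" using t(4)[of n] by (metis \<epsilon>_def order_le_imp_less_or_eq)
      define d where "d = min (t - \<beta>) (successor (osc_set a b A \<epsilon>) \<beta> - t)"
      show "\<exists>d>0. \<forall>s. dist s t < d \<longrightarrow> dist (A s) (A t) < e"
      proof (intro exI[of _ d] conjI allI impI)
        show "d > 0" using b bt by (simp add: d_def)
        fix s assume "dist s t < d"
        then have "norm (A s - A t) \<le> \<epsilon>"
          using b bt by (intro osc_set_below(6)[OF e b(1)]) (auto simp: d_def dist_real_def)
        then show "dist (A s) (A t) < e" using n by (simp add: dist_norm \<epsilon>_def)
      qed
    qed
    then show False using t by simp
  qed
qed

end

subsection \<open>Summable and multipliable families\<close>

text \<open>Case split for induction over \<Lambda>, while limit elements refer to \<Lambda>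
  enlarged by its supremum. A predecessor found in the enlarged set is smaller than Sup \<Lambda>,
  hence already in \<Lambda>.\<close>

lemma family_index_cases:
  fixes \<Lambda> :: "'i::conditionally_complete_linorder set"
  assumes "bdd_above \<Lambda>" "\<gamma> \<in> \<Lambda>"
  obtains (min) "\<gamma> = Inf \<Lambda>" "\<And>\<alpha>. \<alpha> \<in> \<Lambda> \<Longrightarrow> \<gamma> \<le> \<alpha>"
  | (succ) \<beta> where "\<beta> \<in> \<Lambda>" "is_successor \<Lambda> \<beta> \<gamma>"
  | (limit) "limit_element (insert (Sup \<Lambda>) \<Lambda>) \<gamma>"
proof -
  have gS: "\<gamma> \<le> Sup \<Lambda>" using assms by (intro cSup_upper)
  consider "\<forall>\<delta>\<in>\<Lambda>. \<gamma> \<le> \<delta>" | \<delta> where "\<delta> \<in> \<Lambda>" "\<delta> < \<gamma>" by force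
  then show thesis
  proof cases
    case 1
    then show ?thesis using assms by (intro min cInf_eq_minimum[symmetric]) auto
  next
    case 2
    show ?thesis
    proof (cases "limit_element (insert (Sup \<Lambda>) \<Lambda>) \<gamma>")
      case False
      then obtain \<beta> where "\<beta> \<in> insert (Sup \<Lambda>) \<Lambda>" "is_successor (insert (Sup \<Lambda>) \<Lambda>) \<beta> \<gamma>"
        using 2 assms unfolding limit_element_def by blast
      then show ?thesis
        using gS assms by (intro succ[of \<beta>]) (auto simp: is_successor_def)
    qed (rule limit)
  qed
qed

text \<open>Without a maximum, the value of the partial sums at Sup \<Lambda> is tied to the family
  only through the limit condition; this lemma makes that condition applicable.\<close>

lemma limit_element_Sup:
  fixes \<Lambda> :: "'i::conditionally_complete_linorder set"
  assumes "\<Lambda> \<noteq> {}" "bdd_above \<Lambda>" "Sup \<Lambda> \<notin> \<Lambda>"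
  shows "limit_element (insert (Sup \<Lambda>) \<Lambda>) (Sup \<Lambda>)"
proof -
  obtain \<delta> where "\<delta> \<in> \<Lambda>" using assms by blast
  then have "\<delta> < Sup \<Lambda>"
    using assms cSup_upper[of \<delta> \<Lambda>] by (metis order_le_imp_less_or_eq)
  moreover have "\<not> is_successor (insert (Sup \<Lambda>) \<Lambda>) \<beta> (Sup \<Lambda>)" for \<beta>
  proof
    assume s: "is_successor (insert (Sup \<Lambda>) \<Lambda>) \<beta> (Sup \<Lambda>)"
    then have "\<beta> < Sup \<Lambda>" by (simp add: is_successor_def)
    then obtain \<delta> where "\<delta> \<in> \<Lambda>" "\<beta> < \<delta>" using assms by (auto simp: less_cSup_iff)
    then have "\<delta> = Sup \<Lambda>"
      using s assms cSup_upper[of \<delta> \<Lambda>] by (auto simp: is_successor_def intro: antisym)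
    then show False using \<open>\<delta> \<in> \<Lambda>\<close> assms by simp
  qed
  ultimately show ?thesis
    using \<open>\<delta> \<in> \<Lambda>\<close> by (auto simp: limit_element_def)
qed

lemma limit_elementD:
  fixes \<Lambda> :: "'i::conditionally_complete_linorder set"
  assumes "bdd_above \<Lambda>" "limit_element (insert (Sup \<Lambda>) \<Lambda>) \<gamma>"
  shows "\<exists>\<delta>\<in>\<Lambda>. \<delta> < \<gamma>" "\<And>\<beta>. \<beta> \<in> \<Lambda> \<Longrightarrow> \<beta> < \<gamma> \<Longrightarrow> \<exists>\<delta>\<in>\<Lambda>. \<beta> < \<delta> \<and> \<delta> < \<gamma>"
proof -
  have gS: "\<gamma> \<le> Sup \<Lambda>" using assms by (auto simp: limit_element_def intro: cSup_upper)
  show "\<exists>\<delta>\<in>\<Lambda>. \<delta> < \<gamma>"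
    using assms(2) gS by (auto simp: limit_element_def)
  fix \<beta> assume b: "\<beta> \<in> \<Lambda>" "\<beta> < \<gamma>"
  then have "\<not> is_successor (insert (Sup \<Lambda>) \<Lambda>) \<beta> \<gamma>"
    using assms(2) by (auto simp: limit_element_def)
  then have "\<not> (\<forall>\<delta>\<in>insert (Sup \<Lambda>) \<Lambda>. \<beta> < \<delta> \<longrightarrow> \<gamma> \<le> \<delta>)"
    using b assms(2) unfolding is_successor_def limit_element_def by blast
  then obtain \<delta> where "\<delta> \<in> insert (Sup \<Lambda>) \<Lambda>" "\<beta> < \<delta>" "\<delta> < \<gamma>"
    unfolding not_le[symmetric] by blast
  then show "\<exists>\<delta>\<in>\<Lambda>. \<beta> < \<delta> \<and> \<delta> < \<gamma>"
    using gS by auto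
qed

text \<open>At a limit element the bound uses that all late partial sums are close to the limit, since
  the partial sums are not known to be monotone.\<close>

lemma sum_le_partial_sum:
  fixes \<Lambda> :: "'i::conditionally_complete_linorder set" and x :: "'i \<Rightarrow> real"
  assumes wf: "wfp_on \<Lambda> (<)" and bdd: "bdd_above \<Lambda>" and nonneg: "\<And>\<beta>. \<beta> \<in> \<Lambda> \<Longrightarrow> 0 \<le> x \<beta>"
    and zero: "\<sigma> (Inf \<Lambda>) = 0"
    and succ: "\<And>\<beta> \<gamma>. \<beta> \<in> \<Lambda> \<Longrightarrow> is_successor \<Lambda> \<beta> \<gamma> \<Longrightarrow> \<sigma> \<gamma> = x \<beta> + \<sigma> \<beta>"
    and lim: "partial_limits \<Lambda> \<sigma>"
  shows "\<gamma> \<in> \<Lambda> \<or> limit_element (insert (Sup \<Lambda>) \<Lambda>) \<gamma> \<Longrightarrow>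
    finite F \<Longrightarrow> F \<subseteq> {\<alpha>\<in>\<Lambda>. \<alpha> < \<gamma>} \<Longrightarrow> sum x F \<le> \<sigma> \<gamma>"
proof -
  have at_limit: "sum x F \<le> \<sigma> \<gamma>"
    \<comment> \<open>Kept apart from the induction over \<Lambda>, because the limit element may be
      Sup \<Lambda>, which need not belong to \<Lambda>.\<close>
    if g: "limit_element (insert (Sup \<Lambda>) \<Lambda>) \<gamma>"
      and IH: "\<And>\<beta> F. \<beta> \<in> \<Lambda> \<Longrightarrow> \<beta> < \<gamma> \<Longrightarrow> finite F \<Longrightarrow> F \<subseteq> {\<alpha>\<in>\<Lambda>. \<alpha> < \<beta>} \<Longrightarrow> sum x F \<le> \<sigma> \<beta>"
      and F: "finite F" "F \<subseteq> {\<alpha>\<in>\<Lambda>. \<alpha> < \<gamma>}" for \<gamma> F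
  proof (rule field_le_epsilon)
    fix \<eta> :: real assume "\<eta> > 0"
    then obtain \<beta>0 where b0: "\<beta>0 \<in> \<Lambda>" "\<beta>0 < \<gamma>" "\<And>\<beta>. \<beta> \<in> \<Lambda> \<inter> {\<beta>0..<\<gamma>} \<Longrightarrow> norm (\<sigma> \<beta> - \<sigma> \<gamma>) < \<eta>"
      using lim g unfolding partial_limits_def by blast
    define m where "m = Max (insert \<beta>0 F)"
    have "m \<in> insert \<beta>0 F" unfolding m_def using F by (intro Max_in) auto
    then have "m \<in> \<Lambda>" "m < \<gamma>" using b0 F by auto
    then obtain \<beta> where b: "\<beta> \<in> \<Lambda>" "m < \<beta>" "\<beta> < \<gamma>" using limit_elementD(2)[OF bdd g] by blast
    have le: "y \<le> m" if "y \<in> insert \<beta>0 F" for y unfolding m_def using F that by (intro Max_ge) auto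
    have "sum x F \<le> \<sigma> \<beta>"
      using b F le by (intro IH) (auto intro: le_less_trans)
    moreover have "norm (\<sigma> \<beta> - \<sigma> \<gamma>) < \<eta>"
      using b le[of \<beta>0] by (intro b0(3)) auto
    ultimately show "sum x F \<le> \<sigma> \<gamma> + \<eta>" by (auto simp: abs_if split: if_splits)
  qed
  have main: "sum x F \<le> \<sigma> \<gamma>"
    if "\<gamma> \<in> \<Lambda>" "finite F" "F \<subseteq> {\<alpha>\<in>\<Lambda>. \<alpha> < \<gamma>}" for \<gamma> F
    using wf that
  proof (induction arbitrary: F rule: wfp_on_induct[consumes 2, case_names less])
    case (less \<gamma>)
    from bdd less(1) show ?case
    proof (cases rule: family_index_cases)
      case min
      then have "F = {}" using less by force
      then show ?thesis using min zero by simp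
    next
      case (succ \<beta>)
      have b: "\<beta> < \<gamma>" using succ by (simp add: is_successor_def)
      \<comment> \<open>Inserting \<beta> treats the cases with and without \<beta> in F alike;
        nonnegativity pays for the enlargement.\<close>
      have "sum x F \<le> sum x (insert \<beta> (F - {\<beta>}))"
        using less succ by (intro sum_mono2) (auto intro: nonneg)
      also have "\<dots> = x \<beta> + sum x (F - {\<beta>})"
        using less by (subst sum.insert) auto
      also have "sum x (F - {\<beta>}) \<le> \<sigma> \<beta>"
      proof (rule less(2))
        show "F - {\<beta>} \<subseteq> {\<alpha>\<in>\<Lambda>. \<alpha> < \<beta>}"
          using less succ by (force simp: is_successor_def)
      qed (use less succ b in auto)
      finally show ?thesis using assms(5) succ by simp
    next
      case limit
      show ?thesis by (rule at_limit[OF limit]) (use less in auto)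
    qed
  qed
  show "\<gamma> \<in> \<Lambda> \<or> limit_element (insert (Sup \<Lambda>) \<Lambda>) \<gamma> \<Longrightarrow>
    finite F \<Longrightarrow> F \<subseteq> {\<alpha>\<in>\<Lambda>. \<alpha> < \<gamma>} \<Longrightarrow> sum x F \<le> \<sigma> \<gamma>"
    using main at_limit by blast
qed

text \<open>For nonnegative terms the transfinite sum is the unordered one: finite sums are bounded
  by the partial sums, and conversely unordered sums over initial segments satisfy the recursion and
  the limit condition.\<close>

lemma summable_family_iff_summable_on:
  fixes \<Lambda> :: "'i::conditionally_complete_linorder set" and x :: "'i \<Rightarrow> real"
  assumes wf: "wfp_on \<Lambda> (<)" and bdd: "bdd_above \<Lambda>" and ne: "\<Lambda> \<noteq> {}"
    and nonneg: "\<And>\<beta>. \<beta> \<in> \<Lambda> \<Longrightarrow> 0 \<le> x \<beta>"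
  shows "summable_family \<Lambda> x \<longleftrightarrow> x summable_on \<Lambda>"
proof
  assume "summable_family \<Lambda> x"
  then obtain \<sigma> where \<sigma>: "\<sigma> (Inf \<Lambda>) = 0" "partial_limits \<Lambda> \<sigma>"
    "\<And>\<beta> \<gamma>. \<beta> \<in> \<Lambda> \<Longrightarrow> is_successor \<Lambda> \<beta> \<gamma> \<Longrightarrow> \<sigma> \<gamma> = x \<beta> + \<sigma> \<beta>"
    unfolding summable_family_def by blast
  note le = sum_le_partial_sum[OF wf bdd nonneg \<sigma>(1) \<sigma>(3) \<sigma>(2)]
  \<comment> \<open>The partial sum at Sup \<Lambda> collects only the terms strictly below it, so a
    maximum of \<Lambda> contributes its own term separately.\<close>
  have bound: "sum x F \<le> \<sigma> (Sup \<Lambda>) + (if Sup \<Lambda> \<in> \<Lambda> then x (Sup \<Lambda>) else 0)"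
    if F: "finite F" "F \<subseteq> \<Lambda>" for F
  proof (cases "Sup \<Lambda> \<in> \<Lambda>")
    case True
    have "sum x F \<le> sum x (insert (Sup \<Lambda>) (F - {Sup \<Lambda>}))"
      using F True by (intro sum_mono2) (auto intro: nonneg)
    also have "\<dots> = x (Sup \<Lambda>) + sum x (F - {Sup \<Lambda>})"
      using F by (subst sum.insert) auto
    also have "sum x (F - {Sup \<Lambda>}) \<le> \<sigma> (Sup \<Lambda>)"
      using F True bdd cSup_upper[of _ \<Lambda>] by (intro le) (auto simp: order_less_le)
    finally show ?thesis using True by simp
  next
    case False
    have "sum x F \<le> \<sigma> (Sup \<Lambda>)"
    proof (rule le)
      show "F \<subseteq> {\<alpha> \<in> \<Lambda>. \<alpha> < Sup \<Lambda>}"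
        using F False bdd cSup_upper[of _ \<Lambda>] by (auto simp: order_less_le)
    qed (use F limit_element_Sup[OF ne bdd False] in auto)
    then show ?thesis using False by simp
  qed
  show "x summable_on \<Lambda>"
    by (rule nonneg_bounded_partial_sums_imp_summable_on[OF nonneg])
       (use bound in \<open>auto simp: eventually_finite_subsets_at_top intro!: exI[of _ "{}"]\<close>)
next
  assume sum: "x summable_on \<Lambda>"
  define \<sigma> where "\<sigma> \<gamma> = infsum x {\<alpha>\<in>\<Lambda>. \<alpha> < \<gamma>}" for \<gamma>
  have sum': "x summable_on {\<alpha>\<in>\<Lambda>. \<alpha> < \<gamma>}" for \<gamma>
    by (rule summable_on_subset_banach[OF sum]) auto
  have mono: "\<sigma> \<beta> \<le> \<sigma> \<gamma>" if "\<beta> \<le> \<gamma>" for \<beta> \<gamma>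
    unfolding \<sigma>_def using that by (intro infsum_mono2 sum') (auto intro: nonneg)
  have "Inf \<Lambda> \<le> \<alpha>" if "\<alpha> \<in> \<Lambda>" for \<alpha>
  proof -
    obtain m where m: "m \<in> \<Lambda>" "\<And>y. y \<in> \<Lambda> \<Longrightarrow> m \<le> y"
      using wf ne unfolding wfp_on_iff_ex_minimal by (metis not_le subset_refl)
    then show ?thesis using that cInf_eq_minimum[of m \<Lambda>] by auto
  qed
  then have "{\<alpha>\<in>\<Lambda>. \<alpha> < Inf \<Lambda>} = {}" by force
  then have zero: "\<sigma> (Inf \<Lambda>) = 0" unfolding \<sigma>_def by (subst \<open>_ = {}\<close>) (rule infsum_empty)
  have succ: "\<sigma> \<gamma> = x \<beta> + \<sigma> \<beta>" if "\<beta> \<in> \<Lambda>" "is_successor \<Lambda> \<beta> \<gamma>" for \<beta> \<gamma>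
  proof -
    have "{\<alpha>\<in>\<Lambda>. \<alpha> < \<gamma>} = {\<beta>} \<union> {\<alpha>\<in>\<Lambda>. \<alpha> < \<beta>}"
      using that by (force simp: is_successor_def)
    then show ?thesis
      unfolding \<sigma>_def by (subst infsum_Un_disjoint[symmetric, of x "{\<beta>}", simplified]) (auto intro: sum')
  qed
  have "partial_limits \<Lambda> \<sigma>"
    unfolding partial_limits_def
  proof (intro allI impI)
    fix \<gamma> and \<eta> :: real assume g: "limit_element (insert (Sup \<Lambda>) \<Lambda>) \<gamma>" and "\<eta> > 0"
    have "(sum x \<longlongrightarrow> \<sigma> \<gamma>) (finite_subsets_at_top {\<alpha>\<in>\<Lambda>. \<alpha> < \<gamma>})"
      unfolding \<sigma>_def by (rule infsum_tendsto[OF sum'])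
    \<comment> \<open>Some finite sum is already \<eta>-close to \<sigma> \<gamma>; for every
      \<beta> beyond its indices, \<sigma> \<beta> is squeezed between the two.\<close>
    then have "\<forall>\<^sub>F F in finite_subsets_at_top {\<alpha>\<in>\<Lambda>. \<alpha> < \<gamma>}. dist (sum x F) (\<sigma> \<gamma>) < \<eta>"
      using \<open>\<eta> > 0\<close> by (rule tendstoD)
    then obtain F where F: "finite F" "F \<subseteq> {\<alpha>\<in>\<Lambda>. \<alpha> < \<gamma>}" "dist (sum x F) (\<sigma> \<gamma>) < \<eta>"
      unfolding eventually_finite_subsets_at_top by blast
    obtain \<delta> where d: "\<delta> \<in> \<Lambda>" "\<delta> < \<gamma>" using limit_elementD(1)[OF bdd g] by blast
    define m where "m = Max (insert \<delta> F)"
    have "m \<in> insert \<delta> F" unfolding m_def using F by (intro Max_in) auto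
    then have "m \<in> \<Lambda>" "m < \<gamma>" using d F by auto
    then obtain \<beta>0 where b: "\<beta>0 \<in> \<Lambda>" "m < \<beta>0" "\<beta>0 < \<gamma>" using limit_elementD(2)[OF bdd g] by blast
    have le: "y \<le> m" if "y \<in> insert \<delta> F" for y unfolding m_def using F that by (intro Max_ge) auto
    have "norm (\<sigma> \<beta> - \<sigma> \<gamma>) < \<eta>" if "\<beta> \<in> \<Lambda> \<inter> {\<beta>0..<\<gamma>}" for \<beta>
    proof -
      have "sum x F \<le> \<sigma> \<beta>"
        unfolding \<sigma>_def
        using F b le that by (intro finite_sum_le_infsum sum') (force intro: nonneg)+
      moreover have "\<sigma> \<beta> \<le> \<sigma> \<gamma>" using that by (intro mono) auto
      ultimately show ?thesis using F(3) by (auto simp: dist_real_def)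
    qed
    then show "\<exists>\<beta>\<^sub>\<eta>\<in>\<Lambda>. \<beta>\<^sub>\<eta> < \<gamma> \<and> (\<forall>\<beta>\<in>\<Lambda> \<inter> {\<beta>\<^sub>\<eta>..<\<gamma>}. norm (\<sigma> \<beta> - \<sigma> \<gamma>) < \<eta>)"
      using b by blast
  qed
  then show "summable_family \<Lambda> x"
    unfolding summable_family_def using zero succ by blast
qed

text \<open>Continuity is asked only at the values over limit elements. This suits
  \<open>ln\<close>, whose argument is known to be at least 1 there.\<close>

lemma partial_limits_compose:
  assumes lim: "partial_limits \<Lambda> \<sigma>"
    and cont: "\<And>\<gamma>. limit_element (insert (Sup \<Lambda>) \<Lambda>) \<gamma> \<Longrightarrow> isCont f (\<sigma> \<gamma>)"
  shows "partial_limits \<Lambda> (\<lambda>\<gamma>. f (\<sigma> \<gamma>))"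
  unfolding partial_limits_def
proof (intro allI impI)
  fix \<gamma> and \<eta> :: real assume g: "limit_element (insert (Sup \<Lambda>) \<Lambda>) \<gamma>" and "\<eta> > 0"
  obtain d where d: "d > 0" "\<And>y. norm (y - \<sigma> \<gamma>) < d \<Longrightarrow> norm (f y - f (\<sigma> \<gamma>)) < \<eta>"
    using cont[OF g] \<open>\<eta> > 0\<close> unfolding continuous_at_eps_delta dist_norm by blast
  show "\<exists>\<beta>\<^sub>\<eta>\<in>\<Lambda>. \<beta>\<^sub>\<eta> < \<gamma> \<and> (\<forall>\<beta>\<in>\<Lambda> \<inter> {\<beta>\<^sub>\<eta>..<\<gamma>}. norm (f (\<sigma> \<beta>) - f (\<sigma> \<gamma>)) < \<eta>)"
    using lim g d unfolding partial_limits_def by meson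
qed

text \<open>Before logarithms can be taken, the partial products must be bounded below. Factors at
  least 1 keep them at least 1 at successors, and approximation by earlier products does so at
  limits, including Sup \<Lambda>.\<close>

lemma multipliable_family_iff_summable_family_ln:
  fixes \<Lambda> :: "'i::conditionally_complete_linorder set" and x :: "'i \<Rightarrow> real"
  assumes wf: "wfp_on \<Lambda> (<)" and bdd: "bdd_above \<Lambda>"
    and ge1: "\<And>\<beta>. \<beta> \<in> \<Lambda> \<Longrightarrow> 1 \<le> x \<beta>"
  shows "multipliable_family \<Lambda> x \<longleftrightarrow> summable_family \<Lambda> (\<lambda>\<beta>. ln (x \<beta>))"
proof
  assume "multipliable_family \<Lambda> x"
  then obtain \<sigma> where \<sigma>: "\<sigma> (Inf \<Lambda>) = 1" and lim: "partial_limits \<Lambda> \<sigma>"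
    and mult: "\<And>\<beta> \<gamma>. \<beta> \<in> \<Lambda> \<Longrightarrow> is_successor \<Lambda> \<beta> \<gamma> \<Longrightarrow> \<sigma> \<gamma> = x \<beta> * \<sigma> \<beta>"
    unfolding multipliable_family_def by blast
  have at_limit: "1 \<le> \<sigma> \<gamma>"
    if g: "limit_element (insert (Sup \<Lambda>) \<Lambda>) \<gamma>"
      and IH: "\<And>\<beta>. \<beta> \<in> \<Lambda> \<Longrightarrow> \<beta> < \<gamma> \<Longrightarrow> 1 \<le> \<sigma> \<beta>" for \<gamma>
  proof (rule field_le_epsilon)
    fix \<eta> :: real assume "\<eta> > 0"
    then obtain \<beta> where "\<beta> \<in> \<Lambda>" "\<beta> < \<gamma>" "\<forall>\<beta>'\<in>\<Lambda> \<inter> {\<beta>..<\<gamma>}. norm (\<sigma> \<beta>' - \<sigma> \<gamma>) < \<eta>"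
      using lim g unfolding partial_limits_def by blast
    then have "1 \<le> \<sigma> \<beta>" "norm (\<sigma> \<beta> - \<sigma> \<gamma>) < \<eta>" using IH by auto
    then show "1 \<le> \<sigma> \<gamma> + \<eta>" by (auto simp: abs_if split: if_splits)
  qed
  have pos: "1 \<le> \<sigma> \<gamma>" if "\<gamma> \<in> \<Lambda>" for \<gamma>
    using wf that
  proof (induction rule: wfp_on_induct[consumes 2, case_names less])
    case (less \<gamma>)
    from bdd less(1) show ?case
    proof (cases rule: family_index_cases)
      case (succ \<beta>)
      then have "1 \<le> x \<beta>" "1 \<le> \<sigma> \<beta>" using less ge1 by (auto simp: is_successor_def)
      then have "1 * 1 \<le> x \<beta> * \<sigma> \<beta>" by (intro mult_mono) auto
      then show ?thesis using succ mult by simp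
    next
      case min
      then show ?thesis using \<sigma> by simp
    next
      case limit
      show ?thesis by (rule at_limit[OF limit]) (use less in auto)
    qed
  qed
  have "partial_limits \<Lambda> (\<lambda>\<gamma>. ln (\<sigma> \<gamma>))"
    using at_limit pos by (intro partial_limits_compose[OF lim] isCont_ln') fastforce+
  moreover have "ln (\<sigma> \<gamma>) = ln (x \<beta>) + ln (\<sigma> \<beta>)" if "\<beta> \<in> \<Lambda>" "is_successor \<Lambda> \<beta> \<gamma>" for \<beta> \<gamma>
    using mult[OF that] pos[OF that(1)] ge1[OF that(1)] by (simp add: ln_mult)
  ultimately show "summable_family \<Lambda> (\<lambda>\<beta>. ln (x \<beta>))"
    unfolding summable_family_def using \<sigma> by (intro exI[of _ "\<lambda>\<gamma>. ln (\<sigma> \<gamma>)"]) auto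
next
  assume "summable_family \<Lambda> (\<lambda>\<beta>. ln (x \<beta>))"
  then obtain \<sigma> where \<sigma>: "\<sigma> (Inf \<Lambda>) = 0" and lim: "partial_limits \<Lambda> \<sigma>"
    and succ: "\<And>\<beta> \<gamma>. \<beta> \<in> \<Lambda> \<Longrightarrow> is_successor \<Lambda> \<beta> \<gamma> \<Longrightarrow> \<sigma> \<gamma> = ln (x \<beta>) + \<sigma> \<beta>"
    unfolding summable_family_def by blast
  have "partial_limits \<Lambda> (\<lambda>\<gamma>. exp (\<sigma> \<gamma>))"
    by (intro partial_limits_compose[OF lim] isCont_exp)
  moreover have "exp (\<sigma> \<gamma>) = x \<beta> * exp (\<sigma> \<beta>)" if "\<beta> \<in> \<Lambda>" "is_successor \<Lambda> \<beta> \<gamma>" for \<beta> \<gamma>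
    using succ[OF that] ge1[OF that(1)] by (simp add: exp_add)
  ultimately show "multipliable_family \<Lambda> x"
    unfolding multipliable_family_def using \<sigma> by (intro exI[of _ "\<lambda>\<gamma>. exp (\<sigma> \<gamma>)"]) auto
qed

text \<open>Each logarithm is at most the total B, so 1 + y \<beta> \<le> exp B. Together with y
  \<le> (1 + y) ln (1 + y) this gives the majorant exp B * ln (1 + y \<beta>).\<close>

lemma summable_on_ln_one_plus_iff:
  fixes y :: "'i \<Rightarrow> real"
  assumes nonneg: "\<And>\<beta>. \<beta> \<in> \<Lambda> \<Longrightarrow> 0 \<le> y \<beta>"
  shows "(\<lambda>\<beta>. ln (1 + y \<beta>)) summable_on \<Lambda> \<longleftrightarrow> y summable_on \<Lambda>"
proof
  assume "y summable_on \<Lambda>"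
  then show "(\<lambda>\<beta>. ln (1 + y \<beta>)) summable_on \<Lambda>"
    by (rule summable_on_comparison_test) (use nonneg in \<open>simp_all add: ln_add_one_self_le_self\<close>)
next
  assume s: "(\<lambda>\<beta>. ln (1 + y \<beta>)) summable_on \<Lambda>"
  define B where "B = infsum (\<lambda>\<beta>. ln (1 + y \<beta>)) \<Lambda>"
  have "(\<lambda>\<beta>. exp B * ln (1 + y \<beta>)) summable_on \<Lambda>"
    by (rule summable_on_cmult_right[OF s])
  then show "y summable_on \<Lambda>"
  proof (rule summable_on_comparison_test)
    fix \<beta> assume b: "\<beta> \<in> \<Lambda>"
    have "ln (1 + y \<beta>) \<le> B"
      using finite_sum_le_infsum[OF s, of "{\<beta>}"] b nonneg by (auto simp: B_def)
    then have "exp (ln (1 + y \<beta>)) \<le> exp B" by simp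
    then have le: "1 + y \<beta> \<le> exp B" using nonneg[OF b] by simp
    have "y \<beta> / (1 + y \<beta>) \<le> ln (1 + y \<beta>)"
      using ln_diff_le[of 1 "1 + y \<beta>"] nonneg[OF b] by simp
    then have "y \<beta> \<le> (1 + y \<beta>) * ln (1 + y \<beta>)"
      using nonneg[OF b] by (simp add: divide_le_eq mult.commute)
    also have "\<dots> \<le> exp B * ln (1 + y \<beta>)"
      using le nonneg[OF b] by (intro mult_right_mono) auto
    finally show "y \<beta> \<le> exp B * ln (1 + y \<beta>)" .
  qed (rule nonneg)
qed

subsection \<open>Product integrability implies summability\<close>

text \<open>The condition on one cell of a fine free partition, isolated so that partitions can be
  concatenated before they are indexed by numbers.\<close>

definition fine_cell :: "real \<Rightarrow> real \<Rightarrow> (real \<Rightarrow> real) \<Rightarrow> real \<Rightarrow> real \<Rightarrow> real \<Rightarrow> bool" where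
  "fine_cell a b \<delta> s t \<xi> \<longleftrightarrow> s < t \<and> \<xi> \<in> {a..b} \<and> {s..t} \<subseteq> {\<xi> - \<delta> \<xi><..<\<xi> + \<delta> \<xi>}"

text \<open>There are two \<open>\<delta>\<close>-fine free tagged partitions of the interval from \<open>s\<close> to \<open>t\<close> with the same
  division points: one with Riemann sum of \<open>norm \<circ> A\<close> at least \<open>X\<close>, the other with all values of
  \<open>norm \<circ> A\<close> at the tags bounded by \<open>M\<close>.\<close>

inductive paired_partitions for a b :: real and \<delta> and A :: "real \<Rightarrow> 'e::real_normed_vector" and M where
  single: "fine_cell a b \<delta> s t \<xi> \<Longrightarrow> fine_cell a b \<delta> s t \<xi>' \<Longrightarrow> norm (A \<xi>') \<le> M \<Longrightarrow>
    X \<le> norm (A \<xi>) * (t - s) \<Longrightarrow> paired_partitions a b \<delta> A M s t X"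
| snoc: "paired_partitions a b \<delta> A M s u Y \<Longrightarrow>
    fine_cell a b \<delta> u t \<xi> \<Longrightarrow> fine_cell a b \<delta> u t \<xi>' \<Longrightarrow> norm (A \<xi>') \<le> M \<Longrightarrow>
    X \<le> norm (A \<xi>) * (t - u) \<Longrightarrow> paired_partitions a b \<delta> A M s t (Y + X)"

text \<open>The right-hand partition is the first premise because the induction runs along it:
  \<open>snoc\<close> appends cells on the right.\<close>

lemma paired_partitions_join:
  assumes "paired_partitions a b \<delta> A M u t Y" "paired_partitions a b \<delta> A M s u X"
  shows "paired_partitions a b \<delta> A M s t (X + Y)"
  using assms
proof (induction rule: paired_partitions.induct)
  case (single u t \<xi> \<xi>' Y)
  then show ?case by (blast intro: paired_partitions.intros)
next
  case (snoc u v Y t \<xi> \<xi>' Z)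
  then have "paired_partitions a b \<delta> A M s t ((X + Y) + Z)"
    by (blast intro: paired_partitions.intros)
  then show ?case by (simp add: add.assoc)
qed

lemma paired_partitions_mono_bound:
  "paired_partitions a b \<delta> A M s t X \<Longrightarrow> M \<le> M' \<Longrightarrow> paired_partitions a b \<delta> A M' s t X"
  by (induction rule: paired_partitions.induct) (blast intro: paired_partitions.intros order_trans)+

lemma paired_partitionsE:
  assumes "paired_partitions a b \<delta> A M s t X"
  obtains m and \<tau> \<xi> \<xi>' :: "nat \<Rightarrow> real" where "\<tau> 0 = s" "\<tau> m = t"
    "\<And>i. i \<in> {1..m} \<Longrightarrow> fine_cell a b \<delta> (\<tau> (i - 1)) (\<tau> i) (\<xi> i)"
    "\<And>i. i \<in> {1..m} \<Longrightarrow> fine_cell a b \<delta> (\<tau> (i - 1)) (\<tau> i) (\<xi>' i)"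
    "\<And>i. i \<in> {1..m} \<Longrightarrow> norm (A (\<xi>' i)) \<le> M"
    "X \<le> (\<Sum>i=1..m. norm (A (\<xi> i)) * (\<tau> i - \<tau> (i - 1)))"
proof -
  from assms have "\<exists>m (\<tau> :: nat \<Rightarrow> real) \<xi> \<xi>'. \<tau> 0 = s \<and> \<tau> m = t \<and>
    (\<forall>i\<in>{1..m}. fine_cell a b \<delta> (\<tau> (i - 1)) (\<tau> i) (\<xi> i) \<and>
       fine_cell a b \<delta> (\<tau> (i - 1)) (\<tau> i) (\<xi>' i) \<and> norm (A (\<xi>' i)) \<le> M) \<and>
    X \<le> (\<Sum>i=1..m. norm (A (\<xi> i)) * (\<tau> i - \<tau> (i - 1)))"
  proof (induction rule: paired_partitions.induct)
    case (single s t \<xi> \<xi>' X)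
    then show ?case
      by (intro exI[of _ 1] exI[of _ "\<lambda>i. if i = 0 then s else t"] exI[of _ "\<lambda>_. \<xi>"] exI[of _ "\<lambda>_. \<xi>'"]) auto
  next
    case (snoc s u Y t \<xi> \<xi>' X)
    from snoc.IH obtain m and \<tau> \<sigma> \<sigma>' :: "nat \<Rightarrow> real" where *: "\<tau> 0 = s" "\<tau> m = u"
      "\<forall>i\<in>{1..m}. fine_cell a b \<delta> (\<tau> (i - 1)) (\<tau> i) (\<sigma> i) \<and>
        fine_cell a b \<delta> (\<tau> (i - 1)) (\<tau> i) (\<sigma>' i) \<and> norm (A (\<sigma>' i)) \<le> M"
      "Y \<le> (\<Sum>i=1..m. norm (A (\<sigma> i)) * (\<tau> i - \<tau> (i - 1)))"
      by (elim exE conjE) (rule that)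
    define \<tau>2 where "\<tau>2 = \<tau>(Suc m := t)"
    define \<sigma>2 where "\<sigma>2 = \<sigma>(Suc m := \<xi>)"
    define \<sigma>3 where "\<sigma>3 = \<sigma>'(Suc m := \<xi>')"
    have eq: "\<tau>2 (Suc m) = t" "\<sigma>2 (Suc m) = \<xi>" "\<sigma>3 (Suc m) = \<xi>'"
      "\<And>i. i \<le> m \<Longrightarrow> \<tau>2 i = \<tau> i" "\<And>i. i \<le> m \<Longrightarrow> \<sigma>2 i = \<sigma> i" "\<And>i. i \<le> m \<Longrightarrow> \<sigma>3 i = \<sigma>' i"
      by (auto simp: \<tau>2_def \<sigma>2_def \<sigma>3_def)
    have "fine_cell a b \<delta> (\<tau>2 (i - 1)) (\<tau>2 i) (\<sigma>2 i) \<and>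
       fine_cell a b \<delta> (\<tau>2 (i - 1)) (\<tau>2 i) (\<sigma>3 i) \<and> norm (A (\<sigma>3 i)) \<le> M" if "i \<in> {1..Suc m}" for i
    proof (cases "i = Suc m")
      case True
      then show ?thesis using snoc *(2) eq by simp
    next
      case False
      then have "i \<in> {1..m}" "i - 1 \<le> m" using that by auto
      then show ?thesis using *(3) eq by simp
    qed
    moreover have "Y + X \<le> (\<Sum>i=1..Suc m. norm (A (\<sigma>2 i)) * (\<tau>2 i - \<tau>2 (i - 1)))"
    proof -
      have "(\<Sum>i=1..m. norm (A (\<sigma>2 i)) * (\<tau>2 i - \<tau>2 (i - 1))) = (\<Sum>i=1..m. norm (A (\<sigma> i)) * (\<tau> i - \<tau> (i - 1)))"
        by (rule sum.cong) (auto simp: eq)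
      then show ?thesis using snoc *(2,4) eq by simp
    qed
    ultimately show ?case
      using * eq by (intro exI[of _ "Suc m"] exI[of _ \<tau>2] exI[of _ \<sigma>2] exI[of _ \<sigma>3]) auto
  qed
  then show thesis using that by blast
qed

text \<open>On a cell of length h, the vector h A(\<xi>) - h A(\<xi>') is a difference of two error
  terms, since \<open>H\<close> depends only on the division points and cancels. Both error sums are
  below 1, hence the 2; the bounded tags contribute at most M (b - a).\<close>

lemma paired_partitions_bound:
  fixes A :: "real \<Rightarrow> 'e::real_normed_algebra_1"
  assumes bound: "\<And>m \<tau> \<xi>. free_tagged_partition a b m \<tau> \<xi> \<Longrightarrow> fine_partition \<delta> m \<tau> \<xi> \<Longrightarrow>
      (\<Sum>i=1..m. norm (1 + (\<tau> i - \<tau> (i - 1)) *\<^sub>R A (\<xi> i) - H (\<tau> (i - 1)) (\<tau> i))) < 1"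
    and pp: "paired_partitions a b \<delta> A M a b X"
  shows "X \<le> 2 + M * (b - a)"
proof -
  from pp obtain m and \<tau> \<xi> \<xi>' :: "nat \<Rightarrow> real" where *: "\<tau> 0 = a" "\<tau> m = b"
    "\<forall>i\<in>{1..m}. fine_cell a b \<delta> (\<tau> (i - 1)) (\<tau> i) (\<xi> i)"
    "\<forall>i\<in>{1..m}. fine_cell a b \<delta> (\<tau> (i - 1)) (\<tau> i) (\<xi>' i)"
    "\<forall>i\<in>{1..m}. norm (A (\<xi>' i)) \<le> M"
    "X \<le> (\<Sum>i=1..m. norm (A (\<xi> i)) * (\<tau> i - \<tau> (i - 1)))"
    by (elim paired_partitionsE) (rule that; (rule ballI)?; assumption?; simp)
  define R where "R \<xi> i = norm (1 + (\<tau> i - \<tau> (i - 1)) *\<^sub>R A (\<xi> i) - H (\<tau> (i - 1)) (\<tau> i))" for \<xi> and i :: nat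
  have 1: "(\<Sum>i=1..m. R \<xi> i) < 1" "(\<Sum>i=1..m. R \<xi>' i) < 1"
    unfolding R_def using *(1-4)
    by (intro bound; auto simp: free_tagged_partition_def fine_partition_def fine_cell_def)+
  have "X \<le> (\<Sum>i=1..m. R \<xi> i + R \<xi>' i + M * (\<tau> i - \<tau> (i - 1)))"
  proof (rule order_trans[OF *(6) sum_mono])
    fix i assume i: "i \<in> {1..m}"
    define h where "h = \<tau> i - \<tau> (i - 1)"
    have h: "h > 0" using *(3) i by (simp add: fine_cell_def h_def)
    have "norm (h *\<^sub>R A (\<xi> i)) = norm ((1 + h *\<^sub>R A (\<xi> i) - H (\<tau> (i - 1)) (\<tau> i)) -
      (1 + h *\<^sub>R A (\<xi>' i) - H (\<tau> (i - 1)) (\<tau> i)) + h *\<^sub>R A (\<xi>' i))"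
      by (simp add: algebra_simps)
    also have "\<dots> \<le> R \<xi> i + R \<xi>' i + norm (h *\<^sub>R A (\<xi>' i))"
      unfolding R_def h_def by (intro norm_triangle_le add_right_mono norm_triangle_ineq4)
    also have "norm (h *\<^sub>R A (\<xi>' i)) \<le> M * h"
      using *(5) i h by (simp add: mult.commute)
    finally show "norm (A (\<xi> i)) * (\<tau> i - \<tau> (i - 1)) \<le> R \<xi> i + R \<xi>' i + M * (\<tau> i - \<tau> (i - 1))"
      using h by (simp add: h_def mult.commute)
  qed
  also have "\<dots> = (\<Sum>i=1..m. R \<xi> i) + (\<Sum>i=1..m. R \<xi>' i) + M * (\<Sum>i=1..m. \<tau> i - \<tau> (i - 1))"
    by (simp add: sum.distrib sum_distrib_left)
  also have "(\<Sum>i=1..m. \<tau> i - \<tau> (i - 1)) = \<tau> m - \<tau> 0"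
    by (induction m) auto
  finally show ?thesis using 1 * by simp
qed

text \<open>The point x can tag every cell inside [s,t] and so provides the bounded tags. The others
  come from bisection: a cell that is short compared to \<delta> y is tagged by a point y of its
  own, where the lower bound c holds.\<close>

lemma paired_partitions_const:
  assumes gauge: "\<And>t. t \<in> {a..b} \<Longrightarrow> \<delta> t > 0"
    and x: "x \<in> {a..b}" "{s..t} \<subseteq> {x - \<delta> x<..<x + \<delta> x}"
    and st: "a \<le> s" "s < t" "t \<le> b" and c: "\<And>\<xi>. \<xi> \<in> {s..t} \<Longrightarrow> c \<le> norm (A \<xi>)"
  shows "paired_partitions a b \<delta> A (norm (A x)) s t (c * (t - s))"
proof -
  let ?pp = "\<lambda>s t. paired_partitions a b \<delta> A (norm (A x)) s t (c * (t - s))"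
  \<comment> \<open>The guards make the claim vacuous for degenerate intervals and for those
    sticking out of [s,t], both of which \<open>Bolzano\<close> admits.\<close>
  define P where "P u v \<longleftrightarrow> (s \<le> u \<longrightarrow> u < v \<longrightarrow> v \<le> t \<longrightarrow> ?pp u v)" for u v
  have "s \<le> t" using st by simp
  then have "P s t"
  proof (induction rule: Bolzano)
    case (trans u v w)
    show ?case
    proof (cases "u < v \<and> v < w")
      case True
      have "?pp u w" if "s \<le> u" "w \<le> t"
        using paired_partitions_join[of a b \<delta> A "norm (A x)" v w "c * (w - v)" u "c * (v - u)"] trans True that
        by (simp add: P_def algebra_simps)
      then show ?thesis by (simp add: P_def)
    next
      case False
      then have "u = v \<or> v = w" using trans by linarith
      then show ?thesis using trans by auto
    qed
  next
    case (local y)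
    then have y: "y \<in> {a..b}" using st by auto
    have "P u v" if uv: "u \<le> y" "y \<le> v" "v - u < \<delta> y" for u v
      unfolding P_def
    proof (intro impI)
      assume *: "s \<le> u" "u < v" "v \<le> t"
      have "{u..v} \<subseteq> {s..t}" using * by auto
      then have "fine_cell a b \<delta> u v x" using x * unfolding fine_cell_def by blast
      moreover have "fine_cell a b \<delta> u v y" using * uv y by (auto simp: fine_cell_def)
      moreover have "c * (v - u) \<le> norm (A y) * (v - u)"
        using * c[of y] local by (intro mult_right_mono) auto
      ultimately show "?pp u v" by (intro paired_partitions.single) auto
    qed
    then show ?case using gauge[OF y] by blast
  qed
  then show ?thesis using st by (simp add: P_def)
qed

text \<open>The order of quantifiers is the point: one M serves all subintervals and all lower
  bounds, since pieces for arbitrarily many \<beta> are joined later. Near x the bound is norm (A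
  x); bisection plays the role of a finite subcover, and gluing takes the maximum of the two
  bounds.\<close>

lemma ex_paired_partitions:
  assumes gauge: "\<And>t. t \<in> {a..b} \<Longrightarrow> \<delta> t > 0" and "a \<le> b"
  shows "\<exists>M. \<forall>s t c. a \<le> s \<longrightarrow> s < t \<longrightarrow> t \<le> b \<longrightarrow> (\<forall>\<xi>\<in>{s..t}. c \<le> norm (A \<xi>)) \<longrightarrow>
    paired_partitions a b \<delta> A M s t (c * (t - s))"
proof -
  define P where "P p q \<longleftrightarrow> (\<exists>M. \<forall>s t c. a \<le> s \<longrightarrow> p \<le> s \<longrightarrow> s < t \<longrightarrow> t \<le> q \<longrightarrow> t \<le> b \<longrightarrow>
    (\<forall>\<xi>\<in>{s..t}. c \<le> norm (A \<xi>)) \<longrightarrow> paired_partitions a b \<delta> A M s t (c * (t - s)))" for p q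
  from \<open>a \<le> b\<close> have "P a b"
  proof (induction rule: Bolzano)
    case (trans p u q)
    then obtain M1 M2 where
      M1: "\<And>s t c. a \<le> s \<Longrightarrow> p \<le> s \<Longrightarrow> s < t \<Longrightarrow> t \<le> u \<Longrightarrow> t \<le> b \<Longrightarrow>
        (\<And>\<xi>. \<xi> \<in> {s..t} \<Longrightarrow> c \<le> norm (A \<xi>)) \<Longrightarrow> paired_partitions a b \<delta> A M1 s t (c * (t - s))" and
      M2: "\<And>s t c. a \<le> s \<Longrightarrow> u \<le> s \<Longrightarrow> s < t \<Longrightarrow> t \<le> q \<Longrightarrow> t \<le> b \<Longrightarrow>
        (\<And>\<xi>. \<xi> \<in> {s..t} \<Longrightarrow> c \<le> norm (A \<xi>)) \<Longrightarrow> paired_partitions a b \<delta> A M2 s t (c * (t - s))"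
      unfolding P_def by metis
    define M where "M = max M1 M2"
    have "paired_partitions a b \<delta> A M s t (c * (t - s))"
      if st: "a \<le> s" "p \<le> s" "s < t" "t \<le> q" "t \<le> b" and c: "\<forall>\<xi>\<in>{s..t}. c \<le> norm (A \<xi>)" for s t c
    proof -
      consider "t \<le> u" | "u \<le> s" | "s < u" "u < t" by linarith
      then show ?thesis
      proof cases
        case 1
        show ?thesis by (rule paired_partitions_mono_bound[OF M1]) (use st c 1 in \<open>auto simp: M_def\<close>)
      next
        case 2
        show ?thesis by (rule paired_partitions_mono_bound[OF M2]) (use st c 2 in \<open>auto simp: M_def\<close>)
      next
        case 3
        have "paired_partitions a b \<delta> A M s u (c * (u - s))"
          by (rule paired_partitions_mono_bound[OF M1]) (use st c 3 in \<open>auto simp: M_def\<close>)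
        moreover have "paired_partitions a b \<delta> A M u t (c * (t - u))"
          by (rule paired_partitions_mono_bound[OF M2]) (use st c 3 in \<open>auto simp: M_def\<close>)
        ultimately have "paired_partitions a b \<delta> A M s t (c * (u - s) + c * (t - u))"
          by (rule paired_partitions_join[rotated])
        then show ?thesis by (simp add: algebra_simps)
      qed
    qed
    then show ?case unfolding P_def by blast
  next
    case (local x)
    have "P p q" if pq: "p \<le> x" "x \<le> q" "q - p < \<delta> x" for p q
      unfolding P_def
    proof (intro exI[of _ "norm (A x)"] allI impI)
      fix s t c assume st: "a \<le> s" "p \<le> s" "s < t" "t \<le> q" "t \<le> b" and c: "\<forall>\<xi>\<in>{s..t}. c \<le> norm (A \<xi>)"
      show "paired_partitions a b \<delta> A (norm (A x)) s t (c * (t - s))"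
        by (rule paired_partitions_const) (use gauge local st c pq in auto)
    qed
    then show ?case using gauge[of x] local by auto
  qed
  then show ?thesis unfolding P_def by metis
qed

context right_regulated_interval begin

text \<open>The intervals do not overlap. Inserting the largest index last leaves all earlier
  intervals to the left of it, which requires a variable right end t.\<close>

lemma sum_osc_set_lengths:
  assumes eps: "\<epsilon> > 0" and F: "finite F" "F \<subseteq> osc_set_below a b A \<epsilon>"
  shows "(\<Sum>\<beta>\<in>F. successor (osc_set a b A \<epsilon>) \<beta> - \<beta>) \<le> b - a"
proof -
  let ?S = "successor (osc_set a b A \<epsilon>)"
  note below = osc_set_below[OF eps]
  from F have "\<forall>t. a \<le> t \<longrightarrow> (\<forall>\<beta>\<in>F. ?S \<beta> \<le> t) \<longrightarrow> (\<Sum>\<beta>\<in>F. ?S \<beta> - \<beta>) \<le> t - a"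
  proof (induction rule: finite_linorder_max_induct)
    case (insert \<beta> F)
    show ?case
    proof (intro allI impI)
      fix t assume t: "a \<le> t" "\<forall>\<gamma>\<in>insert \<beta> F. ?S \<gamma> \<le> t"
      have "?S \<gamma> \<le> \<beta>" if "\<gamma> \<in> F" for \<gamma>
        using below(5)[of \<gamma> \<beta>] insert that by (auto simp: osc_set_below_def)
      then have "(\<Sum>\<beta>\<in>F. ?S \<beta> - \<beta>) \<le> \<beta> - a" using insert below(1)[of \<beta>] by auto
      then show "(\<Sum>\<beta>\<in>insert \<beta> F. ?S \<beta> - \<beta>) \<le> t - a"
        using insert t by (subst sum.insert) auto
    qed
  qed simp
  then show ?thesis using below F less by (meson less_imp_le subsetD)
qed

end

lemma strongly_McShane_imp_summable:
  fixes A :: "real \<Rightarrow> 'e::real_normed_algebra_1"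
  assumes "a < b" "right_regulated a b A" and eps: "\<epsilon> > 0"
    and int: "strongly_McShane_product_integrable a b A"
  shows "(\<lambda>\<beta>. (successor (osc_set a b A \<epsilon>) \<beta> - \<beta>) * norm (right_lim A \<beta>)) summable_on osc_set_below a b A \<epsilon>"
proof -
  interpret right_regulated_interval a b A by unfold_locales fact+
  let ?S = "successor (osc_set a b A \<epsilon>)" and ?L = "osc_set_below a b A \<epsilon>"
  note below = osc_set_below[OF eps]
  obtain W where W: "\<forall>\<eta>>0. \<exists>\<delta>. (\<forall>t\<in>{a..b}. \<delta> t > 0) \<and>
    (\<forall>m t \<xi>. free_tagged_partition a b m t \<xi> \<and> fine_partition \<delta> m t \<xi> \<longrightarrow>
      (\<Sum>i=1..m. norm (1 + (t i - t (i - 1)) *\<^sub>R A (\<xi> i) - W (t i) * inv_elem (W (t (i - 1))))) < \<eta>)"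
    using int unfolding strongly_McShane_product_integrable_def by blast
  obtain \<delta> where gauge: "\<And>t. t \<in> {a..b} \<Longrightarrow> \<delta> t > 0" and
    bound: "\<And>m t \<xi>. free_tagged_partition a b m t \<xi> \<Longrightarrow> fine_partition \<delta> m t \<xi> \<Longrightarrow>
      (\<Sum>i=1..m. norm (1 + (t i - t (i - 1)) *\<^sub>R A (\<xi> i) - W (t i) * inv_elem (W (t (i - 1))))) < 1"
    using W[THEN spec, of 1, THEN mp, OF zero_less_one] by blast
  obtain M where M: "\<And>s t c. a \<le> s \<Longrightarrow> s < t \<Longrightarrow> t \<le> b \<Longrightarrow> (\<And>\<xi>. \<xi> \<in> {s..t} \<Longrightarrow> c \<le> norm (A \<xi>)) \<Longrightarrow>
    paired_partitions a b \<delta> A M s t (c * (t - s))"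
    using ex_paired_partitions[of a b \<delta> A, OF gauge less_imp_le[OF \<open>a < b\<close>]] by blast
  \<comment> \<open>Filler between the selected intervals, where only the trivial lower bound 0 is
    claimed.\<close>
  have zero: "paired_partitions a b \<delta> A M s t 0" if "a \<le> s" "s < t" "t \<le> b" for s t
    using M[of s t 0] that by simp
  \<comment> \<open>The middle half accounts for the division by 2, and the oscillation for the loss
    of \<epsilon>. The value may be negative, which the lower bounds \<open>c\<close>
    permit.\<close>
  define x where "x \<beta> = (?S \<beta> - \<beta>) / 2 * (norm (right_lim A \<beta>) - \<epsilon>)" for \<beta>
  have pp: "paired_partitions a b \<delta> A M a b (sum x F)" if F: "finite F" "F \<subseteq> ?L" for F
  proof -
    from F have "\<forall>t. a < t \<longrightarrow> t \<le> b \<longrightarrow> (\<forall>\<beta>\<in>F. ?S \<beta> \<le> t) \<longrightarrow> paired_partitions a b \<delta> A M a t (sum x F)"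
    proof (induction rule: finite_linorder_max_induct)
      case empty
      then show ?case using zero by simp
    next
      case (insert \<beta> F)
      show ?case
      proof (intro allI impI)
        fix t assume t: "a < t" "t \<le> b" "\<forall>\<gamma>\<in>insert \<beta> F. ?S \<gamma> \<le> t"
        have L: "\<beta> \<in> ?L" using insert by simp
        \<comment> \<open>The quarters at both ends keep the closed interval [u,v] inside the open
          gap, where the oscillation bound holds, and leave nondegenerate room for the neighbouring
          pieces even if \<beta> = a or the successor is t.\<close>
        define u v where "u = \<beta> + (?S \<beta> - \<beta>) / 4" and "v = ?S \<beta> - (?S \<beta> - \<beta>) / 4"
        have uv: "\<beta> < u" "u < v" "v < ?S \<beta>" "v - u = (?S \<beta> - \<beta>) / 2"
          using below(3)[OF L] by (auto simp: u_def v_def field_simps)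
        have ab: "a \<le> \<beta>" "?S \<beta> \<le> t" "?S \<beta> \<le> b" using below(1,4)[OF L] t by auto
        have "?S \<gamma> \<le> \<beta>" if "\<gamma> \<in> F" for \<gamma>
          using below(5)[of \<gamma> \<beta>] insert that by (auto simp: osc_set_below_def)
        then have "\<forall>\<gamma>\<in>F. ?S \<gamma> \<le> u" using uv by force
        moreover have "F \<subseteq> ?L" "a < u" "u \<le> b" using insert uv ab by auto
        ultimately have "paired_partitions a b \<delta> A M a u (sum x F)"
          using insert.IH by blast
        moreover have "paired_partitions a b \<delta> A M u v ((norm (right_lim A \<beta>) - \<epsilon>) * (v - u))"
        proof (rule M)
          fix \<xi> assume "\<xi> \<in> {u..v}"
          then have "norm (A \<xi> - right_lim A \<beta>) \<le> \<epsilon>"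
            using uv by (intro norm_diff_right_lim[OF eps L]) auto
          then show "norm (right_lim A \<beta>) - \<epsilon> \<le> norm (A \<xi>)"
            using norm_triangle_ineq2[of "right_lim A \<beta>" "A \<xi>"] by (simp add: norm_minus_commute)
        qed (use uv ab t in auto)
        ultimately have "paired_partitions a b \<delta> A M a v (sum x F + x \<beta>)"
          using paired_partitions_join by (fastforce simp: x_def uv mult.commute)
        moreover have "paired_partitions a b \<delta> A M v t 0"
          using uv ab t by (intro zero) auto
        ultimately have "paired_partitions a b \<delta> A M a t (sum x F + x \<beta> + 0)"
          by (rule paired_partitions_join[rotated])
        moreover have "sum x (insert \<beta> F) = sum x F + x \<beta>"
          using insert by (subst sum.insert) auto
        ultimately show "paired_partitions a b \<delta> A M a t (sum x (insert \<beta> F))"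
          by simp
      qed
    qed
    then show ?thesis using below(4) F \<open>a < b\<close> by auto
  qed
  \<comment> \<open>Solving the definition of \<open>x\<close> for the term gives twice
    \<open>x\<close> plus \<epsilon> times the length; the lengths add up to at most b - a.\<close>
  have "(\<Sum>\<beta>\<in>F. (?S \<beta> - \<beta>) * norm (right_lim A \<beta>)) \<le> 2 * (2 + M * (b - a)) + \<epsilon> * (b - a)"
    if F: "finite F" "F \<subseteq> ?L" for F
  proof -
    have "(\<Sum>\<beta>\<in>F. (?S \<beta> - \<beta>) * norm (right_lim A \<beta>)) = (\<Sum>\<beta>\<in>F. 2 * x \<beta> + \<epsilon> * (?S \<beta> - \<beta>))"
      by (rule sum.cong) (auto simp: x_def field_simps)
    also have "\<dots> = 2 * sum x F + \<epsilon> * (\<Sum>\<beta>\<in>F. ?S \<beta> - \<beta>)"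
      by (simp add: sum.distrib sum_distrib_left)
    also have "\<dots> \<le> 2 * (2 + M * (b - a)) + \<epsilon> * (b - a)"
      using paired_partitions_bound[OF bound pp[OF F]] sum_osc_set_lengths[OF eps F] eps
      by (intro add_mono mult_left_mono) auto
    finally show ?thesis .
  qed
  then show ?thesis
    by (intro nonneg_bounded_partial_sums_imp_summable_on[where C="2 * (2 + M * (b - a)) + \<epsilon> * (b - a)"])
      (use below(3) in \<open>auto simp: eventually_finite_subsets_at_top less_imp_le intro!: exI[of _ "{}"] mult_nonneg_nonneg\<close>)
qed

subsection \<open>Product integrals of functions with controlled increments\<close>

lemma norm_exp_minus_one_minus_le:
  fixes x :: "'e::{real_normed_algebra_1, banach}"
  shows "norm (exp x - 1 - x) \<le> exp (norm x) - 1 - norm x"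
proof -
  let ?f = "\<lambda>n. inverse (fact (n + 2)) *\<^sub>R x ^ (n + 2)"
    and ?g = "\<lambda>n. inverse (fact (n + 2)) *\<^sub>R norm x ^ (n + 2)"
  have g: "summable ?g"
    using summable_exp_generic[of "norm x"] by (subst summable_iff_shift)
  have le: "norm (?f n) \<le> ?g n" for n
    using norm_power_ineq[of x "n + 2"] by (simp add: mult_left_mono del: fact_Suc power_Suc)
  have "norm (suminf ?f) \<le> suminf ?g"
    by (rule norm_suminf_le[OF le g])
  then show ?thesis
    using exp_first_two_terms[of x] exp_first_two_terms[of "norm x"] by (simp del: fact_Suc power_Suc)
qed

lemma norm_exp_minus_one_le:
  fixes x :: "'e::{real_normed_algebra_1, banach}"
  shows "norm (exp x - 1) \<le> exp (norm x) - 1"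
  using norm_exp_minus_one_minus_le[of x] norm_triangle_ineq[of "exp x - 1 - x" x] by simp

text \<open>Makes the remainder visibly quadratic, so that one factor w can be absorbed by the mesh
  while the other telescopes.\<close>

lemma exp_minus_one_minus_le:
  fixes w :: real
  assumes "0 \<le> w"
  shows "exp w - 1 - w \<le> w\<^sup>2 * exp w"
proof -
  have "1 - w \<le> exp (- w)" using exp_ge_add_one_self[of "- w"] by simp
  then have "(1 - w) * exp w \<le> exp (- w) * exp w" by (intro mult_right_mono) auto
  then have le: "exp w - 1 \<le> w * exp w" by (simp add: exp_minus algebra_simps)
  have "exp w - 1 - w \<le> w * (exp w - 1)" using le by (simp add: algebra_simps)
  also have "\<dots> \<le> w * (w * exp w)" using le assms by (intro mult_left_mono)
  finally show ?thesis by (simp add: power2_eq_square mult.assoc)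
qed

lemma tendsto_if_cauchy:
  fixes f :: "'i \<Rightarrow> 'a::complete_space"
  assumes "F \<noteq> bot"
    and "\<And>e. e > 0 \<Longrightarrow> \<exists>P. eventually P F \<and> (\<forall>x y. P x \<and> P y \<longrightarrow> dist (f x) (f y) < e)"
  shows "\<exists>L. (f \<longlongrightarrow> L) F"
proof -
  have "cauchy_filter (filtermap f F)"
    unfolding cauchy_filter_metric_filtermap using assms(2) by simp
  moreover have "complete (UNIV :: 'a set)"
    by (meson Cauchy_convergent UNIV_I complete_def convergent_def)
  ultimately show ?thesis
    using assms(1) complete_uniform[where S="UNIV :: 'a set"] by (force simp: filterlim_def filtermap_bot_iff)
qed

section \<open>Inverses and their limits\<close>

lemma is_inverse_unique: "is_inverse x y \<Longrightarrow> is_inverse x z \<Longrightarrow> y = z"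
  unfolding is_inverse_def by (metis mult.assoc mult_1_left mult_1_right)

lemma inv_elem_eqI: "is_inverse x y \<Longrightarrow> inv_elem x = y"
  unfolding inv_elem_def by (blast intro: the_equality is_inverse_unique)

lemma is_inverse_mult: "is_inverse x y \<Longrightarrow> is_inverse x' y' \<Longrightarrow> is_inverse (x * x') (y' * y)"
  unfolding is_inverse_def by (metis mult.assoc mult_1_left)

text \<open>The uniform bound on the inverses keeps the limit invertible: g i - g j = g i (f j - f
  i) g j shows that the inverses form a Cauchy net.\<close>

lemma is_inverse_tendsto:
  fixes f g :: "'i \<Rightarrow> 'e::{real_normed_algebra_1, banach}"
  assumes lim: "(f \<longlongrightarrow> l) F" and ne: "F \<noteq> bot"
    and inv: "\<forall>\<^sub>F i in F. is_inverse (f i) (g i) \<and> norm (g i) \<le> B"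
  shows "\<exists>m. is_inverse l m \<and> norm m \<le> B"
proof -
  have "\<exists>m. (g \<longlongrightarrow> m) F"
  proof (rule tendsto_if_cauchy[OF ne])
    fix e :: real assume e: "e > 0"
    \<comment> \<open>The added 1 keeps the denominator of \<open>d\<close> positive when B =
      0.\<close>
    define k where "k = B\<^sup>2 + 1"
    have k: "k > 0" "B\<^sup>2 < k" by (simp_all add: k_def add_nonneg_pos)
    define d where "d = e / (2 * k)"
    have d: "d > 0" using e k by (simp add: d_def)
    define P where "P i \<longleftrightarrow> is_inverse (f i) (g i) \<and> norm (g i) \<le> B \<and> dist (f i) l < d" for i
    have "eventually P F"
      unfolding P_def using inv tendstoD[OF lim d] by eventually_elim auto
    moreover have "dist (g i) (g j) < e" if P: "P i" "P j" for i j
    proof -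
      have B: "0 \<le> B" using P(1) norm_ge_zero[of "g i"] unfolding P_def by linarith
      have "g i - g j = g i * (f j - f i) * g j"
        using P unfolding P_def is_inverse_def
        by (simp add: algebra_simps)
      then have "norm (g i - g j) \<le> norm (g i) * norm (f j - f i) * norm (g j)"
        by (simp only:) (rule order_trans[OF norm_mult_ineq mult_right_mono[OF norm_mult_ineq norm_ge_zero]])
      also have "\<dots> \<le> B * (2 * d) * B"
      proof (intro mult_mono)
        show "norm (f j - f i) \<le> 2 * d"
          using P dist_triangle2[of "f j" "f i" l] by (simp add: P_def dist_norm)
      qed (use P d B in \<open>auto simp: P_def\<close>)
      also have "\<dots> = B\<^sup>2 * (2 * d)" by (simp add: power2_eq_square)
      also have "\<dots> < k * (2 * d)" using d k by simp
      also have "\<dots> = e" using k by (simp add: d_def)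
      finally show ?thesis by (simp add: dist_norm)
    qed
    ultimately show "\<exists>P. eventually P F \<and> (\<forall>x y. P x \<and> P y \<longrightarrow> dist (g x) (g y) < e)" by blast
  qed
  then obtain m where m: "(g \<longlongrightarrow> m) F" ..
  have fin: "\<forall>\<^sub>F i in F. f i * g i = 1" "\<forall>\<^sub>F i in F. g i * f i = 1" "\<forall>\<^sub>F i in F. norm (g i) \<le> B"
    by (rule eventually_mono[OF inv]; simp add: is_inverse_def)+
  have "l * m = 1"
    using tendsto_unique[OF ne tendsto_eventually[OF fin(1)] tendsto_mult[OF lim m]] by simp
  moreover have "m * l = 1"
    using tendsto_unique[OF ne tendsto_eventually[OF fin(2)] tendsto_mult[OF m lim]] by simp
  moreover have "norm m \<le> B"
    by (rule tendsto_upperbound[OF tendsto_norm[OF m] fin(3) ne])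
  ultimately show ?thesis unfolding is_inverse_def by blast
qed

section \<open>Ordered products over finite sets of division points\<close>

text \<open>The last division point is split off, so later factors stand on the left. Points of D
  outside (s,t) are ignored; thus one set D serves all intervals simultaneously, and infinite D fall
  back to a single factor.\<close>

function ordered_product :: "(real \<Rightarrow> 'e::{real_normed_algebra_1, banach}) \<Rightarrow> real set \<Rightarrow> real \<Rightarrow> real \<Rightarrow> 'e" where
  "ordered_product G D s t =
    (if finite D \<and> D \<inter> {s<..<t} \<noteq> {}
     then exp (G t - G (Max (D \<inter> {s<..<t}))) * ordered_product G D s (Max (D \<inter> {s<..<t}))
     else exp (G t - G s))"
  by auto
termination
proof (relation "Wellfounded.measure (\<lambda>(G, D, s, t). card (D \<inter> {s<..<t}))")
  fix D :: "real set" and s t :: real and G :: "real \<Rightarrow> 'e"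
  assume D: "finite D \<and> D \<inter> {s<..<t} \<noteq> {}"
  then have "Max (D \<inter> {s<..<t}) \<in> D \<inter> {s<..<t}" by (intro Max_in) auto
  then have "D \<inter> {s<..<Max (D \<inter> {s<..<t})} \<subset> D \<inter> {s<..<t}" by force
  then show "((G, D, s, Max (D \<inter> {s<..<t})), G, D, s, t) \<in> Wellfounded.measure (\<lambda>(G, D, s, t). card (D \<inter> {s<..<t}))"
    using D by (simp add: psubset_card_mono)
qed simp

declare ordered_product.simps [simp del]

lemma ordered_product_single: "D \<inter> {s<..<t} = {} \<Longrightarrow> ordered_product G D s t = exp (G t - G s)"
  by (subst ordered_product.simps) simp

lemma ordered_product_Max:
  assumes "finite D" "D \<inter> {s<..<t} \<noteq> {}"
  obtains u where "u \<in> D" "s < u" "u < t" "D \<inter> {u<..<t} = {}" "u = Max (D \<inter> {s<..<t})"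
    "ordered_product G D s t = exp (G t - G u) * ordered_product G D s u"
proof -
  define u where "u = Max (D \<inter> {s<..<t})"
  have u: "u \<in> D \<inter> {s<..<t}" unfolding u_def by (intro Max_in) (use assms in auto)
  have "x \<le> u" if "x \<in> D \<inter> {s<..<t}" for x unfolding u_def using that assms by (intro Max_ge) auto
  then have "D \<inter> {u<..<t} = {}" using u by fastforce
  then show thesis
    using u assms by (intro that[of u]) (auto simp: u_def ordered_product.simps[of G D s t])
qed

text \<open>Unless u is itself the last division point before t, the intervals from s and from u to
  t have the same last division point, and splitting it off reduces the claim to fewer
  points.\<close>

lemma ordered_product_split:
  assumes "finite D" "u \<in> D" "s \<le> u" "u \<le> t"
  shows "ordered_product G D s t = ordered_product G D u t * ordered_product G D s u"
  using assms
proof (induction "card (D \<inter> {s<..<t})" arbitrary: t rule: less_induct)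
  case less
  show ?case
  proof (cases "u = s \<or> u = t")
    case True
    then show ?thesis by (auto simp: ordered_product_single)
  next
    case False
    then have st: "s < u" "u < t" using less by auto
    then have ne: "D \<inter> {s<..<t} \<noteq> {}" using less by auto
    from less(2) ne obtain v where v: "v \<in> D" "s < v" "v < t" "D \<inter> {v<..<t} = {}"
      "v = Max (D \<inter> {s<..<t})"
      "ordered_product G D s t = exp (G t - G v) * ordered_product G D s v"
      by (rule ordered_product_Max)
    show ?thesis
    proof (cases "u = v")
      case True
      then show ?thesis using v by (simp add: ordered_product_single)
    next
      case False
      have "u \<le> v" unfolding v(5) using less st by (intro Max_ge) auto
      with False have uv: "u < v" by simp
      have "D \<inter> {s<..<v} \<subset> D \<inter> {s<..<t}" using v by force
      then have "ordered_product G D s v = ordered_product G D u v * ordered_product G D s u"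
        using less uv by (intro less(1)) (auto simp: psubset_card_mono)
      moreover have "ordered_product G D u t = exp (G t - G v) * ordered_product G D u v"
      proof -
        have "D \<inter> {u<..<t} \<noteq> {}" using v uv by auto
        with less(2) obtain w where w: "w \<in> D" "u < w" "w < t" "D \<inter> {w<..<t} = {}"
          "ordered_product G D u t = exp (G t - G w) * ordered_product G D u w"
          by (rule ordered_product_Max)
        have "w = v"
          using w(1-4) v(1-4) uv by (cases w v rule: linorder_cases) auto
        then show ?thesis using w by simp
      qed
      ultimately show ?thesis using v by (simp add: mult.assoc)
    qed
  qed
qed

text \<open>In the application \<open>G\<close> is an indefinite Bochner integral of
  \<open>A\<close> and \<open>V\<close> one of its norm. Only domination of increments and
  continuity of \<open>V\<close> enter the construction.\<close>

locale controlled_increments =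
  fixes a b :: real and G :: "real \<Rightarrow> 'e::{real_normed_algebra_1, banach}" and V :: "real \<Rightarrow> real"
  assumes le: "a \<le> b"
    and control: "a \<le> s \<Longrightarrow> s \<le> t \<Longrightarrow> t \<le> b \<Longrightarrow> norm (G t - G s) \<le> V t - V s"
    and continuous_V: "continuous_on {a..b} V"
begin

lemma V_mono: "a \<le> s \<Longrightarrow> s \<le> t \<Longrightarrow> t \<le> b \<Longrightarrow> V s \<le> V t"
  using control[of s t] norm_ge_zero[of "G t - G s"] by linarith

lemma exp_increment:
  assumes st: "a \<le> s" "s \<le> t" "t \<le> b"
  shows "norm (exp (G t - G s)) \<le> exp (V t - V s)"
    and "norm (exp (G t - G s) - 1) \<le> exp (V t - V s) - 1"
    and "norm (exp (G t - G s) - 1 - (G t - G s)) \<le> exp (V t - V s) - 1 - (V t - V s)"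
    and "is_inverse (exp (G t - G s)) (exp (G s - G t))"
    and "norm (exp (G s - G t)) \<le> exp (V t - V s)"
proof -
  note c = control[OF st]
  show "norm (exp (G t - G s)) \<le> exp (V t - V s)"
    using norm_exp[of "G t - G s"] c by (meson exp_le_cancel_iff order_trans)
  show "norm (exp (G t - G s) - 1) \<le> exp (V t - V s) - 1"
    using norm_exp_minus_one_le[of "G t - G s"] c by (smt (verit) exp_le_cancel_iff)
  show "norm (exp (G s - G t)) \<le> exp (V t - V s)"
    using norm_exp[of "G s - G t"] c by (metis exp_le_cancel_iff norm_minus_commute order_trans)
  show "is_inverse (exp (G t - G s)) (exp (G s - G t))"
    using exp_minus_inverse[of "G t - G s"] exp_minus_inverse[of "G s - G t"] by (simp add: is_inverse_def)
  \<comment> \<open>Monotonicity on the nonnegative reals permits replacing the norm of the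
    increment by the larger V t - V s.\<close>
  have "exp x - x \<le> exp y - y" if "0 \<le> x" "x \<le> y" for x y :: real
  proof -
    have "1 + (y - x) \<le> exp (y - x)" by (rule exp_ge_add_one_self)
    then have "exp x * (1 + (y - x)) \<le> exp x * exp (y - x)" by (intro mult_left_mono) auto
    moreover have "1 * (y - x) \<le> exp x * (y - x)" using that by (intro mult_right_mono) auto
    ultimately show ?thesis by (simp add: exp_diff algebra_simps)
  qed
  from this[OF norm_ge_zero c] show "norm (exp (G t - G s) - 1 - (G t - G s)) \<le> exp (V t - V s) - 1 - (V t - V s)"
    using norm_exp_minus_one_minus_le[of "G t - G s"] by simp
qed

text \<open>The bounds reproduce themselves when a factor is added: exp y (exp x - 1 - x) + (exp y -
  1) x + (exp y - 1 - y) = exp (y + x) - 1 - (y + x). They are therefore uniform in D and pass to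
  the limit.\<close>

lemma ordered_product_estimates:
  assumes "a \<le> s" "s \<le> t" "t \<le> b"
  shows "norm (ordered_product G D s t) \<le> exp (V t - V s) \<and>
    norm (ordered_product G D s t - 1 - (G t - G s)) \<le> exp (V t - V s) - 1 - (V t - V s) \<and>
    (\<exists>Q. is_inverse (ordered_product G D s t) Q \<and> norm Q \<le> exp (V t - V s))"
  using assms
proof (induction "card (D \<inter> {s<..<t})" arbitrary: t rule: less_induct)
  case less
  show ?case
  proof (cases "finite D \<and> D \<inter> {s<..<t} \<noteq> {}")
    case False
    then have "ordered_product G D s t = exp (G t - G s)"
      by (subst ordered_product.simps) (rule if_not_P)
    then show ?thesis using exp_increment[OF less(2-4)] by auto
  next
    case True
    then have fin: "finite D" and ne: "D \<inter> {s<..<t} \<noteq> {}" by auto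
    from fin ne obtain u where u: "u \<in> D" "s < u" "u < t"
      "ordered_product G D s t = exp (G t - G u) * ordered_product G D s u"
      by (rule ordered_product_Max)
    define X where "X = ordered_product G D s u"
    define E where "E = exp (G t - G u)"
    define x where "x = V u - V s"
    define y where "y = V t - V u"
    have xy: "V t - V s = y + x" by (simp add: x_def y_def)
    have "D \<inter> {s<..<u} \<subset> D \<inter> {s<..<t}" using u by force
    then have "card (D \<inter> {s<..<u}) < card (D \<inter> {s<..<t})"
      using fin by (intro psubset_card_mono) auto
    then have "norm X \<le> exp x \<and> norm (X - 1 - (G u - G s)) \<le> exp x - 1 - x \<and>
        (\<exists>Q. is_inverse X Q \<and> norm Q \<le> exp x)"
      unfolding X_def x_def by (rule less(1)) (use u less in auto)
    then obtain Q where X: "norm X \<le> exp x" "norm (X - 1 - (G u - G s)) \<le> exp x - 1 - x"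
      "is_inverse X Q" "norm Q \<le> exp x"
      by blast
    note E = exp_increment[of u t, folded E_def y_def]
    have ut: "a \<le> u" "u \<le> t" "t \<le> b" using u less by auto
    have y: "0 \<le> y" using V_mono[of u t] u less by (simp add: y_def)
    have Gx: "norm (G u - G s) \<le> x" using control[of s u] u less by (simp add: x_def)
    have "norm (E * X) \<le> norm E * norm X" by (rule norm_mult_ineq)
    also have "\<dots> \<le> exp y * exp x" using E ut X by (intro mult_mono) auto
    finally have 1: "norm (E * X) \<le> exp (y + x)" by (simp add: exp_add)
    have "E * X - 1 - (G t - G s) = E * (X - 1 - (G u - G s)) + (E - 1) * (G u - G s) + (E - 1 - (G t - G u))"
      by (simp add: algebra_simps)
    also have "norm \<dots> \<le> exp y * (exp x - 1 - x) + (exp y - 1) * x + (exp y - 1 - y)"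
      using E ut X Gx y
      by (intro order_trans[OF norm_triangle_ineq] add_mono order_trans[OF norm_mult_ineq] mult_mono) auto
    also have "\<dots> = exp (y + x) - 1 - (y + x)" by (simp add: exp_add algebra_simps)
    finally have 2: "norm (E * X - 1 - (G t - G s)) \<le> exp (y + x) - 1 - (y + x)" .
    have 3: "is_inverse (E * X) (Q * exp (G u - G t))"
      using E ut X by (intro is_inverse_mult)
    have "norm (Q * exp (G u - G t)) \<le> norm Q * norm (exp (G u - G t))" by (rule norm_mult_ineq)
    also have "\<dots> \<le> exp x * exp y" using E ut X by (intro mult_mono) auto
    finally have 4: "norm (Q * exp (G u - G t)) \<le> exp (y + x)" by (simp add: exp_add mult.commute)
    show ?thesis using 1 2 3 4 u(4) unfolding X_def[symmetric] E_def[symmetric] xy by auto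
  qed
qed

text \<open>On a cell of D0 with w = V v - V u, the product over D and the single exponential are
  both within exp w - 1 - w \<le> \<theta> w exp w of 1 + (G v - G u), whence the factor 2. Cells
  are combined through Y X - E X0 = (Y - E) X + E (X - X0).\<close>

lemma ordered_product_refine:
  assumes fin: "finite D" and sub: "D0 \<subseteq> D"
    and mesh: "\<And>u v. a \<le> u \<Longrightarrow> u \<le> v \<Longrightarrow> v \<le> b \<Longrightarrow> D0 \<inter> {u<..<v} = {} \<Longrightarrow> V v - V u \<le> \<theta>"
    and "a \<le> s" "s \<le> t" "t \<le> b"
  shows "norm (ordered_product G D s t - ordered_product G D0 s t) \<le>
    2 * \<theta> * (V t - V s) * exp (V t - V s)"
  using assms(4-6)
proof (induction "card (D0 \<inter> {s<..<t})" arbitrary: t rule: less_induct)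
  case less
  have fin0: "finite D0" using fin sub finite_subset by blast
  have single: "norm (ordered_product G D u v - exp (G v - G u)) \<le> 2 * \<theta> * (V v - V u) * exp (V v - V u)"
    if uv: "a \<le> u" "u \<le> v" "v \<le> b" "D0 \<inter> {u<..<v} = {}" for u v
  proof -
    define w where "w = V v - V u"
    have w: "0 \<le> w" "w \<le> \<theta>" using V_mono mesh uv by (auto simp: w_def)
    have "norm (ordered_product G D u v - exp (G v - G u)) \<le>
      norm (ordered_product G D u v - 1 - (G v - G u)) + norm (exp (G v - G u) - 1 - (G v - G u))"
      using norm_triangle_ineq4[of "ordered_product G D u v - 1 - (G v - G u)" "exp (G v - G u) - 1 - (G v - G u)"]
      by simp
    also have "\<dots> \<le> 2 * (exp w - 1 - w)"
      using ordered_product_estimates[of u v D] exp_increment(3)[of u v] uv by (simp add: w_def)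
    also have "\<dots> \<le> 2 * (w\<^sup>2 * exp w)" using exp_minus_one_minus_le[OF w(1)] by simp
    also have "w\<^sup>2 * exp w \<le> \<theta> * w * exp w"
      unfolding power2_eq_square using w by (intro mult_right_mono) auto
    finally show ?thesis by (simp add: w_def)
  qed
  show ?case
  proof (cases "D0 \<inter> {s<..<t} = {}")
    case True
    then show ?thesis using single[of s t] less by (simp add: ordered_product_single)
  next
    case False
    with fin0 obtain u where u: "u \<in> D0" "s < u" "u < t" "D0 \<inter> {u<..<t} = {}"
      "ordered_product G D0 s t = exp (G t - G u) * ordered_product G D0 s u"
      by (rule ordered_product_Max)
    define X where "X = ordered_product G D s u"
    define X0 where "X0 = ordered_product G D0 s u"
    define E where "E = exp (G t - G u)"
    define Y where "Y = ordered_product G D u t"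
    define x where "x = V u - V s"
    define y where "y = V t - V u"
    have xy: "V t - V s = y + x" by (simp add: x_def y_def)
    have x: "0 \<le> x" and y: "0 \<le> y" using V_mono u less by (auto simp: x_def y_def)
    \<comment> \<open>Obtained from the mesh condition on the degenerate interval from s to
      s.\<close>
    have \<theta>: "0 \<le> \<theta>" using mesh[of s s] less by auto
    have "D0 \<inter> {s<..<u} \<subset> D0 \<inter> {s<..<t}" using u by force
    then have "card (D0 \<inter> {s<..<u}) < card (D0 \<inter> {s<..<t})"
      using fin0 by (intro psubset_card_mono) auto
    then have IH: "norm (X - X0) \<le> 2 * \<theta> * x * exp x"
      unfolding X_def X0_def x_def using u less by (intro less(1)) auto
    have YE: "norm (Y - E) \<le> 2 * \<theta> * y * exp y"
      unfolding Y_def E_def y_def using u less by (intro single) auto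
    have X: "norm X \<le> exp x" unfolding X_def x_def using ordered_product_estimates[of s u D] u less by simp
    have E: "norm E \<le> exp y" unfolding E_def y_def using exp_increment(1)[of u t] u less by simp
    have "ordered_product G D s t = Y * X"
      unfolding X_def Y_def using u sub fin by (intro ordered_product_split) auto
    then have "ordered_product G D s t - ordered_product G D0 s t = (Y - E) * X + E * (X - X0)"
      using u(5) by (simp add: X0_def E_def algebra_simps)
    also have "norm \<dots> \<le> 2 * \<theta> * y * exp y * exp x + exp y * (2 * \<theta> * x * exp x)"
      using X E YE IH x y \<theta>
      by (intro order_trans[OF norm_triangle_ineq] add_mono order_trans[OF norm_mult_ineq] mult_mono) auto
    also have "\<dots> = 2 * \<theta> * (y + x) * exp (y + x)" by (simp add: exp_add algebra_simps)
    finally show ?thesis using xy by simp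
  qed
qed

text \<open>Continuity of \<open>V\<close> settles short intervals without any division point. When
  two intervals are glued, their common end r joins D0, so no interval free of division points
  crosses it.\<close>

lemma ex_fine_mesh:
  assumes \<theta>: "\<theta> > 0"
  obtains D0 where "finite D0"
    "\<And>u v. a \<le> u \<Longrightarrow> u \<le> v \<Longrightarrow> v \<le> b \<Longrightarrow> D0 \<inter> {u<..<v} = {} \<Longrightarrow> V v - V u \<le> \<theta>"
proof -
  define P where "P p q \<longleftrightarrow> (\<exists>D0. finite D0 \<and> (\<forall>u v. a \<le> u \<longrightarrow> p \<le> u \<longrightarrow> u \<le> v \<longrightarrow> v \<le> q \<longrightarrow> v \<le> b \<longrightarrow>
    D0 \<inter> {u<..<v} = {} \<longrightarrow> V v - V u \<le> \<theta>))" for p q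
  from le have "P a b"
  proof (induction rule: Bolzano)
    case (trans p r q)
    then obtain D1 D2 where "finite D1" "finite D2"
      and 1: "\<And>u v. a \<le> u \<Longrightarrow> p \<le> u \<Longrightarrow> u \<le> v \<Longrightarrow> v \<le> r \<Longrightarrow> v \<le> b \<Longrightarrow> D1 \<inter> {u<..<v} = {} \<Longrightarrow> V v - V u \<le> \<theta>"
      and 2: "\<And>u v. a \<le> u \<Longrightarrow> r \<le> u \<Longrightarrow> u \<le> v \<Longrightarrow> v \<le> q \<Longrightarrow> v \<le> b \<Longrightarrow> D2 \<inter> {u<..<v} = {} \<Longrightarrow> V v - V u \<le> \<theta>"
      unfolding P_def by metis
    show ?case
      unfolding P_def
    proof (intro exI[of _ "insert r (D1 \<union> D2)"] conjI allI impI)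
      fix u v assume *: "a \<le> u" "p \<le> u" "u \<le> v" "v \<le> q" "v \<le> b" and D: "insert r (D1 \<union> D2) \<inter> {u<..<v} = {}"
      then have "r \<le> u \<or> v \<le> r" by auto
      then show "V v - V u \<le> \<theta>" using 1[of u v] 2[of u v] * D by blast
    qed (use \<open>finite D1\<close> \<open>finite D2\<close> in auto)
  next
    case (local x)
    then obtain d where d: "d > 0" "\<And>y. y \<in> {a..b} \<Longrightarrow> dist y x < d \<Longrightarrow> dist (V y) (V x) < \<theta> / 2"
      using continuous_V \<theta> unfolding continuous_on_iff by (metis atLeastAtMost_iff half_gt_zero)
    have "P p q" if pq: "p \<le> x" "x \<le> q" "q - p < d" for p q
      unfolding P_def
    proof (intro exI[of _ "{}"] conjI allI impI)
      fix u v assume *: "a \<le> u" "p \<le> u" "u \<le> v" "v \<le> q" "v \<le> b"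
      have "dist (V u) (V x) < \<theta> / 2" "dist (V v) (V x) < \<theta> / 2"
        by (rule d(2); use * pq in \<open>auto simp: dist_real_def\<close>)+
      then show "V v - V u \<le> \<theta>" unfolding dist_real_def abs_less_iff by linarith
    qed simp
    then show ?case using d(1) by blast
  qed
  then show thesis unfolding P_def using that by metis
qed

text \<open>A single net, the finite subsets of the whole line, is used for all intervals, so that
  identities between products over adjacent intervals survive the limit.\<close>

definition product_integral :: "real \<Rightarrow> real \<Rightarrow> 'e" where
  "product_integral s t = Lim (finite_subsets_at_top UNIV) (\<lambda>D. ordered_product G D s t)"

lemma product_integral_tendsto:
  assumes st: "a \<le> s" "s \<le> t" "t \<le> b"
  shows "((\<lambda>D. ordered_product G D s t) \<longlongrightarrow> product_integral s t) (finite_subsets_at_top UNIV)"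
proof -
  have "\<exists>L. ((\<lambda>D. ordered_product G D s t) \<longlongrightarrow> L) (finite_subsets_at_top UNIV)"
  proof (rule tendsto_if_cauchy)
    fix e :: real assume e: "e > 0"
    define w where "w = (V t - V s) * exp (V t - V s)"
    have w: "w \<ge> 0" using V_mono[OF st] by (simp add: w_def)
    \<comment> \<open>Chosen so that the refinement bound 2 \<theta> w stays below e / 2; the added
      1 covers w = 0.\<close>
    define \<theta> where "\<theta> = e / (4 * (w + 1))"
    have \<theta>: "\<theta> > 0" using e w by (simp add: \<theta>_def)
    obtain D0 where D0: "finite D0"
      "\<And>u v. a \<le> u \<Longrightarrow> u \<le> v \<Longrightarrow> v \<le> b \<Longrightarrow> D0 \<inter> {u<..<v} = {} \<Longrightarrow> V v - V u \<le> \<theta>"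
      using ex_fine_mesh[OF \<theta>] by blast
    define P where "P D \<longleftrightarrow> finite D \<and> D0 \<subseteq> D" for D
    have near: "dist (ordered_product G D s t) (ordered_product G D0 s t) < e / 2" if "P D" for D
    proof -
      have "dist (ordered_product G D s t) (ordered_product G D0 s t) \<le> 2 * \<theta> * w"
        using ordered_product_refine[OF _ _ D0(2) st] that
        by (auto simp: P_def dist_norm w_def mult.assoc)
      also have "\<dots> < 2 * \<theta> * (w + 1)" using \<theta> by simp
      also have "\<dots> = e / 2" using w by (simp add: \<theta>_def field_simps)
      finally show ?thesis .
    qed
    have "eventually P (finite_subsets_at_top UNIV)"
      unfolding P_def eventually_finite_subsets_at_top using D0(1) by auto
    moreover have "\<forall>x y. P x \<and> P y \<longrightarrow> dist (ordered_product G x s t) (ordered_product G y s t) < e"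
      using near dist_triangle_half_l by blast
    ultimately show "\<exists>P. eventually P (finite_subsets_at_top UNIV) \<and>
      (\<forall>x y. P x \<and> P y \<longrightarrow> dist (ordered_product G x s t) (ordered_product G y s t) < e)" by blast
  qed simp
  then show ?thesis
    unfolding product_integral_def by (metis finite_subsets_at_top_neq_bot tendsto_Lim)
qed

text \<open>As soon as s belongs to D, the identity already holds for the ordered products.\<close>

lemma product_integral_mult:
  assumes "a \<le> r" "r \<le> s" "s \<le> t" "t \<le> b"
  shows "product_integral r t = product_integral s t * product_integral r s"
proof (rule tendsto_unique)
  show "((\<lambda>D. ordered_product G D r t) \<longlongrightarrow> product_integral r t) (finite_subsets_at_top UNIV)"
    using assms by (intro product_integral_tendsto) auto
  have "\<forall>\<^sub>F D in finite_subsets_at_top UNIV. ordered_product G D s t * ordered_product G D r s = ordered_product G D r t"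
    unfolding eventually_finite_subsets_at_top
    using assms by (intro exI[of _ "{s}"]) (auto intro!: ordered_product_split[symmetric])
  moreover have "((\<lambda>D. ordered_product G D s t * ordered_product G D r s) \<longlongrightarrow>
    product_integral s t * product_integral r s) (finite_subsets_at_top UNIV)"
    using assms by (intro tendsto_mult product_integral_tendsto) auto
  ultimately show "((\<lambda>D. ordered_product G D r t) \<longlongrightarrow> product_integral s t * product_integral r s) (finite_subsets_at_top UNIV)"
    by (rule Lim_transform_eventually[rotated])
qed simp

lemma product_integral_estimates:
  assumes st: "a \<le> s" "s \<le> t" "t \<le> b"
  shows "norm (product_integral s t) \<le> exp (V t - V s)"
    and "norm (product_integral s t - 1 - (G t - G s)) \<le> exp (V t - V s) - 1 - (V t - V s)"
    and "\<exists>Q. is_inverse (product_integral s t) Q \<and> norm Q \<le> exp (V t - V s)"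
proof -
  note lim = product_integral_tendsto[OF st] and est = ordered_product_estimates[OF st]
  show "norm (product_integral s t) \<le> exp (V t - V s)"
    using est by (intro tendsto_upperbound[OF tendsto_norm[OF lim]]) auto
  show "norm (product_integral s t - 1 - (G t - G s)) \<le> exp (V t - V s) - 1 - (V t - V s)"
    by (rule tendsto_upperbound[OF tendsto_norm[OF tendsto_diff[OF tendsto_diff[OF lim tendsto_const] tendsto_const]]])
      (use est in auto)
  obtain Q where "\<And>D. is_inverse (ordered_product G D s t) (Q D) \<and> norm (Q D) \<le> exp (V t - V s)"
    using est by metis
  then show "\<exists>Q. is_inverse (product_integral s t) Q \<and> norm Q \<le> exp (V t - V s)"
    by (intro is_inverse_tendsto[OF lim, where g=Q]) auto
qed

end

section \<open>Free tagged partitions and the choice of gauges\<close>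

lemma free_tagged_partition_mono:
  assumes "free_tagged_partition a b m t \<xi>" "i \<le> j" "j \<le> m"
  shows "t i \<le> t j"
  using assms(2,3)
proof (induction rule: dec_induct)
  case (step n)
  then have "t n < t (Suc n)"
    using assms(1) by (auto simp: free_tagged_partition_def dest!: bspec[of _ _ "Suc n"])
  then show ?case using step by simp
qed simp

lemma free_tagged_partition_range:
  assumes "free_tagged_partition a b m t \<xi>" "i \<in> {1..m}"
  shows "a \<le> t (i - 1)" "t (i - 1) < t i" "t i \<le> b" "\<xi> i \<in> {a..b}"
  using assms free_tagged_partition_mono[OF assms(1), of 0 "i - 1"]
    free_tagged_partition_mono[OF assms(1), of i m]
  by (auto simp: free_tagged_partition_def)

lemma free_tagged_partition_telescope:
  fixes f :: "real \<Rightarrow> real"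
  assumes "free_tagged_partition a b m t \<xi>"
  shows "(\<Sum>i=1..m. f (t i) - f (t (i - 1))) = f b - f a"
proof -
  have "(\<Sum>i=1..m. f (t i) - f (t (i - 1))) = f (t m) - f (t 0)"
    by (induction m) auto
  then show ?thesis using assms by (simp add: free_tagged_partition_def)
qed

text \<open>Truncating the argument of \<open>H\<close> makes the sum telescope without losing the cells in \<open>I\<close>.\<close>

lemma sum_increments_le:
  fixes H :: "real \<Rightarrow> real"
  assumes part: "free_tagged_partition a b m t \<xi>" and mono: "mono_on {p..q} H" and "p \<le> q"
    and I: "I \<subseteq> {1..m}" "\<And>i. i \<in> I \<Longrightarrow> p \<le> t (i - 1) \<and> t i \<le> q"
  shows "(\<Sum>i\<in>I. H (t i) - H (t (i - 1))) \<le> H q - H p"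
proof -
  define K where "K x = H (max p (min q x))" for x
  have K_mono: "K x \<le> K y" if "x \<le> y" for x y
    unfolding K_def using \<open>p \<le> q\<close> that by (intro mono_onD[OF mono]) auto
  have "(\<Sum>i\<in>I. H (t i) - H (t (i - 1))) = (\<Sum>i\<in>I. K (t i) - K (t (i - 1)))"
  proof (rule sum.cong)
    fix i assume i: "i \<in> I"
    then have "p \<le> t (i - 1)" "t (i - 1) < t i" "t i \<le> q"
      using I free_tagged_partition_range[OF part, of i] by auto
    then show "H (t i) - H (t (i - 1)) = K (t i) - K (t (i - 1))"
      by (simp add: K_def max_def min_def)
  qed simp
  also have "\<dots> \<le> (\<Sum>i=1..m. K (t i) - K (t (i - 1)))"
    using I free_tagged_partition_range(2)[OF part]
    by (intro sum_mono2) (force intro!: K_mono)+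
  also have "\<dots> = K b - K a" by (rule free_tagged_partition_telescope[OF part])
  also have "\<dots> \<le> H q - H p"
    using \<open>p \<le> q\<close> unfolding K_def by (intro diff_mono mono_onD[OF mono]) auto
  finally show ?thesis .
qed

lemma sum_half_power_le:
  assumes "finite K" "inj_on f K"
  shows "(\<Sum>x\<in>K. (1 / 2) ^ f x) \<le> (2 :: real)"
proof -
  have "(\<Sum>x\<in>K. (1 / 2) ^ f x) = (\<Sum>n\<in>f ` K. (1 / 2 :: real) ^ n)"
    using assms by (simp add: sum.reindex)
  also have "\<dots> \<le> (\<Sum>n. (1 / 2) ^ n)"
    using assms by (intro sum_le_suminf summable_geometric) auto
  also have "\<dots> = 2" by (subst suminf_geometric) auto
  finally show ?thesis .
qed

context controlled_increments begin

text \<open>Used with M = norm (A c) at an exceptional tag c. Halving the radius admits p and q on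
  the boundary, as needed for clipped end points.\<close>

lemma small_increment:
  assumes c: "c \<in> {a..b}" and "\<eta> > 0"
  shows "\<exists>d>0. \<forall>p q. p \<in> {a..b} \<longrightarrow> q \<in> {a..b} \<longrightarrow> \<bar>p - c\<bar> \<le> d \<longrightarrow> \<bar>q - c\<bar> \<le> d \<longrightarrow>
    (V q + M * q) - (V p + M * p) < \<eta>"
proof -
  have "continuous_on {a..b} (\<lambda>x. V x + M * x)"
    by (intro continuous_intros continuous_V)
  then obtain d where d: "d > 0" "\<And>y. y \<in> {a..b} \<Longrightarrow> dist y c < d \<Longrightarrow> dist (V y + M * y) (V c + M * c) < \<eta> / 2"
    using c \<open>\<eta> > 0\<close> unfolding continuous_on_iff by (metis half_gt_zero)
  have "(V q + M * q) - (V p + M * p) < \<eta>"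
    if "p \<in> {a..b}" "q \<in> {a..b}" "\<bar>p - c\<bar> \<le> d / 2" "\<bar>q - c\<bar> \<le> d / 2" for p q
  proof -
    have "dist (V p + M * p) (V c + M * c) < \<eta> / 2" "dist (V q + M * q) (V c + M * c) < \<eta> / 2"
      by (rule d(2); use that d(1) in \<open>simp add: dist_real_def\<close>)+
    then show ?thesis unfolding dist_real_def abs_less_iff by linarith
  qed
  then show ?thesis using d(1) by (intro exI[of _ "d / 2"]) auto
qed

text \<open>For a tag c in \<open>C\<close>, the error on each cell is at most the increment of V x
  + norm (A c) x. This function is monotone, so all cells tagged by c together cost no more than its
  increment over the small neighbourhood to which the gauge confines them, regardless of their
  number. The remaining tags cost e times the length.\<close>

lemma ex_gauge_increments:
  assumes C: "countable C" and \<eta>: "\<eta> > 0"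
    and local: "\<And>\<xi> e. \<xi> \<in> {a..b} - C \<Longrightarrow> e > 0 \<Longrightarrow> \<exists>d>0. \<forall>s t. a \<le> s \<longrightarrow> s \<le> t \<longrightarrow> t \<le> b \<longrightarrow>
      {s..t} \<subseteq> {\<xi> - d<..<\<xi> + d} \<longrightarrow> norm ((t - s) *\<^sub>R A \<xi> - (G t - G s)) \<le> e * (t - s)"
  shows "\<exists>\<delta>. (\<forall>t\<in>{a..b}. \<delta> t > 0) \<and> (\<forall>m t \<xi>. free_tagged_partition a b m t \<xi> \<longrightarrow>
    (\<forall>i\<in>{1..m}. {t (i - 1)..t i} \<subseteq> {\<xi> i - \<delta> (\<xi> i)<..<\<xi> i + \<delta> (\<xi> i)}) \<longrightarrow>
    (\<Sum>i=1..m. norm ((t i - t (i - 1)) *\<^sub>R A (\<xi> i) - (G (t i) - G (t (i - 1))))) \<le> \<eta>)"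
proof -
  define k where "k = b - a + 1"
  have k: "k > 0" "b - a \<le> k" using le by (auto simp: k_def)
  define e where "e = \<eta> / (2 * k)"
  have e: "e > 0" using \<eta> k by (simp add: e_def)
  \<comment> \<open>The budgets follow an enumeration of \<open>C\<close> and add up to at most
    \<eta> / 2; the other half is left for the regular tags.\<close>
  define h where "h c = \<eta> / 4 * (1 / 2) ^ to_nat_on C c" for c
  have h: "h c > 0" for c using \<eta> by (simp add: h_def)
  define H where "H c x = V x + norm (A c) * x" for c x
  obtain d1 where d1: "\<And>c. c \<in> {a..b} \<Longrightarrow> d1 c > 0"
    "\<And>c p q. c \<in> {a..b} \<Longrightarrow> p \<in> {a..b} \<Longrightarrow> q \<in> {a..b} \<Longrightarrow> \<bar>p - c\<bar> \<le> d1 c \<Longrightarrow> \<bar>q - c\<bar> \<le> d1 c \<Longrightarrow> H c q - H c p < h c"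
    using small_increment[OF _ h, of c "norm (A c)" c for c] unfolding H_def[symmetric] by metis
  obtain d2 where d2: "\<And>\<xi>. \<xi> \<in> {a..b} - C \<Longrightarrow> d2 \<xi> > 0"
    "\<And>\<xi> s t. \<xi> \<in> {a..b} - C \<Longrightarrow> a \<le> s \<Longrightarrow> s \<le> t \<Longrightarrow> t \<le> b \<Longrightarrow> {s..t} \<subseteq> {\<xi> - d2 \<xi><..<\<xi> + d2 \<xi>} \<Longrightarrow>
      norm ((t - s) *\<^sub>R A \<xi> - (G t - G s)) \<le> e * (t - s)"
    using local[OF _ e] by metis
  define \<delta> where "\<delta> \<xi> = (if \<xi> \<in> C then d1 \<xi> else d2 \<xi>)" for \<xi>
  have bound: "(\<Sum>i=1..m. norm ((t i - t (i - 1)) *\<^sub>R A (\<xi> i) - (G (t i) - G (t (i - 1))))) \<le> \<eta>"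
    if part: "free_tagged_partition a b m t \<xi>"
      and fine: "\<forall>i\<in>{1..m}. {t (i - 1)..t i} \<subseteq> {\<xi> i - \<delta> (\<xi> i)<..<\<xi> i + \<delta> (\<xi> i)}" for m t \<xi>
  proof -
    define r where "r i = norm ((t i - t (i - 1)) *\<^sub>R A (\<xi> i) - (G (t i) - G (t (i - 1))))" for i
    define I where "I = {i\<in>{1..m}. \<xi> i \<in> C}"
    note range = free_tagged_partition_range[OF part]
    have "sum r ({1..m} - I) \<le> (\<Sum>i\<in>{1..m} - I. e * (t i - t (i - 1)))"
    proof (rule sum_mono)
      fix i assume i: "i \<in> {1..m} - I"
      then have i': "\<xi> i \<notin> C" "i \<in> {1..m}" by (auto simp: I_def)
      have "{t (i - 1)..t i} \<subseteq> {\<xi> i - d2 (\<xi> i)<..<\<xi> i + d2 (\<xi> i)}"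
        using bspec[OF fine i'(2)] i'(1) by (simp add: \<delta>_def)
      with i' show "r i \<le> e * (t i - t (i - 1))"
        unfolding r_def using range[of i] by (intro d2(2)) auto
    qed
    also have "\<dots> \<le> (\<Sum>i=1..m. e * (t i - t (i - 1)))"
      using range(2) e by (intro sum_mono2) (auto simp: less_imp_le I_def)
    also have "\<dots> = e * (b - a)"
      using free_tagged_partition_telescope[OF part, of "\<lambda>x. x"] by (simp add: sum_distrib_left[symmetric])
    also have "\<dots> \<le> e * k" using e k by simp
    also have "\<dots> = \<eta> / 2" using k by (simp add: e_def)
    finally have 1: "sum r ({1..m} - I) \<le> \<eta> / 2" .
    have single: "(\<Sum>i\<in>{i\<in>I. \<xi> i = c}. r i) \<le> h c" if c: "c \<in> \<xi> ` I" for c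
    proof -
      have cC: "c \<in> C" "c \<in> {a..b}" using c range(4) by (auto simp: I_def)
      define p where "p = max a (c - d1 c)"
      define q where "q = min b (c + d1 c)"
      have pq: "p \<in> {a..b}" "q \<in> {a..b}" "\<bar>p - c\<bar> \<le> d1 c" "\<bar>q - c\<bar> \<le> d1 c" "p \<le> q"
        using cC d1(1)[of c] by (auto simp: p_def q_def)
      have mono: "mono_on {p..q} (H c)"
        unfolding H_def using pq by (intro mono_onI add_mono V_mono mult_left_mono) auto
      have "(\<Sum>i\<in>{i\<in>I. \<xi> i = c}. r i) \<le> (\<Sum>i\<in>{i\<in>I. \<xi> i = c}. H c (t i) - H c (t (i - 1)))"
      proof (rule sum_mono)
        fix i assume "i \<in> {i\<in>I. \<xi> i = c}"
        then have i: "i \<in> {1..m}" "\<xi> i = c" by (auto simp: I_def)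
        have "r i \<le> norm ((t i - t (i - 1)) *\<^sub>R A (\<xi> i)) + norm (G (t i) - G (t (i - 1)))"
          unfolding r_def by (rule norm_triangle_ineq4)
        also have "\<dots> \<le> (t i - t (i - 1)) * norm (A c) + (V (t i) - V (t (i - 1)))"
          using range[OF i(1)] i(2) by (intro add_mono control) auto
        also have "\<dots> = H c (t i) - H c (t (i - 1))"
          by (simp add: H_def algebra_simps)
        finally show "r i \<le> H c (t i) - H c (t (i - 1))" .
      qed
      also have "\<dots> \<le> H c q - H c p"
      proof (rule sum_increments_le[OF part mono pq(5)])
        fix i assume "i \<in> {i\<in>I. \<xi> i = c}"
        then have i: "i \<in> {1..m}" "\<xi> i = c" by (auto simp: I_def)
        have "{t (i - 1)..t i} \<subseteq> {c - d1 c<..<c + d1 c}"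
          using bspec[OF fine i(1)] i(2) cC by (simp add: \<delta>_def)
        from subsetD[OF this, of "t (i - 1)"] subsetD[OF this, of "t i"]
        show "p \<le> t (i - 1) \<and> t i \<le> q"
          using range[OF i(1)] by (auto simp: p_def q_def)
      qed (auto simp: I_def)
      also have "\<dots> \<le> h c" using d1(2)[OF cC(2) pq(1-4)] by simp
      finally show ?thesis .
    qed
    have finI: "finite I" by (simp add: I_def)
    have "sum r I = (\<Sum>c\<in>\<xi> ` I. \<Sum>i\<in>{i\<in>I. \<xi> i = c}. r i)"
      using finI by (rule sum.image_gen)
    also have "\<dots> \<le> (\<Sum>c\<in>\<xi> ` I. h c)"
      by (rule sum_mono) (rule single)
    also have "\<dots> = \<eta> / 4 * (\<Sum>c\<in>\<xi> ` I. (1 / 2) ^ to_nat_on C c)"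
      by (simp add: h_def sum_distrib_left)
    also have "\<dots> \<le> \<eta> / 4 * 2"
    proof (intro mult_left_mono sum_half_power_le)
      show "inj_on (to_nat_on C) (\<xi> ` I)"
        by (rule inj_on_subset[OF inj_on_to_nat_on[OF C]]) (auto simp: I_def)
    qed (use finI \<eta> in auto)
    finally have 2: "sum r I \<le> \<eta> / 2" by simp
    have "sum r {1..m} = sum r ({1..m} - I) + sum r I"
      by (rule sum.subset_diff) (auto simp: I_def)
    then show ?thesis using 1 2 by (simp add: r_def)
  qed
  have "\<forall>t\<in>{a..b}. \<delta> t > 0" using d1(1) d2(1) by (auto simp: \<delta>_def)
  then show ?thesis using bound by blast
qed

text \<open>Uniform continuity makes every increment w of \<open>V\<close> at most \<kappa>, so exp
  w - 1 - w \<le> \<kappa> w exp v with v the total increment, and the remaining factor w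
  telescopes.\<close>

lemma ex_gauge_sum_squares:
  assumes \<eta>: "\<eta> > 0"
  shows "\<exists>d>0. \<forall>m t \<xi>. free_tagged_partition a b m t \<xi> \<longrightarrow> (\<forall>i\<in>{1..m}. t i - t (i - 1) < d) \<longrightarrow>
    (\<Sum>i=1..m. exp (V (t i) - V (t (i - 1))) - 1 - (V (t i) - V (t (i - 1)))) \<le> \<eta>"
proof -
  define v where "v = V b - V a"
  have v: "v \<ge> 0" using V_mono[of a b] le by (simp add: v_def)
  define k where "k = v * exp v + 1"
  have k: "k > 0" "v * exp v \<le> k" using v by (auto simp: k_def add_nonneg_pos)
  define \<kappa> where "\<kappa> = \<eta> / k"
  have \<kappa>: "\<kappa> > 0" using \<eta> k by (simp add: \<kappa>_def)
  have "uniformly_continuous_on {a..b} V"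
    by (rule compact_uniformly_continuous[OF continuous_V]) auto
  then obtain d where d: "d > 0" "\<And>x y. x \<in> {a..b} \<Longrightarrow> y \<in> {a..b} \<Longrightarrow> dist y x < d \<Longrightarrow> dist (V y) (V x) < \<kappa>"
    using \<kappa> unfolding uniformly_continuous_on_def by metis
  have "(\<Sum>i=1..m. exp (V (t i) - V (t (i - 1))) - 1 - (V (t i) - V (t (i - 1)))) \<le> \<eta>"
    if part: "free_tagged_partition a b m t \<xi>" and fine: "\<forall>i\<in>{1..m}. t i - t (i - 1) < d" for m t \<xi>
  proof -
    note range = free_tagged_partition_range[OF part]
    have "(\<Sum>i=1..m. exp (V (t i) - V (t (i - 1))) - 1 - (V (t i) - V (t (i - 1)))) \<le>
      (\<Sum>i=1..m. \<kappa> * exp v * (V (t i) - V (t (i - 1))))"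
    proof (rule sum_mono)
      fix i assume i: "i \<in> {1..m}"
      define w where "w = V (t i) - V (t (i - 1))"
      have w: "0 \<le> w" "w \<le> v"
        unfolding w_def v_def using range[OF i] V_mono[of "t (i - 1)" "t i"] V_mono[of a "t (i - 1)"] V_mono[of "t i" b]
        by auto
      have "dist (V (t i)) (V (t (i - 1))) < \<kappa>"
        using range[OF i] fine i by (intro d(2)) (auto simp: dist_real_def)
      then have "w \<le> \<kappa>" by (simp add: w_def dist_real_def)
      have "exp w - 1 - w \<le> w * w * exp w" using exp_minus_one_minus_le[OF w(1)] by (simp add: power2_eq_square)
      also have "\<dots> \<le> \<kappa> * w * exp v"
        using w \<open>w \<le> \<kappa>\<close> \<kappa> by (intro mult_mono mult_right_mono) auto
      finally show "exp (V (t i) - V (t (i - 1))) - 1 - (V (t i) - V (t (i - 1))) \<le> \<kappa> * exp v * (V (t i) - V (t (i - 1)))"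
        by (simp add: w_def mult_ac)
    qed
    also have "\<dots> = \<kappa> * (v * exp v)"
      using free_tagged_partition_telescope[OF part, of V] by (simp add: v_def sum_distrib_left[symmetric])
    also have "\<dots> \<le> \<kappa> * k" using k \<kappa> by simp
    also have "\<dots> = \<eta>" using k by (simp add: \<kappa>_def)
    finally show ?thesis .
  qed
  then show ?thesis using d(1) by blast
qed

text \<open>With \<open>W\<close> the product integral from a, W(u) W(s)^{-1} is the product
  integral P from s to u. The error splits into (u - s) A(\<xi>) - (G u - G s) and P - 1 - (G u - G
  s); the first depends on the tags, the second only on the mesh.\<close>

lemma strongly_McShane_product_integrableI:
  assumes C: "countable C"
    and local: "\<And>\<xi> e. \<xi> \<in> {a..b} - C \<Longrightarrow> e > 0 \<Longrightarrow> \<exists>d>0. \<forall>s t. a \<le> s \<longrightarrow> s \<le> t \<longrightarrow> t \<le> b \<longrightarrow>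
      {s..t} \<subseteq> {\<xi> - d<..<\<xi> + d} \<longrightarrow> norm ((t - s) *\<^sub>R A \<xi> - (G t - G s)) \<le> e * (t - s)"
  shows "strongly_McShane_product_integrable a b A"
proof -
  define W where "W = product_integral a"
  define B where "B = exp (V b - V a)"
  have B: "exp (V t - V a) \<le> B" if "t \<in> {a..b}" for t
    using V_mono[of t b] that by (simp add: B_def)
  obtain Q where Q: "\<And>t. t \<in> {a..b} \<Longrightarrow> is_inverse (W t) (Q t) \<and> norm (Q t) \<le> exp (V t - V a)"
    using product_integral_estimates(3)[of a] unfolding W_def by (metis atLeastAtMost_iff order_refl)
  have inv: "inv_elem (W t) = Q t" if "t \<in> {a..b}" for t
    using Q[OF that] by (intro inv_elem_eqI) auto
  have "\<forall>t\<in>{a..b}. invertible_elem (W t)"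
    using Q unfolding invertible_elem_def by blast
  moreover have "bounded (W ` {a..b})"
  proof (rule boundedI[of _ B])
    fix x assume "x \<in> W ` {a..b}"
    then obtain t where "t \<in> {a..b}" "x = product_integral a t" unfolding W_def by auto
    then show "norm x \<le> B" using product_integral_estimates(1)[of a t] B[of t] by simp
  qed
  moreover have "bounded ((\<lambda>t. inv_elem (W t)) ` {a..b})"
  proof (rule boundedI[of _ B])
    fix x assume "x \<in> (\<lambda>t. inv_elem (W t)) ` {a..b}"
    then obtain t where "t \<in> {a..b}" "x = Q t" using inv by auto
    then show "norm x \<le> B" using Q[of t] B[of t] by simp
  qed
  moreover have "\<exists>\<delta>. (\<forall>t\<in>{a..b}. \<delta> t > 0) \<and>
      (\<forall>m t \<xi>. free_tagged_partition a b m t \<xi> \<and> fine_partition \<delta> m t \<xi> \<longrightarrow>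
        (\<Sum>i=1..m. norm (1 + (t i - t (i - 1)) *\<^sub>R A (\<xi> i) - W (t i) * inv_elem (W (t (i - 1))))) < \<eta>)"
    if \<eta>: "\<eta> > 0" for \<eta>
  proof -
    have \<eta>3: "\<eta> / 3 > 0" using \<eta> by simp
    obtain \<delta>1 where \<delta>1: "\<forall>t\<in>{a..b}. \<delta>1 t > 0"
      "\<And>m t \<xi>. free_tagged_partition a b m t \<xi> \<Longrightarrow>
        \<forall>i\<in>{1..m}. {t (i - 1)..t i} \<subseteq> {\<xi> i - \<delta>1 (\<xi> i)<..<\<xi> i + \<delta>1 (\<xi> i)} \<Longrightarrow>
        (\<Sum>i=1..m. norm ((t i - t (i - 1)) *\<^sub>R A (\<xi> i) - (G (t i) - G (t (i - 1))))) \<le> \<eta> / 3"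
      using ex_gauge_increments[OF C \<eta>3, of A] local by blast
    obtain d where d: "d > 0" "\<And>m t \<xi>. free_tagged_partition a b m t \<xi> \<Longrightarrow> \<forall>i\<in>{1..m}. t i - t (i - 1) < d \<Longrightarrow>
        (\<Sum>i=1..m. exp (V (t i) - V (t (i - 1))) - 1 - (V (t i) - V (t (i - 1)))) \<le> \<eta> / 3"
      using ex_gauge_sum_squares[OF \<eta>3] by blast
    \<comment> \<open>A cell within distance less than d / 2 of its tag is shorter than d, even if
      the tag lies outside the cell.\<close>
    define \<delta> where "\<delta> x = min (\<delta>1 x) (d / 2)" for x
    have "(\<Sum>i=1..m. norm (1 + (t i - t (i - 1)) *\<^sub>R A (\<xi> i) - W (t i) * inv_elem (W (t (i - 1))))) < \<eta>"
      if part: "free_tagged_partition a b m t \<xi>" and fine: "fine_partition \<delta> m t \<xi>" for m t \<xi>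
    proof -
      note range = free_tagged_partition_range[OF part]
      have fine': "{t (i - 1)..t i} \<subseteq> {\<xi> i - \<delta> (\<xi> i)<..<\<xi> i + \<delta> (\<xi> i)}" if "i \<in> {1..m}" for i
        using fine that by (auto simp: fine_partition_def)
      have 1: "(\<Sum>i=1..m. norm ((t i - t (i - 1)) *\<^sub>R A (\<xi> i) - (G (t i) - G (t (i - 1))))) \<le> \<eta> / 3"
      proof (rule \<delta>1(2)[OF part], rule ballI)
        fix i assume "i \<in> {1..m}"
        then show "{t (i - 1)..t i} \<subseteq> {\<xi> i - \<delta>1 (\<xi> i)<..<\<xi> i + \<delta>1 (\<xi> i)}"
          by (rule order_trans[OF fine']) (auto simp: \<delta>_def)
      qed
      have 2: "(\<Sum>i=1..m. exp (V (t i) - V (t (i - 1))) - 1 - (V (t i) - V (t (i - 1)))) \<le> \<eta> / 3"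
      proof (rule d(2)[OF part], rule ballI)
        fix i assume i: "i \<in> {1..m}"
        have "t (i - 1) \<in> {\<xi> i - \<delta> (\<xi> i)<..<\<xi> i + \<delta> (\<xi> i)}" "t i \<in> {\<xi> i - \<delta> (\<xi> i)<..<\<xi> i + \<delta> (\<xi> i)}"
          using subsetD[OF fine'[OF i], of "t (i - 1)"] subsetD[OF fine'[OF i], of "t i"] range[OF i] by auto
        then show "t i - t (i - 1) < d" by (auto simp: \<delta>_def)
      qed
      have "(\<Sum>i=1..m. norm (1 + (t i - t (i - 1)) *\<^sub>R A (\<xi> i) - W (t i) * inv_elem (W (t (i - 1))))) \<le>
        (\<Sum>i=1..m. norm ((t i - t (i - 1)) *\<^sub>R A (\<xi> i) - (G (t i) - G (t (i - 1)))) +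
          (exp (V (t i) - V (t (i - 1))) - 1 - (V (t i) - V (t (i - 1)))))"
      proof (rule sum_mono)
        fix i assume i: "i \<in> {1..m}"
        define s u where "s = t (i - 1)" and "u = t i"
        have su: "a \<le> s" "s \<le> u" "u \<le> b" using range[OF i] by (auto simp: s_def u_def)
        have "W u * inv_elem (W s) = product_integral s u * (W s * Q s)"
          using su inv[of s] product_integral_mult[of a s u] by (simp add: W_def mult.assoc)
        also have "W s * Q s = 1" using Q[of s] su by (simp add: is_inverse_def)
        finally have "1 + (u - s) *\<^sub>R A (\<xi> i) - W u * inv_elem (W s) =
          ((u - s) *\<^sub>R A (\<xi> i) - (G u - G s)) - (product_integral s u - 1 - (G u - G s))"
          by simp
        also have "norm \<dots> \<le> norm ((u - s) *\<^sub>R A (\<xi> i) - (G u - G s)) + (exp (V u - V s) - 1 - (V u - V s))"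
          using product_integral_estimates(2)[OF su] by (rule order_trans[OF norm_triangle_ineq4 add_left_mono])
        finally show "norm (1 + (t i - t (i - 1)) *\<^sub>R A (\<xi> i) - W (t i) * inv_elem (W (t (i - 1)))) \<le>
          norm ((t i - t (i - 1)) *\<^sub>R A (\<xi> i) - (G (t i) - G (t (i - 1)))) +
          (exp (V (t i) - V (t (i - 1))) - 1 - (V (t i) - V (t (i - 1))))"
          by (simp add: s_def u_def)
      qed
      also have "\<dots> \<le> \<eta> / 3 + \<eta> / 3"
        unfolding sum.distrib by (intro add_mono 1 2)
      also have "\<dots> < \<eta>" using \<eta> by simp
      finally show ?thesis .
    qed
    moreover have "\<forall>t\<in>{a..b}. \<delta> t > 0" using \<delta>1(1) d(1) by (simp add: \<delta>_def)
    ultimately show ?thesis by blast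
  qed
  ultimately show ?thesis
    unfolding strongly_McShane_product_integrable_def by blast
qed

end

subsection \<open>Bochner integrability without separability\<close>

lemma AE_lebesgue_on_notin_countable:
  fixes C :: "real set"
  assumes "countable C" shows "AE x in lebesgue_on {a..b}. x \<notin> C"
proof -
  have "C \<in> null_sets lebesgue"
    by (rule null_sets_completionI[OF countable_imp_null_set_lborel[OF assms]])
  then have "AE x in lebesgue. x \<notin> C" by (rule AE_not_in)
  then show ?thesis by (subst AE_restrict_space_iff) auto
qed

text \<open>Finitely many values of \<open>g\<close> reduce the claim to constants, so measurability
  of the vector-valued \<open>f\<close> itself is not involved.\<close>

lemma simple_function_norm_diff_measurable:
  assumes g: "simple_function M g" and meas: "\<And>c. (\<lambda>x. norm (f x - c)) \<in> borel_measurable M"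
  shows "(\<lambda>x. norm (f x - g x)) \<in> borel_measurable M"
proof (rule measurable_compose_countable'[OF meas])
  have "finite (g ` space M)" using g by (simp add: simple_function_def)
  then show "g \<in> measurable M (count_space (g ` space M))"
    using g by (subst measurable_count_space_eq2) (auto simp: simple_function_def)
  show "countable (g ` space M)" using \<open>finite _\<close> by (rule countable_finite)
qed

lemma simple_bochner_integral_norm_le_nn_integral:
  assumes "Bochner_Integration.simple_bochner_integrable M f"
  shows "ennreal (norm (Bochner_Integration.simple_bochner_integral M f)) \<le> (\<integral>\<^sup>+x. norm (f x) \<partial>M)"
proof -
  have "ennreal (norm (Bochner_Integration.simple_bochner_integral M f)) \<le>
    ennreal (Bochner_Integration.simple_bochner_integral M (\<lambda>x. norm (f x)))"
    by (intro ennreal_leI simple_bochner_integral_norm_bound assms)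
  also have "\<dots> = (\<integral>\<^sup>+x. norm (f x) \<partial>M)"
    using simple_bochner_integrable_compose2[of "\<lambda>x _. norm x" M f f] assms
    by (intro simple_bochner_integral_eq_nn_integral) auto
  finally show ?thesis .
qed

lemma simple_bochner_integrable_lebesgue_on:
  fixes a b :: real
  assumes "simple_function (lebesgue_on {a..b}) f"
  shows "Bochner_Integration.simple_bochner_integrable (lebesgue_on {a..b}) f"
proof
  have "finite_measure (lebesgue_on {a..b})" by (rule finite_measure_lebesgue_on) simp
  then show "emeasure (lebesgue_on {a..b}) {x \<in> space (lebesgue_on {a..b}). f x \<noteq> 0} \<noteq> \<infinity>"
    using finite_measure.emeasure_finite by auto
qed (rule assms)

lemma simple_function_indicator_lebesgue_on:
  assumes "A \<in> sets lebesgue"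
  shows "simple_function (lebesgue_on S) (indicator A :: _ \<Rightarrow> real)"
proof (rule simple_function_borel_measurable)
  show "indicator A \<in> borel_measurable (lebesgue_on S)"
    by (intro measurable_restrict_space1 borel_measurable_indicator assms)
  show "finite ((indicator A :: _ \<Rightarrow> real) ` space (lebesgue_on S))"
    by (rule finite_subset[of _ "{0, 1}"]) (auto simp: indicator_def)
qed

lemma simple_bochner_integral_indicator:
  assumes A: "A \<in> sets M" "emeasure M A < \<infinity>"
  shows "Bochner_Integration.simple_bochner_integrable M (\<lambda>x. indicator A x *\<^sub>R c)"
    and "Bochner_Integration.simple_bochner_integral M (\<lambda>x. indicator A x *\<^sub>R c) = measure M A *\<^sub>R c"
proof -
  have ind: "Bochner_Integration.simple_bochner_integrable M (indicator A :: _ \<Rightarrow> real)"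
  proof
    have "{x\<in>space M. indicator A x \<noteq> (0::real)} = A"
      using sets.sets_into_space[OF A(1)] by (auto split: split_indicator)
    then show "emeasure M {x\<in>space M. indicator A x \<noteq> (0::real)} \<noteq> \<infinity>" using A by simp
  qed (use A in simp)
  then show "Bochner_Integration.simple_bochner_integrable M (\<lambda>x. indicator A x *\<^sub>R c)"
    using simple_bochner_integrable_compose2[of "\<lambda>x _. x *\<^sub>R c" M "indicator A :: _ \<Rightarrow> real" "indicator A :: _ \<Rightarrow> real"] by simp
  have "Bochner_Integration.simple_bochner_integral M (indicator A :: _ \<Rightarrow> real) = measure M A"
    using simple_bochner_integral_eq_nn_integral[OF ind] A
    by (simp add: ennreal_indicator emeasure_eq_ennreal_measure)
  then show "Bochner_Integration.simple_bochner_integral M (\<lambda>x. indicator A x *\<^sub>R c) = measure M A *\<^sub>R c"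
    using simple_bochner_integral_linear[OF linear_scaleR_left ind, of c] by simp
qed

text \<open>\<open>G\<close> is an indefinite Bochner integral of \<open>f\<close>; the one of the library needs a second countable
  target space. The parameter \<open>c\<close> serves both for the bound on increments and for differentiation.\<close>

lemma Bochner_integrable_indefinite:
  fixes f :: "real \<Rightarrow> 'e::banach"
  assumes int: "Bochner_integrable_on a b f"
    and meas: "\<And>c. (\<lambda>x. norm (f x - c)) \<in> borel_measurable (lebesgue_on {a..b})"
  obtains G where "\<And>s t c. a \<le> s \<Longrightarrow> s \<le> t \<Longrightarrow> t \<le> b \<Longrightarrow>
    ennreal (norm (G t - G s - (t - s) *\<^sub>R c)) \<le> (\<integral>\<^sup>+x. ennreal (norm (f x - c)) * indicator {s..t} x \<partial>lebesgue_on {a..b})"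
proof -
  let ?M = "lebesgue_on {a..b}"
  let ?I = "Bochner_Integration.simple_bochner_integral ?M"
  obtain S where S: "\<And>n. Bochner_Integration.simple_bochner_integrable ?M (S n)"
    and lim: "(\<lambda>n. \<integral>\<^sup>+x. ennreal (norm (f x - S n x)) \<partial>?M) \<longlonglongrightarrow> 0"
    using int unfolding Bochner_integrable_def by blast
  define E where "E n = (\<integral>\<^sup>+x. ennreal (norm (f x - S n x)) \<partial>?M)" for n
  have simple: "simple_function ?M (S n)" for n
    using S[of n] by (auto elim: simple_bochner_integrable.cases)
  have meas_S: "(\<lambda>x. norm (f x - S n x)) \<in> borel_measurable ?M" for n
    by (rule simple_function_norm_diff_measurable[OF simple meas])
  \<comment> \<open>Cutting at {..t} makes J n t - J n s the integral over (s,t], to be compared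
    with (t - s) c, the integral of c over the same set. The cut does not increase norms, so the
    Cauchy estimate is independent of t.\<close>
  define J where "J n t = ?I (\<lambda>x. indicator {..t} x *\<^sub>R S n x)" for n t
  have cut: "Bochner_Integration.simple_bochner_integrable ?M (\<lambda>x. indicator {..t} x *\<^sub>R S n x)" for t n
    by (rule simple_bochner_integrable_lebesgue_on,
        rule simple_function_compose2[OF simple_function_indicator_lebesgue_on simple]) simp
  have diff: "Bochner_Integration.simple_bochner_integrable ?M (\<lambda>x. g x - h x)"
    if "Bochner_Integration.simple_bochner_integrable ?M g" "Bochner_Integration.simple_bochner_integrable ?M h" for g h :: "real \<Rightarrow> 'e"
    by (rule simple_bochner_integrable_compose2) (use that in auto)
  have "dist (J m t) (J n t) \<le> E m + E n" for m n t
  proof -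
    have "ennreal (norm (J m t - J n t)) = ennreal (norm (?I (\<lambda>x. indicator {..t} x *\<^sub>R S m x - indicator {..t} x *\<^sub>R S n x)))"
      unfolding J_def by (subst simple_bochner_integral_diff[OF cut cut]) simp
    also have "\<dots> \<le> (\<integral>\<^sup>+x. norm (indicator {..t} x *\<^sub>R S m x - indicator {..t} x *\<^sub>R S n x) \<partial>?M)"
      by (intro simple_bochner_integral_norm_le_nn_integral diff cut)
    also have "\<dots> \<le> (\<integral>\<^sup>+x. ennreal (norm (f x - S m x)) + ennreal (norm (f x - S n x)) \<partial>?M)"
    proof (intro nn_integral_mono)
      fix x
      have "norm (S m x - S n x) \<le> norm (f x - S m x) + norm (f x - S n x)"
        using norm_triangle_ineq4[of "f x - S n x" "f x - S m x"] by (simp add: add.commute)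
      then show "ennreal (norm (indicator {..t} x *\<^sub>R S m x - indicator {..t} x *\<^sub>R S n x)) \<le>
        ennreal (norm (f x - S m x)) + ennreal (norm (f x - S n x))"
        by (simp add: ennreal_plus[symmetric] indicator_def ennreal_leI del: ennreal_plus)
    qed
    also have "\<dots> = E m + E n"
      unfolding E_def by (rule nn_integral_add) (use meas_S in auto)
    finally show ?thesis by (simp add: dist_norm)
  qed
  note near = this
  have E0: "E \<longlonglongrightarrow> 0" using lim unfolding E_def[abs_def] .
  have "\<exists>L. (\<lambda>n. J n t) \<longlonglongrightarrow> L" for t
  proof -
    have "Cauchy (\<lambda>n. J n t)"
    proof (rule metric_CauchyI)
      fix e :: real assume e: "e > 0"
      then have "\<forall>\<^sub>F n in sequentially. E n < ennreal (e / 2)"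
        by (intro order_tendstoD(2)[OF E0]) simp
      then obtain N where N: "\<And>n. n \<ge> N \<Longrightarrow> E n < ennreal (e / 2)"
        unfolding eventually_sequentially by blast
      have "dist (J m t) (J n t) < e" if "m \<ge> N" "n \<ge> N" for m n
      proof -
        have "ennreal (dist (J m t) (J n t)) < ennreal (e / 2) + ennreal (e / 2)"
          by (rule le_less_trans[OF near add_strict_mono[OF N N]]) (use that in auto)
        also have "\<dots> = ennreal e" using e by (simp add: ennreal_plus[symmetric] del: ennreal_plus)
        finally show ?thesis by (simp add: ennreal_less_iff)
      qed
      then show "\<exists>N. \<forall>m\<ge>N. \<forall>n\<ge>N. dist (J m t) (J n t) < e" by blast
    qed
    then show ?thesis using Cauchy_convergent convergent_def by blast
  qed
  then obtain G where G: "\<And>t. (\<lambda>n. J n t) \<longlonglongrightarrow> G t" by metis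
  have "ennreal (norm (G t - G s - (t - s) *\<^sub>R c)) \<le> (\<integral>\<^sup>+x. ennreal (norm (f x - c)) * indicator {s..t} x \<partial>?M)"
    if st: "a \<le> s" "s \<le> t" "t \<le> b" for s t c
  proof -
    let ?X = "\<integral>\<^sup>+x. ennreal (norm (f x - c)) * indicator {s..t} x \<partial>?M"
    have sets: "{s<..t} \<in> sets ?M" "emeasure ?M {s<..t} = ennreal (t - s)"
      using st by (auto simp: sets_restrict_space_iff emeasure_restrict_space subset_iff)
    have "ennreal (norm (J n t - J n s - (t - s) *\<^sub>R c)) \<le> ?X + E n" for n
    proof -
      have c: "(t - s) *\<^sub>R c = ?I (\<lambda>x. indicator {s<..t} x *\<^sub>R c)"
        using sets st by (subst simple_bochner_integral_indicator(2)) (auto simp: measure_def)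
      have ci: "Bochner_Integration.simple_bochner_integrable ?M (\<lambda>x. indicator {s<..t} x *\<^sub>R c)"
        by (rule simple_bochner_integral_indicator(1)) (use sets in auto)
      have "ennreal (norm (J n t - J n s - (t - s) *\<^sub>R c)) =
        ennreal (norm (?I (\<lambda>x. indicator {..t} x *\<^sub>R S n x - indicator {..s} x *\<^sub>R S n x - indicator {s<..t} x *\<^sub>R c)))"
        unfolding J_def c
        by (subst simple_bochner_integral_diff[OF diff[OF cut cut] ci], subst simple_bochner_integral_diff[OF cut cut]) simp
      also have "\<dots> \<le> (\<integral>\<^sup>+x. norm (indicator {..t} x *\<^sub>R S n x - indicator {..s} x *\<^sub>R S n x - indicator {s<..t} x *\<^sub>R c) \<partial>?M)"
        by (intro simple_bochner_integral_norm_le_nn_integral diff cut ci)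
      also have "\<dots> \<le> (\<integral>\<^sup>+x. ennreal (norm (f x - c)) * indicator {s..t} x + ennreal (norm (f x - S n x)) \<partial>?M)"
      proof (intro nn_integral_mono)
        fix x
        have "norm (S n x - c) \<le> norm (f x - c) + norm (f x - S n x)"
          using norm_triangle_ineq4[of "f x - c" "f x - S n x"] by simp
        then show "ennreal (norm (indicator {..t} x *\<^sub>R S n x - indicator {..s} x *\<^sub>R S n x - indicator {s<..t} x *\<^sub>R c)) \<le>
          ennreal (norm (f x - c)) * indicator {s..t} x + ennreal (norm (f x - S n x))"
          using st by (auto simp: ennreal_plus[symmetric] indicator_def ennreal_leI simp del: ennreal_plus)
      qed
      also have "\<dots> = ?X + E n"
        unfolding E_def using meas_S meas st
        by (intro nn_integral_add borel_measurable_times_ennreal borel_measurable_indicator) (auto simp: sets_restrict_space_iff subset_iff)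
      finally show ?thesis .
    qed
    moreover have "(\<lambda>n. ennreal (norm (J n t - J n s - (t - s) *\<^sub>R c))) \<longlonglongrightarrow> ennreal (norm (G t - G s - (t - s) *\<^sub>R c))"
      by (intro tendsto_ennrealI tendsto_intros G)
    moreover have "(\<lambda>n. ?X + E n) \<longlonglongrightarrow> ?X + 0"
      by (intro tendsto_add tendsto_const E0)
    ultimately show ?thesis
      using LIMSEQ_le by (metis (no_types, lifting) add.right_neutral)
  qed
  then show thesis by (rule that)
qed

section \<open>Integrability of right regulated mappings\<close>

context right_regulated_interval begin

text \<open>The end points are included because \<open>isCont\<close> is two-sided and the values of
  \<open>A\<close> outside [a,b] are arbitrary.\<close>

definition exceptional :: "real set" where
  "exceptional = insert a (insert b {t \<in> {a<..<b}. \<not> isCont A t})"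

lemma countable_exceptional: "countable exceptional"
  unfolding exceptional_def using countable_discontinuities by simp

lemma not_exceptionalD: "t \<in> {a..b} \<Longrightarrow> t \<notin> exceptional \<Longrightarrow> a < t \<and> t < b \<and> isCont A t"
  by (auto simp: exceptional_def)

text \<open>Extended by 0 to the line, the function is continuous outside a countable set; possible
  jumps at a and b are covered by \<open>exceptional\<close>.\<close>

lemma norm_diff_measurable: "(\<lambda>x. norm (A x - c)) \<in> borel_measurable (lebesgue_on {a..b})"
proof -
  define f where "f x = (if x \<in> {a..b} then norm (A x - c) else 0)" for x
  have "isCont f x" if x: "x \<notin> exceptional" for x
  proof (cases "x \<in> {a..b}")
    case True
    with x have x: "a < x" "x < b" "isCont A x" using not_exceptionalD by auto
    have "\<forall>\<^sub>F y in nhds x. y \<in> {a<..<b}" using x by (intro eventually_nhds_in_open) auto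
    then have "\<forall>\<^sub>F y in nhds x. f y = norm (A y - c)" by eventually_elim (simp add: f_def)
    then have "isCont f x \<longleftrightarrow> isCont (\<lambda>x. norm (A x - c)) x" by (rule isCont_cong)
    then show ?thesis using x by (simp add: continuous_intros)
  next
    case False
    have "\<forall>\<^sub>F y in nhds x. y \<in> - {a..b}" using False by (intro eventually_nhds_in_open) auto
    then have "\<forall>\<^sub>F y in nhds x. f y = 0" by eventually_elim (auto simp: f_def)
    then have "isCont f x \<longleftrightarrow> isCont (\<lambda>x. 0 :: real) x" by (rule isCont_cong)
    then show ?thesis by simp
  qed
  then have "f \<in> borel_measurable borel"
    by (intro borel_measurable_continuous_countable_exceptions[OF countable_exceptional]
        continuous_at_imp_continuous_on) auto
  then have "f \<in> borel_measurable (lebesgue_on {a..b})"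
    by (intro measurable_restrict_space1 measurable_completion) simp
  then show ?thesis
    by (subst measurable_cong[where g=f]) (auto simp: f_def)
qed

lemma norm_measurable: "(\<lambda>x. norm (A x)) \<in> borel_measurable (lebesgue_on {a..b})"
  using norm_diff_measurable[of 0] by simp

text \<open>One approximation with error below 1 suffices, as simple Bochner integrable functions
  have norms of finite integral.\<close>

lemma Bochner_integrable_imp_finite:
  assumes "Bochner_integrable_on a b A"
  shows "(\<integral>\<^sup>+x. norm (A x) \<partial>lebesgue_on {a..b}) < \<infinity>"
proof -
  let ?M = "lebesgue_on {a..b}"
  obtain S where S: "\<And>n. Bochner_Integration.simple_bochner_integrable ?M (S n)"
    and lim: "(\<lambda>n. \<integral>\<^sup>+x. ennreal (norm (A x - S n x)) \<partial>?M) \<longlonglongrightarrow> 0"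
    using assms unfolding Bochner_integrable_def by blast
  have "\<forall>\<^sub>F n in sequentially. (\<integral>\<^sup>+x. ennreal (norm (A x - S n x)) \<partial>?M) < 1"
    by (rule order_tendstoD(2)[OF lim]) simp
  then obtain n where n: "(\<integral>\<^sup>+x. ennreal (norm (A x - S n x)) \<partial>?M) < 1"
    unfolding eventually_sequentially by blast
  have simple: "simple_function ?M (S n)"
    using S[of n] by (auto elim: simple_bochner_integrable.cases)
  have norm_S: "Bochner_Integration.simple_bochner_integrable ?M (\<lambda>x. norm (S n x))"
    using simple_bochner_integrable_compose2[of "\<lambda>x _. norm x" ?M "S n" "S n"] S by simp
  have "(\<integral>\<^sup>+x. norm (A x) \<partial>?M) \<le> (\<integral>\<^sup>+x. ennreal (norm (A x - S n x)) + ennreal (norm (S n x)) \<partial>?M)"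
  proof (rule nn_integral_mono)
    fix x
    show "ennreal (norm (A x)) \<le> ennreal (norm (A x - S n x)) + ennreal (norm (S n x))"
      using norm_triangle_sub[of "A x" "S n x"]
      by (simp add: ennreal_plus[symmetric] ennreal_leI add.commute del: ennreal_plus)
  qed
  also have "\<dots> = (\<integral>\<^sup>+x. ennreal (norm (A x - S n x)) \<partial>?M) + (\<integral>\<^sup>+x. norm (S n x) \<partial>?M)"
    using simple_function_norm_diff_measurable[OF simple norm_diff_measurable]
      borel_measurable_simple_function[OF simple_function_compose1[OF simple, of norm]]
    by (intro nn_integral_add) auto
  also have "(\<integral>\<^sup>+x. norm (S n x) \<partial>?M) = ennreal (Bochner_Integration.simple_bochner_integral ?M (\<lambda>x. norm (S n x)))"
    by (rule simple_bochner_integral_eq_nn_integral[symmetric, OF norm_S]) simp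
  also have "(\<integral>\<^sup>+x. ennreal (norm (A x - S n x)) \<partial>?M) + \<dots> < \<infinity>"
    using n by (auto simp: less_top[symmetric] intro: order.strict_trans)
  finally show ?thesis .
qed

text \<open>The simple approximations sample \<open>A\<close> on a grid; the values that are too large compared to
  \<open>norm (A x)\<close> are replaced by \<open>0\<close> to have a dominating function.\<close>

lemma Bochner_integrable_if_finite:
  assumes fin: "(\<integral>\<^sup>+x. norm (A x) \<partial>lebesgue_on {a..b}) < \<infinity>"
  shows "Bochner_integrable_on a b A"
proof -
  let ?M = "lebesgue_on {a..b}"
  \<comment> \<open>The grid point of mesh 1/(n+1) just left of x, or x itself. The grid starts at
    a, so samples stay in [a,b].\<close>
  define q where "q n x = a + of_int \<lfloor>(x - a) * Suc n\<rfloor> / Suc n" for n :: nat and x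
  define S where "S n x = (if norm (A (q n x)) \<le> norm (A x) + 1 then A (q n x) else 0)" for n x
  have q_simple: "simple_function ?M (q n)" for n
  proof (rule simple_function_borel_measurable)
    have "q n \<in> borel_measurable borel" unfolding q_def by measurable
    then show "q n \<in> borel_measurable ?M"
      by (intro measurable_restrict_space1 measurable_completion) simp
    show "finite (q n ` space ?M)"
    proof (rule finite_subset)
      show "q n ` space ?M \<subseteq> (\<lambda>k. a + of_int k / Suc n) ` {0..\<lfloor>(b - a) * Suc n\<rfloor>}"
      proof
        fix y assume "y \<in> q n ` space ?M"
        then obtain x where x: "a \<le> x" "x \<le> b" "y = q n x" by auto
        then have "\<lfloor>(x - a) * Suc n\<rfloor> \<in> {0..\<lfloor>(b - a) * Suc n\<rfloor>}"
          by (auto intro!: floor_mono mult_right_mono)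
        then show "y \<in> (\<lambda>k. a + of_int k / Suc n) ` {0..\<lfloor>(b - a) * Suc n\<rfloor>}"
          using x unfolding q_def by blast
      qed
    qed simp
  qed
  have Aq: "simple_function ?M (\<lambda>x. A (q n x))" for n
    by (rule simple_function_compose1[OF q_simple])
  have S_simple: "simple_function ?M (S n)" for n
    unfolding S_def
  proof (rule simple_function_If[OF Aq])
    have [measurable]: "(\<lambda>x. norm (A (q n x))) \<in> borel_measurable ?M"
      by (rule borel_measurable_simple_function[OF simple_function_compose1[OF Aq]])
    note norm_measurable[measurable]
    show "{x \<in> space ?M. norm (A (q n x)) \<le> norm (A x) + 1} \<in> sets ?M" by measurable
  qed simp
  have conv: "(\<lambda>n. S n x) \<longlonglongrightarrow> A x" if x: "x \<in> {a..b}" "x \<notin> exceptional" for x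
  proof -
    have cont: "isCont A x" using not_exceptionalD x by blast
    have "(\<lambda>n. q n x) \<longlonglongrightarrow> x"
    proof (rule tendsto_sandwich)
      have "x - 1 / Suc n \<le> q n x \<and> q n x \<le> x" for n
      proof -
        have N: "real (Suc n) > 0" by simp
        have "(x - a) * Suc n - 1 \<le> of_int \<lfloor>(x - a) * Suc n\<rfloor>" "of_int \<lfloor>(x - a) * Suc n\<rfloor> \<le> (x - a) * Suc n"
          by linarith+
        then have "((x - a) * Suc n - 1) / Suc n \<le> of_int \<lfloor>(x - a) * Suc n\<rfloor> / Suc n"
          "of_int \<lfloor>(x - a) * Suc n\<rfloor> / Suc n \<le> (x - a) * Suc n / Suc n"
          using N by (intro divide_right_mono; simp)+
        then show ?thesis using N by (simp add: q_def diff_divide_distrib)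
      qed
      then show "\<forall>\<^sub>F n in sequentially. x - 1 / Suc n \<le> q n x" "\<forall>\<^sub>F n in sequentially. q n x \<le> x" by auto
      show "(\<lambda>n. x - 1 / Suc n) \<longlonglongrightarrow> x"
        using tendsto_diff[OF tendsto_const LIMSEQ_Suc[OF lim_const_over_n[of 1]], of x] by simp
    qed simp
    then have lim: "(\<lambda>n. A (q n x)) \<longlonglongrightarrow> A x" by (rule isCont_tendsto_compose[OF cont])
    \<comment> \<open>The slack 1 in the threshold ensures that near a continuity point the sampled
      value is eventually kept.\<close>
    have "\<forall>\<^sub>F n in sequentially. norm (A (q n x)) < norm (A x) + 1"
      by (rule order_tendstoD(2)[OF tendsto_norm[OF lim]]) simp
    then have "\<forall>\<^sub>F n in sequentially. A (q n x) = S n x"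
      by eventually_elim (simp add: S_def)
    with lim show ?thesis by (rule Lim_transform_eventually)
  qed
  have AE_conv: "AE x in ?M. (\<lambda>n. S n x) \<longlonglongrightarrow> A x"
    using AE_lebesgue_on_notin_countable[OF countable_exceptional, of a b]
    by (rule AE_mp) (use conv in auto)
  have "(\<lambda>n. \<integral>\<^sup>+x. ennreal (norm (A x - S n x)) \<partial>?M) \<longlonglongrightarrow> (\<integral>\<^sup>+x. 0 \<partial>?M)"
  proof (rule nn_integral_dominated_convergence[where w="\<lambda>x. 2 * ennreal (norm (A x)) + 1"])
    show "(\<lambda>x. ennreal (norm (A x - S n x))) \<in> borel_measurable ?M" for n
      using simple_function_norm_diff_measurable[OF S_simple norm_diff_measurable] by simp
    note norm_measurable[measurable]
    show "(\<lambda>x. 2 * ennreal (norm (A x)) + 1) \<in> borel_measurable ?M" by measurable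
    have "ennreal (norm (A x - S n x)) \<le> 2 * ennreal (norm (A x)) + 1" for n x
    proof -
      have "norm (A x - S n x) \<le> norm (A x) + norm (S n x)" by (rule norm_triangle_ineq4)
      also have "norm (S n x) \<le> norm (A x) + 1" by (simp add: S_def)
      finally have "ennreal (norm (A x - S n x)) \<le> ennreal (2 * norm (A x) + 1)" by (intro ennreal_leI) simp
      also have "\<dots> = 2 * ennreal (norm (A x)) + 1" by (simp add: ennreal_mult)
      finally show ?thesis .
    qed
    then show "AE x in ?M. ennreal (norm (A x - S n x)) \<le> 2 * ennreal (norm (A x)) + 1" for n by simp
    have "(\<integral>\<^sup>+x. 2 * ennreal (norm (A x)) + 1 \<partial>?M) = 2 * (\<integral>\<^sup>+x. norm (A x) \<partial>?M) + emeasure ?M (space ?M)"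
      by (subst nn_integral_add) (auto simp: nn_integral_cmult)
    also have "\<dots> < \<infinity>"
      using fin less by (auto simp: emeasure_restrict_space ennreal_mult_less_top)
    finally show "(\<integral>\<^sup>+x. 2 * ennreal (norm (A x)) + 1 \<partial>?M) < \<infinity>" .
    show "AE x in ?M. (\<lambda>n. ennreal (norm (A x - S n x))) \<longlonglongrightarrow> 0"
      using AE_conv
    proof eventually_elim
      case (elim x)
      then have "(\<lambda>n. norm (A x - S n x)) \<longlonglongrightarrow> norm (A x - A x)" by (intro tendsto_intros)
      then show ?case using tendsto_ennrealI by fastforce
    qed
  qed simp
  then show ?thesis
    unfolding Bochner_integrable_def
    using AE_conv simple_bochner_integrable_lebesgue_on[OF S_simple] by (intro exI[of _ S]) simp
qed

lemma Bochner_integrable_iff_finite: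
  "Bochner_integrable_on a b A \<longleftrightarrow> (\<integral>\<^sup>+x. norm (A x) \<partial>lebesgue_on {a..b}) < \<infinity>"
  using Bochner_integrable_imp_finite Bochner_integrable_if_finite by blast

text \<open>A bounded difference has finite integral over [a,b], and \<open>C\<close> is a null set.
  It is applied with \<open>A\<close> and its step map in either role.\<close>

lemma nn_integral_norm_finite_perturb:
  assumes B: "right_regulated a b B" and C: "countable C"
    and close: "\<And>x. x \<in> {a..b} \<Longrightarrow> x \<notin> C \<Longrightarrow> norm (A x - B x) \<le> \<epsilon>"
    and fin: "(\<integral>\<^sup>+x. norm (B x) \<partial>lebesgue_on {a..b}) < \<infinity>"
  shows "(\<integral>\<^sup>+x. norm (A x) \<partial>lebesgue_on {a..b}) < \<infinity>"
proof -
  let ?M = "lebesgue_on {a..b}"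
  interpret B: right_regulated_interval a b B by unfold_locales (use less B in auto)
  have le: "ennreal (norm (A x)) \<le> ennreal (norm (B x)) + ennreal \<epsilon>" if "x \<in> {a..b}" "x \<notin> C" for x
  proof -
    have "0 \<le> \<epsilon>" using close[OF that] norm_ge_zero order_trans by blast
    moreover have "norm (A x) \<le> norm (B x) + \<epsilon>"
      using close[OF that] norm_triangle_sub[of "A x" "B x"] by simp
    ultimately show ?thesis by (simp add: ennreal_plus[symmetric] ennreal_leI del: ennreal_plus)
  qed
  have "(\<integral>\<^sup>+x. norm (A x) \<partial>?M) \<le> (\<integral>\<^sup>+x. ennreal (norm (B x)) + ennreal \<epsilon> \<partial>?M)"
    by (rule nn_integral_mono_AE, rule AE_mp[OF AE_lebesgue_on_notin_countable[OF C]]) (use le in auto)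
  also have "\<dots> = (\<integral>\<^sup>+x. norm (B x) \<partial>?M) + ennreal \<epsilon> * emeasure ?M (space ?M)"
    using B.norm_measurable by (subst nn_integral_add) auto
  also have "\<dots> < \<infinity>"
    using fin less by (auto simp: emeasure_restrict_space ennreal_mult_less_top)
  finally show ?thesis .
qed

lemma Bochner_integrable_step_map_iff:
  assumes eps: "\<epsilon> > 0"
  shows "Bochner_integrable_on a b (step_map a b A \<epsilon>) \<longleftrightarrow> Bochner_integrable_on a b A"
proof -
  interpret B: right_regulated_interval a b "step_map a b A \<epsilon>"
    by unfold_locales (use less right_regulated_step_map[OF eps] in auto)
  show ?thesis
    unfolding B.Bochner_integrable_iff_finite Bochner_integrable_iff_finite
    using nn_integral_norm_finite_perturb[OF B.right_regulated countable_osc_set_below[OF eps] norm_diff_step_map[OF eps]]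
      B.nn_integral_norm_finite_perturb[OF right_regulated countable_osc_set_below[OF eps], of \<epsilon>]
      norm_diff_step_map[OF eps] by (auto simp: norm_minus_commute)
qed

text \<open>Tonelli over the countable index set: integrating the step map piece by piece turns the
  integral of its norm into the given sum.\<close>

lemma summable_imp_Bochner_integrable:
  assumes eps: "\<epsilon> > 0"
    and sum: "(\<lambda>\<beta>. (successor (osc_set a b A \<epsilon>) \<beta> - \<beta>) * norm (right_lim A \<beta>)) summable_on osc_set_below a b A \<epsilon>"
  shows "Bochner_integrable_on a b A"
proof -
  let ?M = "lebesgue_on {a..b}" and ?L = "osc_set_below a b A \<epsilon>"
  define S where "S = successor (osc_set a b A \<epsilon>)"
  define y where "y \<beta> = (S \<beta> - \<beta>) * norm (right_lim A \<beta>)" for \<beta>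
  define B where "B = step_map a b A \<epsilon>"
  interpret B: right_regulated_interval a b B
    unfolding B_def by unfold_locales (use less right_regulated_step_map[OF eps] in auto)
  note below = osc_set_below[OF eps, folded S_def]
  note countable = countable_osc_set_below[OF eps]
  have J: "{\<beta>..<S \<beta>} \<in> sets ?M" "emeasure ?M {\<beta>..<S \<beta>} = ennreal (S \<beta> - \<beta>)" if "\<beta> \<in> ?L" for \<beta>
    using below[OF that] by (auto simp: sets_restrict_space_iff emeasure_restrict_space subset_iff)
  \<comment> \<open>An upper bound suffices, so only the term of the interval containing x is used.
    The point b lies in none of the half-open intervals.\<close>
  have le: "ennreal (norm (B x)) \<le> (\<integral>\<^sup>+\<beta>. ennreal (norm (right_lim A \<beta>)) * indicator {\<beta>..<S \<beta>} x \<partial>count_space ?L)"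
    if x: "x \<in> {a..b}" "x \<notin> {b}" for x
  proof -
    obtain \<beta> where b: "\<beta> \<in> ?L" "\<beta> \<le> x" "x < S \<beta>"
      using osc_set_belowE[OF eps, of x] x unfolding S_def by auto
    have "ennreal (norm (B x)) = ennreal (norm (right_lim A \<beta>)) * indicator {\<beta>..<S \<beta>} x"
      using step_map_eq[OF eps b(1)] b by (simp add: B_def S_def)
    also have "\<dots> \<le> (\<integral>\<^sup>+\<beta>. ennreal (norm (right_lim A \<beta>)) * indicator {\<beta>..<S \<beta>} x \<partial>count_space ?L)"
      by (rule nn_integral_ge_point[OF b(1)])
    finally show ?thesis .
  qed
  have "(\<integral>\<^sup>+x. norm (B x) \<partial>?M) \<le>
    (\<integral>\<^sup>+x. \<integral>\<^sup>+\<beta>. ennreal (norm (right_lim A \<beta>)) * indicator {\<beta>..<S \<beta>} x \<partial>count_space ?L \<partial>?M)"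
    by (rule nn_integral_mono_AE, rule AE_mp[OF AE_lebesgue_on_notin_countable[of "{b}"]]) (use le in auto)
  also have "\<dots> = (\<integral>\<^sup>+\<beta>. \<integral>\<^sup>+x. ennreal (norm (right_lim A \<beta>)) * indicator {\<beta>..<S \<beta>} x \<partial>?M \<partial>count_space ?L)"
    using J by (intro nn_integral_count_space_nn_integral countable) auto
  also have "\<dots> = (\<integral>\<^sup>+\<beta>. ennreal (y \<beta>) \<partial>count_space ?L)"
    using J below(3) by (intro nn_integral_cong)
      (auto simp: nn_integral_cmult_indicator y_def ennreal_mult[symmetric] less_imp_le mult.commute)
  also have "\<dots> < \<infinity>"
  proof -
    have "y summable_on ?L" using sum by (simp add: y_def[abs_def] S_def)
    then have "(\<lambda>\<beta>. norm (y \<beta>)) summable_on ?L"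
      by (rule summable_on_cong[THEN iffD1, rotated]) (use below(3) in \<open>auto simp: y_def abs_mult less_imp_le\<close>)
    then have "integrable (count_space ?L) y"
      using abs_summable_equivalent[of y ?L] by (simp add: abs_summable_on_def)
    then have "(\<integral>\<^sup>+\<beta>. ennreal (norm (y \<beta>)) \<partial>count_space ?L) < \<infinity>"
      by (simp add: integrable_iff_bounded)
    moreover have "(\<integral>\<^sup>+\<beta>. ennreal (y \<beta>) \<partial>count_space ?L) \<le> (\<integral>\<^sup>+\<beta>. ennreal (norm (y \<beta>)) \<partial>count_space ?L)"
      by (intro nn_integral_mono ennreal_leI) simp
    ultimately show ?thesis by (rule le_less_trans[rotated])
  qed
  finally show ?thesis
    using B.Bochner_integrable_iff_finite Bochner_integrable_step_map_iff[OF eps] by (simp add: B_def)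
qed

end

text \<open>The estimate for \<open>G\<close> enters twice: c = 0 gives domination by the integral
  of the norm, and c = A \<xi> gives the approximation of increments at a continuity point
  \<xi>.\<close>

lemma Bochner_integrable_imp_strongly_McShane:
  fixes A :: "real \<Rightarrow> 'e::{real_normed_algebra_1, banach}"
  assumes "a < b" "right_regulated a b A" and int: "Bochner_integrable_on a b A"
  shows "strongly_McShane_product_integrable a b A"
proof -
  interpret right_regulated_interval a b A by unfold_locales fact+
  let ?M = "lebesgue_on {a..b}"
  obtain G where G: "\<And>s t c. a \<le> s \<Longrightarrow> s \<le> t \<Longrightarrow> t \<le> b \<Longrightarrow>
    ennreal (norm (G t - G s - (t - s) *\<^sub>R c)) \<le> (\<integral>\<^sup>+x. ennreal (norm (A x - c)) * indicator {s..t} x \<partial>?M)"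
    using Bochner_integrable_indefinite[OF int norm_diff_measurable] by blast
  define N where "N x = norm (A x)" for x
  define V where "V t = integral {a..t} N" for t
  have "integrable ?M N"
    using norm_measurable Bochner_integrable_imp_finite[OF int]
    unfolding N_def by (intro integrableI_bounded) auto
  then have N: "N integrable_on {a..b}" by (rule integrable_on_lebesgue_on) simp
  have sub: "N integrable_on {s..t}" if "a \<le> s" "t \<le> b" for s t
    using that by (intro integrable_on_subinterval[OF N]) auto
  interpret controlled_increments a b G V
  proof
    show "a \<le> b" using \<open>a < b\<close> by simp
    show "continuous_on {a..b} V"
      unfolding V_def by (rule indefinite_integral_continuous_1[OF N])
    fix s t assume st: "a \<le> s" "s \<le> t" "t \<le> b"
    have "ennreal (norm (G t - G s)) \<le> (\<integral>\<^sup>+x. ennreal (N x) * indicator {s..t} x \<partial>?M)"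
      using G[OF st, of 0] by (simp add: N_def)
    also have "\<dots> = (\<integral>\<^sup>+x. ennreal (N x) * indicator {s..t} x \<partial>lborel)"
      using st by (subst nn_integral_restrict_space)
        (auto simp: nn_integral_completion indicator_def intro!: nn_integral_cong)
    also have "\<dots> = ennreal (integral {s..t} N)"
      using st by (intro nn_integral_has_integral_lebesgue' integrable_integral sub) (auto simp: N_def)
    finally have "norm (G t - G s) \<le> integral {s..t} N"
      using st by (subst (asm) ennreal_le_iff) (auto intro!: integral_nonneg sub simp: N_def)
    also have "\<dots> = V t - V s"
      using Henstock_Kurzweil_Integration.integral_combine[of a s t N] st sub[of a t] by (simp add: V_def)
    finally show "norm (G t - G s) \<le> V t - V s" .
  qed
  show ?thesis
  proof (rule strongly_McShane_product_integrableI[OF countable_exceptional])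
    fix \<xi> e :: real assume "\<xi> \<in> {a..b} - exceptional" and e: "e > 0"
    then have "isCont A \<xi>" using not_exceptionalD by blast
    then obtain d where d: "d > 0" "\<And>x. dist x \<xi> < d \<Longrightarrow> dist (A x) (A \<xi>) < e"
      using e unfolding continuous_at_eps_delta by blast
    have "norm ((t - s) *\<^sub>R A \<xi> - (G t - G s)) \<le> e * (t - s)"
      if st: "a \<le> s" "s \<le> t" "t \<le> b" and sub: "{s..t} \<subseteq> {\<xi> - d<..<\<xi> + d}" for s t
    proof -
      have "ennreal (norm (G t - G s - (t - s) *\<^sub>R A \<xi>)) \<le>
        (\<integral>\<^sup>+x. ennreal (norm (A x - A \<xi>)) * indicator {s..t} x \<partial>?M)"
        by (rule G[OF st])
      also have "\<dots> \<le> (\<integral>\<^sup>+x. ennreal e * indicator {s..t} x \<partial>?M)"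
      proof (rule nn_integral_mono)
        fix x
        show "ennreal (norm (A x - A \<xi>)) * indicator {s..t} x \<le> ennreal e * indicator {s..t} x"
        proof (cases "x \<in> {s..t}")
          case True
          then have "dist x \<xi> < d" using subsetD[OF sub, of x] by (auto simp: dist_real_def)
          from d(2)[OF this] show ?thesis using True by (simp add: dist_norm ennreal_leI)
        qed simp
      qed
      also have "\<dots> = ennreal e * emeasure ?M {s..t}"
        using st by (intro nn_integral_cmult_indicator) (auto simp: sets_restrict_space_iff)
      also have "\<dots> = ennreal (e * (t - s))"
        using st e by (simp add: emeasure_restrict_space ennreal_mult)
      finally have "norm (G t - G s - (t - s) *\<^sub>R A \<xi>) \<le> e * (t - s)"
        using st e by (subst (asm) ennreal_le_iff) auto
      then show ?thesis by (subst norm_minus_commute)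
    qed
    then show "\<exists>d>0. \<forall>s t. a \<le> s \<longrightarrow> s \<le> t \<longrightarrow> t \<le> b \<longrightarrow> {s..t} \<subseteq> {\<xi> - d<..<\<xi> + d} \<longrightarrow>
      norm ((t - s) *\<^sub>R A \<xi> - (G t - G s)) \<le> e * (t - s)"
      using d(1) by blast
  qed
qed

theorem theorem5p4:
  fixes A :: "real \<Rightarrow> 'e::{real_normed_algebra_1, banach}"
    and a b \<epsilon> :: real
  assumes "a < b"
    and "right_regulated a b A"
    and "\<epsilon> > 0"
  shows
    "let \<Lambda> = osc_set_below a b A \<epsilon>;
         S = successor (osc_set a b A \<epsilon>);
         P1 = strongly_McShane_product_integrable a b A;
         P2 = Bochner_integrable_on a b A;
         P3 = Bochner_integrable_on a b (step_map a b A \<epsilon>);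
         P4 = abs_summable_family \<Lambda> (\<lambda>\<beta>. (S \<beta> - \<beta>) *\<^sub>R right_lim A \<beta>);
         P5 = multipliable_family \<Lambda> (\<lambda>\<beta>. exp ((S \<beta> - \<beta>) * norm (right_lim A \<beta>)));
         P6 = multipliable_family \<Lambda> (\<lambda>\<beta>. 1 + (S \<beta> - \<beta>) * norm (right_lim A \<beta>))
     in (P1 \<longleftrightarrow> P2) \<and> (P2 \<longleftrightarrow> P3) \<and> (P3 \<longleftrightarrow> P4) \<and> (P4 \<longleftrightarrow> P5) \<and> (P5 \<longleftrightarrow> P6)"
proof -
  interpret right_regulated_interval a b A by unfold_locales fact+
  define \<Lambda> where "\<Lambda> = osc_set_below a b A \<epsilon>"
  define S where "S = successor (osc_set a b A \<epsilon>)"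
  \<comment> \<open>Each of the three statements on families is reduced to unordered summability of
    this \<open>y\<close>.\<close>
  define y where "y \<beta> = (S \<beta> - \<beta>) * norm (right_lim A \<beta>)" for \<beta>
  have S: "\<beta> < S \<beta>" if "\<beta> \<in> \<Lambda>" for \<beta>
    using that osc_set_below(3)[OF \<open>\<epsilon> > 0\<close>] by (simp add: \<Lambda>_def S_def)
  have y: "0 \<le> y \<beta>" if "\<beta> \<in> \<Lambda>" for \<beta> using S[OF that] by (simp add: y_def)
  have wf: "wfp_on \<Lambda> (<)" and bdd: "bdd_above \<Lambda>" and ne: "\<Lambda> \<noteq> {}"
    unfolding \<Lambda>_def using wfp_on_osc_set_below bdd_above_osc_set_below osc_set_below_nonempty \<open>\<epsilon> > 0\<close> by auto
  note family_iff = summable_family_iff_summable_on[OF wf bdd ne]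
  have "abs_summable_family \<Lambda> (\<lambda>\<beta>. (S \<beta> - \<beta>) *\<^sub>R right_lim A \<beta>) \<longleftrightarrow>
      (\<lambda>\<beta>. norm ((S \<beta> - \<beta>) *\<^sub>R right_lim A \<beta>)) summable_on \<Lambda>"
    unfolding abs_summable_family_def by (rule family_iff) simp
  also have "\<dots> \<longleftrightarrow> y summable_on \<Lambda>"
    by (rule summable_on_cong) (use S in \<open>auto simp: y_def less_imp_le\<close>)
  finally have P4: "abs_summable_family \<Lambda> (\<lambda>\<beta>. (S \<beta> - \<beta>) *\<^sub>R right_lim A \<beta>) \<longleftrightarrow> y summable_on \<Lambda>" .
  have P5: "multipliable_family \<Lambda> (\<lambda>\<beta>. exp (y \<beta>)) \<longleftrightarrow> y summable_on \<Lambda>"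
    using y family_iff[of y] by (subst multipliable_family_iff_summable_family_ln[OF wf bdd]) auto
  have P6: "multipliable_family \<Lambda> (\<lambda>\<beta>. 1 + y \<beta>) \<longleftrightarrow> y summable_on \<Lambda>"
    using y family_iff[of "\<lambda>\<beta>. ln (1 + y \<beta>)"] summable_on_ln_one_plus_iff[of \<Lambda> y]
    by (subst multipliable_family_iff_summable_family_ln[OF wf bdd]) auto
  have P14: "strongly_McShane_product_integrable a b A \<Longrightarrow> y summable_on \<Lambda>"
    using strongly_McShane_imp_summable[OF assms] unfolding y_def[abs_def] S_def \<Lambda>_def .
  have P42: "y summable_on \<Lambda> \<Longrightarrow> Bochner_integrable_on a b A"
    using summable_imp_Bochner_integrable[OF \<open>\<epsilon> > 0\<close>] unfolding y_def[abs_def] S_def \<Lambda>_def .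
  note P21 = Bochner_integrable_imp_strongly_McShane[OF assms(1,2)]
  show ?thesis
    unfolding Let_def \<Lambda>_def[symmetric] S_def[symmetric] y_def[symmetric] P4 P5 P6
      Bochner_integrable_step_map_iff[OF \<open>\<epsilon> > 0\<close>]
    using P14 P42 P21 by blast
qed

end
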